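(* Let $L=\mathbb{Q}(\xi)$ be a totally real number field of degree $n$ with discriminant $D_L$, where $\xi$ is a root of a monic irreducible polynomial $f(x)\in\mathbb{Z}[x]$ of degree $n$ all of whose roots are real. Let $d>0$ be a square-free integer, let $M=\mathbb{Q}(i\sqrt d)$ with discriminant $D_M$, and assume $\gcd(D_L,D_M)=1$. Let $\omega=i\sqrt d$ if $-d\equiv 2,3\pmod 4$ and $\omega=\frac{1+i\sqrt d}{2}$ if $-d\equiv 1\pmod 4$. Let $K=LM$ be the composite field. If $-d\neq -1,-3$, then every generator $\alpha$ of a power integral basis of $K$ is of the form $$\alpha=x+\beta\pm\omega,$$ where $\beta$ generates a power integral basis in $L$ and $x\in\mathbb{Z}$.
   Context: For a number field $F$ with ring of integers $\mathbb{Z}_F$, an element $\alpha\in\mathbb{Z}_F$ generates a power integral basis in $F$ (is a generator of a power integral basis of $F$) if $\mathbb{Z}_F=\mathbb{Z}[\alpha]$, i.e. $(1,\alpha,\ldots,\alpha^{m-1})$ is an integral basis of $F$, where $m=[F:\mathbb{Q}]$. *)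

theory Defs
  imports
    Complex_Main
    "HOL-Library.FuncSet"
    "HOL-Computational_Algebra.Computational_Algebra"
    "Jordan_Normal_Form.Determinant"
begin

section \<open>Number fields inside the complex numbers\<close>

definition complex_subfield :: "complex set \<Rightarrow> bool" where
  "complex_subfield F \<longleftrightarrow>
     1 \<in> F \<and> (\<forall>x\<in>F. \<forall>y\<in>F. x - y \<in> F \<and> x * y \<in> F) \<and> (\<forall>x\<in>F. inverse x \<in> F)"

definition adjoin_rat :: "complex set \<Rightarrow> complex set" where
  "adjoin_rat S = complex_subfield hull S"

definition composite :: "complex set \<Rightarrow> complex set \<Rightarrow> complex set" where
  "composite F G = complex_subfield hull (F \<union> G)"

interpretation rat_vs: vector_space "\<lambda>(q::rat) (z::complex). of_rat q * z"
  by unfold_locales (simp_all add: algebra_simps of_rat_add of_rat_mult)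

interpretation int_mod: Modules.module "\<lambda>(k::int) (z::complex). of_int k * z"
  by unfold_locales (simp_all add: algebra_simps)

definition number_field :: "complex set \<Rightarrow> bool" where
  "number_field F \<longleftrightarrow> complex_subfield F \<and> (\<exists>B. finite B \<and> rat_vs.span B = F)"

definition field_degree :: "complex set \<Rightarrow> nat" where
  "field_degree F = rat_vs.dim F"

text \<open>Embeddings are only determined on \<open>F\<close>; requiring extensionality makes
  the set of embeddings finite, so that the trace is a genuine finite sum.\<close>

definition embeddings :: "complex set \<Rightarrow> (complex \<Rightarrow> complex) set" where
  "embeddings F = {\<sigma> \<in> extensional F. \<sigma> 1 = 1 \<and>
     (\<forall>x\<in>F. \<forall>y\<in>F. \<sigma> (x + y) = \<sigma> x + \<sigma> y \<and> \<sigma> (x * y) = \<sigma> x * \<sigma> y)}"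

definition totally_real :: "complex set \<Rightarrow> bool" where
  "totally_real F \<longleftrightarrow> number_field F \<and> (\<forall>\<sigma>\<in>embeddings F. \<sigma> ` F \<subseteq> \<real>)"

definition field_trace :: "complex set \<Rightarrow> complex \<Rightarrow> complex" where
  "field_trace F x = (\<Sum>\<sigma>\<in>embeddings F. \<sigma> x)"


section \<open>Rings of integers, discriminants and power integral bases\<close>

definition ring_of_integers :: "complex set \<Rightarrow> complex set" where
  "ring_of_integers F = {x \<in> F. algebraic_int x}"

definition integral_basis :: "complex set \<Rightarrow> complex list \<Rightarrow> bool" where
  "integral_basis F bs \<longleftrightarrow>
     distinct bs \<and> int_mod.independent (set bs) \<and> int_mod.span (set bs) = ring_of_integers F"

definition basis_discriminant :: "complex set \<Rightarrow> complex list \<Rightarrow> complex" where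
  "basis_discriminant F bs =
     det (mat (length bs) (length bs) (\<lambda>(i, j). field_trace F (bs ! i * bs ! j)))"

text \<open>The value does not depend on the integral basis, because two integral bases
  differ by an integer matrix of determinant 1 or -1.\<close>

definition discriminant :: "complex set \<Rightarrow> int" where
  "discriminant F =
     (THE D. \<exists>bs. integral_basis F bs \<and> of_int D = basis_discriminant F bs)"

definition adjoin_int :: "complex \<Rightarrow> complex set" where
  "adjoin_int \<alpha> = range (\<lambda>p :: int poly. poly (map_poly of_int p) \<alpha>)"

definition generates_power_integral_basis :: "complex \<Rightarrow> complex set \<Rightarrow> bool" where
  "generates_power_integral_basis \<alpha> F \<longleftrightarrow>
     \<alpha> \<in> ring_of_integers F \<and> ring_of_integers F = adjoin_int \<alpha>"


section \<open>Imaginary quadratic fields\<close>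

definition i_sqrt :: "int \<Rightarrow> complex" where
  "i_sqrt d = \<i> * complex_of_real (sqrt (real_of_int d))"

definition quadratic_omega :: "int \<Rightarrow> complex" where
  "quadratic_omega d = (if (- d) mod 4 = 1 then (1 + i_sqrt d) / 2 else i_sqrt d)"

end

theory Submission
  imports Defs "Jordan_Normal_Form.Char_Poly"
begin

text \<open>
  Write \<open>\<omega>\<close> for the quadratic integer of \<open>M\<close> and \<open>s\<close> for its imaginary part; the exclusion of
  \<open>-1\<close> and \<open>-3\<close> says exactly that \<open>s > 1\<close>. Coprimality of the discriminants gives
  \<open>\<alpha> = a + c \<omega>\<close> with integers \<open>a, c\<close> of \<open>L\<close> (\<open>integral_coordinates\<close>). Since \<open>\<omega>\<close> is an integer polynomial
  in \<open>\<alpha>\<close>, the difference of \<open>\<omega>\<close> and its complex conjugate is a multiple of that of \<open>\<alpha>\<close>, so \<open>c\<close> is a unit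
  (\<open>c_unit\<close>). It remains to see that \<open>c = \<plusminus>1\<close> and that \<open>a\<close> generates the integers of \<open>L\<close>.

  For an embedding \<open>\<sigma>\<close> of \<open>L\<close> put \<open>\<alpha>\<^sub>\<sigma> = \<sigma> a + \<sigma> c \<omega>\<close>, and for two embeddings \<open>\<sigma> \<noteq> \<tau>\<close> consider the
  product \<open>P = (\<alpha>\<^sub>\<sigma> - \<alpha>\<^sub>\<tau>) (\<alpha>\<^sub>\<sigma> - cnj \<alpha>\<^sub>\<tau>)\<close>. An integer \<open>\<theta>\<close> of \<open>L\<close> is an integer polynomial in \<open>\<alpha>\<close>, and \<open>\<theta>\<close>
  is real, so each of the two factors divides \<open>\<sigma> \<theta> - \<tau> \<theta>\<close> in the ring of algebraic integers. The factors
  are coprime: the first divides \<open>D\<^sub>L\<close>, while their difference is a unit times the square root of \<open>D\<^sub>M\<close>.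
  Hence \<open>P\<close> itself divides \<open>\<sigma> \<theta> - \<tau> \<theta>\<close> (\<open>product_divides_difference\<close>).

  The quotient is an algebraic integer, and its conjugates are, up to complex conjugation of \<open>P\<close>,
  the same quotients for other pairs of embeddings. A nonzero algebraic integer has a conjugate of absolute
  value at least 1. So if \<open>|\<sigma> \<theta> - \<tau> \<theta>| < |P|\<close> whenever the left side is nonzero, then \<open>\<theta>\<close> is fixed
  by all embeddings and is therefore rational (\<open>fixed_if_product_dominates\<close>). As \<open>L\<close> is totally real,
  the imaginary parts of the two factors are \<open>s (\<sigma> c - \<tau> c)\<close> and \<open>s (\<sigma> c + \<tau> c)\<close>. For
  \<open>\<theta> = c\<^sup>2\<close> this gives \<open>|P| \<ge> s\<^sup>2 |\<sigma> \<theta> - \<tau> \<theta>|\<close>, so the unit \<open>c\<^sup>2\<close> is rational and \<open>c = \<plusminus>1\<close>. With this,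
  \<open>\<theta> = a\<close> gives \<open>|P| \<ge> 2 s |\<sigma> \<theta> - \<tau> \<theta>|\<close>, so \<open>a\<close> is a rational integer. But then the integers of \<open>L\<close>
  lie in \<open>\<int>[\<omega>]\<close> and are real, so they are the rational integers, which \<open>a\<close> generates trivially.
  In particular a generator can exist only if \<open>L = \<rat>\<close>.
\<close>

(* The scaling laws of_rat p * (of_rat q * x) = of_rat (p * q) * x and their integer analogue
   orient products against mult.assoc, so that rewriting with both does not terminate. *)
declare rat_vs.scale_scale [simp del] int_mod.scale_scale [simp del]

section \<open>The ring of algebraic integers\<close>

lemma algebraic_int_eigenvalue:
  fixes A :: "int mat" and z :: complex
  assumes A: "A \<in> carrier_mat n n"
    and z: "eigenvalue (map_mat of_int A) z"
  shows "algebraic_int z"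
proof -
  interpret h: comm_ring_hom "of_int :: int \<Rightarrow> complex" by unfold_locales auto
  let ?B = "map_mat of_int A :: complex mat"
  have B: "?B \<in> carrier_mat n n" using A by simp
  have cp: "char_poly ?B = map_poly of_int (char_poly A)" by (rule of_int_hom.char_poly_hom[OF A])
  show ?thesis
  proof (rule algebraic_int.intros)
    show "lead_coeff (char_poly ?B) = 1" using degree_monic_char_poly[OF B] by simp
    show "\<forall>i. coeff (char_poly ?B) i \<in> \<int>" unfolding cp by (simp add: coeff_map_poly)
    show "poly (char_poly ?B) z = 0" using z eigenvalue_root_char_poly[OF B] by simp
  qed
qed

text \<open>
  Multiplication by \<open>z\<close> maps the additive group spanned by the family \<open>w\<close> into itself. Closure of the
  algebraic integers under sums and products comes from the fact that such \<open>z\<close> form a ring, and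
  that this property characterizes integrality as soon as \<open>w\<close> is finite and not identically zero.
\<close>

definition integral_action :: "'i set \<Rightarrow> ('i \<Rightarrow> complex) \<Rightarrow> complex \<Rightarrow> bool" where
  "integral_action I w z \<longleftrightarrow>
     (\<exists>A :: 'i \<Rightarrow> 'i \<Rightarrow> int. \<forall>i\<in>I. z * w i = (\<Sum>j\<in>I. of_int (A i j) * w j))"

lemma integral_action_imp_algebraic_int:
  assumes fin: "finite I" and act: "integral_action I w z" and nz: "\<exists>i\<in>I. w i \<noteq> 0"
  shows "algebraic_int z"
proof -
  obtain A :: "'a \<Rightarrow> 'a \<Rightarrow> int" where A: "\<And>i. i \<in> I \<Longrightarrow> z * w i = (\<Sum>j\<in>I. of_int (A i j) * w j)"
    using act unfolding integral_action_def by blast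
  define n where "n = card I"
  obtain g where g: "bij_betw g {0..<n} I" using fin ex_bij_betw_nat_finite n_def by blast
  define B where "B = mat n n (\<lambda>(i, j). A (g i) (g j))"
  define v where "v = vec n (\<lambda>i. w (g i))"
  have "eigenvector (map_mat of_int B) v z"
    unfolding eigenvector_def
  proof (intro conjI)
    show "v \<in> carrier_vec (dim_row (map_mat of_int B))" by (simp add: v_def B_def)
    obtain i where "i \<in> I" "w i \<noteq> 0" using nz by blast
    then obtain k where "k < n" "w (g k) \<noteq> 0"
      using g by (metis atLeastLessThan_iff bij_betw_iff_bijections)
    then show "v \<noteq> 0\<^sub>v (dim_row (map_mat of_int B))"
      by (metis v_def B_def dim_row_mat(1) index_map_mat(2) index_vec index_zero_vec(1))
    show "map_mat of_int B *\<^sub>v v = z \<cdot>\<^sub>v v"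
    proof (rule eq_vecI)
      fix i assume "i < dim_vec (z \<cdot>\<^sub>v v)"
      then have i: "i < n" by (simp add: v_def)
      then have gi: "g i \<in> I" using g by (auto simp: bij_betw_def)
      have "(map_mat of_int B *\<^sub>v v) $ i = (\<Sum>j\<in>{0..<n}. of_int (A (g i) (g j)) * w (g j))"
        using i by (simp add: B_def v_def scalar_prod_def)
      also have "\<dots> = (\<Sum>j\<in>I. of_int (A (g i) j) * w j)"
        by (rule sum.reindex_bij_betw[OF g])
      also have "\<dots> = (z \<cdot>\<^sub>v v) $ i" using i A[OF gi] by (simp add: v_def)
      finally show "(map_mat of_int B *\<^sub>v v) $ i = (z \<cdot>\<^sub>v v) $ i" .
    qed (simp add: v_def B_def)
  qed
  moreover have "B \<in> carrier_mat n n" by (simp add: B_def)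
  ultimately show ?thesis
    using algebraic_int_eigenvalue unfolding eigenvalue_def by blast
qed

lemma integral_action_add:
  assumes "integral_action I w x" "integral_action I w y"
  shows "integral_action I w (x + y)"
proof -
  obtain A :: "'a \<Rightarrow> 'a \<Rightarrow> int" where A: "\<And>i. i \<in> I \<Longrightarrow> x * w i = (\<Sum>j\<in>I. of_int (A i j) * w j)"
    using assms(1) unfolding integral_action_def by blast
  obtain B :: "'a \<Rightarrow> 'a \<Rightarrow> int" where B: "\<And>i. i \<in> I \<Longrightarrow> y * w i = (\<Sum>j\<in>I. of_int (B i j) * w j)"
    using assms(2) unfolding integral_action_def by blast
  show ?thesis unfolding integral_action_def
    by (rule exI[of _ "\<lambda>i j. A i j + B i j"]) (simp add: A B algebra_simps sum.distrib)
qed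

lemma integral_action_mult:
  assumes "integral_action I w x" "integral_action I w y"
  shows "integral_action I w (x * y)"
proof -
  obtain A :: "'a \<Rightarrow> 'a \<Rightarrow> int" where A: "\<And>i. i \<in> I \<Longrightarrow> x * w i = (\<Sum>j\<in>I. of_int (A i j) * w j)"
    using assms(1) unfolding integral_action_def by blast
  obtain B :: "'a \<Rightarrow> 'a \<Rightarrow> int" where B: "\<And>i. i \<in> I \<Longrightarrow> y * w i = (\<Sum>j\<in>I. of_int (B i j) * w j)"
    using assms(2) unfolding integral_action_def by blast
  have "x * y * w i = (\<Sum>l\<in>I. of_int (\<Sum>j\<in>I. B i j * A j l) * w l)" if i: "i \<in> I" for i
  proof -
    have "x * y * w i = (\<Sum>j\<in>I. of_int (B i j) * (x * w j))"
      unfolding mult.assoc B[OF i] sum_distrib_left by (intro sum.cong refl) (simp only: mult.left_commute)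
    also have "\<dots> = (\<Sum>j\<in>I. \<Sum>l\<in>I. of_int (B i j * A j l) * w l)"
    proof (rule sum.cong[OF refl])
      fix j assume "j \<in> I"
      show "of_int (B i j) * (x * w j) = (\<Sum>l\<in>I. of_int (B i j * A j l) * w l)"
        unfolding A[OF \<open>j \<in> I\<close>] sum_distrib_left of_int_mult mult.assoc ..
    qed
    also have "\<dots> = (\<Sum>l\<in>I. of_int (\<Sum>j\<in>I. B i j * A j l) * w l)"
      by (subst sum.swap) (simp add: sum_distrib_right)
    finally show ?thesis .
  qed
  then show ?thesis unfolding integral_action_def
    by (intro exI[of _ "\<lambda>i l. \<Sum>j\<in>I. B i j * A j l"]) blast
qed

lemma algebraic_int_power_relation:
  fixes x :: complex
  assumes "algebraic_int x"
  shows "\<exists>m c. 0 < m \<and> x ^ m = (\<Sum>i<m. of_int (c i :: int) * x ^ i)"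
proof -
  obtain p where p: "poly (map_poly of_int p) x = 0" "lead_coeff p = (1::int)"
    using assms unfolding algebraic_int_altdef_ipoly by blast
  have "degree p \<noteq> 0"
  proof
    assume "degree p = 0"
    then obtain a where "p = [:a:]" by (metis degree_eq_zeroE)
    with p show False by (simp add: map_poly_pCons)
  qed
  have "(\<Sum>i\<le>degree p. of_int (coeff p i) * x ^ i) = 0"
    using p(1) by (simp add: poly_altdef degree_map_poly coeff_map_poly)
  then have "x ^ degree p = (\<Sum>i<degree p. of_int (- coeff p i) * x ^ i)"
    using p(2) by (simp add: lessThan_Suc_atMost[symmetric] sum_negf eq_neg_iff_add_eq_0 add.commute)
  with \<open>degree p \<noteq> 0\<close> show ?thesis
    by (intro exI[of _ "degree p"] exI[of _ "\<lambda>i. - coeff p i"]) simp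
qed

text \<open>
  Both \<open>x\<close> and \<open>y\<close> act integrally on the products \<open>x\<^sup>i y\<^sup>j\<close> with exponents below the degrees of monic
  equations for \<open>x\<close> and \<open>y\<close>: multiplication shifts an exponent, and the top exponent is reduced by the equation.
\<close>

lemma algebraic_int_add_mult:
  fixes x y :: complex
  assumes x: "algebraic_int x" and y: "algebraic_int y"
  shows "algebraic_int (x + y)" "algebraic_int (x * y)"
proof -
  obtain m and c :: "nat \<Rightarrow> int" where m: "0 < m" "x ^ m = (\<Sum>i<m. of_int (c i) * x ^ i)"
    using algebraic_int_power_relation[OF x] by blast
  obtain k and e :: "nat \<Rightarrow> int" where k: "0 < k" "y ^ k = (\<Sum>i<k. of_int (e i) * y ^ i)"
    using algebraic_int_power_relation[OF y] by blast
  define I where "I = {..<m} \<times> {..<k}"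
  define w where "w = (\<lambda>(i, j). x ^ i * y ^ j)"
  have actx: "integral_action I w x"
    unfolding integral_action_def
  proof (intro exI ballI)
    fix p assume "p \<in> I"
    then obtain i j where p: "p = (i, j)" and ij: "i < m" "j < k" by (auto simp: I_def)
    have shift: "(\<Sum>t<m. of_int (if Suc i < m then of_bool (t = Suc i) else c t) * x ^ t) = x ^ Suc i"
    proof (cases "Suc i < m")
      case True
      have "(\<Sum>t<m. of_int (of_bool (t = Suc i)) * x ^ t) = (\<Sum>t<m. if t = Suc i then x ^ t else 0)"
        by (intro sum.cong) auto
      with True show ?thesis by simp
    next
      case False
      with ij have "m = Suc i" by simp
      with m(2) show ?thesis by simp
    qed
    have "(\<Sum>q\<in>I. of_int (of_bool (snd p = snd q) * (if Suc (fst p) < m then of_bool (fst q = Suc (fst p)) else c (fst q))) * w q)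
        = (\<Sum>i'<m. \<Sum>j'<k. of_int (of_bool (j = j') * (if Suc i < m then of_bool (i' = Suc i) else c i')) * (x ^ i' * y ^ j'))"
      unfolding sum.cartesian_product I_def w_def p by (intro sum.cong) auto
    also have "\<dots> = (\<Sum>i'<m. \<Sum>j'<k. if j' = j then of_int (if Suc i < m then of_bool (i' = Suc i) else c i') * (x ^ i' * y ^ j') else 0)"
      by (intro sum.cong refl) simp
    also have "\<dots> = (\<Sum>i'<m. of_int (if Suc i < m then of_bool (i' = Suc i) else c i') * x ^ i') * y ^ j"
      unfolding sum_distrib_right using ij by (intro sum.cong refl) (simp add: mult_ac)
    also have "\<dots> = x * w p" unfolding shift by (simp add: w_def p mult_ac)
    finally show "x * w p = (\<Sum>q\<in>I. of_int (of_bool (snd p = snd q) * (if Suc (fst p) < m then of_bool (fst q = Suc (fst p)) else c (fst q))) * w q)" ..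
  qed
  have acty: "integral_action I w y"
    unfolding integral_action_def
  proof (intro exI ballI)
    fix p assume "p \<in> I"
    then obtain i j where p: "p = (i, j)" and ij: "i < m" "j < k" by (auto simp: I_def)
    have shift: "(\<Sum>t<k. of_int (if Suc j < k then of_bool (t = Suc j) else e t) * y ^ t) = y ^ Suc j"
    proof (cases "Suc j < k")
      case True
      have "(\<Sum>t<k. of_int (of_bool (t = Suc j)) * y ^ t) = (\<Sum>t<k. if t = Suc j then y ^ t else 0)"
        by (intro sum.cong) auto
      with True show ?thesis by simp
    next
      case False
      with ij have "k = Suc j" by simp
      with k(2) show ?thesis by simp
    qed
    have "(\<Sum>q\<in>I. of_int (of_bool (fst p = fst q) * (if Suc (snd p) < k then of_bool (snd q = Suc (snd p)) else e (snd q))) * w q)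
        = (\<Sum>i'<m. \<Sum>j'<k. of_int (of_bool (i = i') * (if Suc j < k then of_bool (j' = Suc j) else e j')) * (x ^ i' * y ^ j'))"
      unfolding sum.cartesian_product I_def w_def p by (intro sum.cong) auto
    also have "\<dots> = (\<Sum>j'<k. \<Sum>i'<m. if i' = i then of_int (if Suc j < k then of_bool (j' = Suc j) else e j') * (x ^ i' * y ^ j') else 0)"
      by (subst sum.swap, intro sum.cong refl) simp
    also have "\<dots> = (\<Sum>j'<k. of_int (if Suc j < k then of_bool (j' = Suc j) else e j') * y ^ j') * x ^ i"
      unfolding sum_distrib_right using ij by (intro sum.cong refl) (simp add: mult_ac)
    also have "\<dots> = y * w p" unfolding shift by (simp add: w_def p mult_ac)
    finally show "y * w p = (\<Sum>q\<in>I. of_int (of_bool (fst p = fst q) * (if Suc (snd p) < k then of_bool (snd q = Suc (snd p)) else e (snd q))) * w q)" ..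
  qed
  have fin: "finite I" by (simp add: I_def)
  have nz: "\<exists>i\<in>I. w i \<noteq> 0"
    using m(1) k(1) by (intro bexI[of _ "(0, 0)"]) (auto simp: I_def w_def)
  show "algebraic_int (x + y)" "algebraic_int (x * y)"
    using integral_action_imp_algebraic_int[OF fin _ nz]
      integral_action_add[OF actx acty] integral_action_mult[OF actx acty] by blast+
qed

lemmas algebraic_int_plus = algebraic_int_add_mult(1)
lemmas algebraic_int_times = algebraic_int_add_mult(2)

lemma algebraic_int_diff:
  "algebraic_int x \<Longrightarrow> algebraic_int y \<Longrightarrow> algebraic_int (x - y)" for x y :: complex
  using algebraic_int_plus[of x "- y"] by simp

lemma algebraic_int_of_int [simp]: "algebraic_int (of_int k :: complex)"
  by (rule int_imp_algebraic_int) simp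

lemma algebraic_int_power: "algebraic_int (x ^ k)" if "algebraic_int (x :: complex)"
  by (induction k) (auto intro: algebraic_int_times that int_imp_algebraic_int)

lemma algebraic_int_sum:
  fixes f :: "'i \<Rightarrow> complex"
  shows "(\<And>i. i \<in> I \<Longrightarrow> algebraic_int (f i)) \<Longrightarrow> algebraic_int (\<Sum>i\<in>I. f i)"
  by (induction I rule: infinite_finite_induct) (auto intro: algebraic_int_plus)

lemma algebraic_int_prod:
  fixes f :: "'i \<Rightarrow> complex"
  shows "(\<And>i. i \<in> I \<Longrightarrow> algebraic_int (f i)) \<Longrightarrow> algebraic_int (\<Prod>i\<in>I. f i)"
  by (induction I rule: infinite_finite_induct)
     (auto intro: algebraic_int_times int_imp_algebraic_int)

lemma algebraic_int_ipoly:
  fixes x :: complex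
  assumes "algebraic_int x"
  shows "algebraic_int (poly (map_poly of_int p) x)"
  by (induction p)
     (auto simp: map_poly_pCons intro!: algebraic_int_plus algebraic_int_times assms)

lemma algebraic_int_det:
  fixes A :: "complex mat"
  assumes A: "A \<in> carrier_mat n n" and int: "\<And>i j. i < n \<Longrightarrow> j < n \<Longrightarrow> algebraic_int (A $$ (i, j))"
  shows "algebraic_int (det A)"
proof -
  have "det A = (\<Sum>p\<in>{p. p permutes {0..<n}}. signof p * (\<Prod>i = 0..<n. A $$ (i, p i)))"
    using A by (simp add: det_def')
  moreover have "algebraic_int \<dots>"
  proof (intro algebraic_int_sum algebraic_int_times algebraic_int_prod int)
    fix p i assume "p \<in> {p. p permutes {0..<n}}" "i \<in> {0..<n}"
    then show "p i < n" "i < n" by (auto dest: permutes_in_image)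
  qed (auto simp: sign_def)
  ultimately show ?thesis by simp
qed

lemma ipoly_diff_divisible:
  fixes x y :: complex
  assumes x: "algebraic_int x" and y: "algebraic_int y"
  shows "\<exists>c. algebraic_int c \<and>
    poly (map_poly of_int p) x - poly (map_poly of_int p) y = (x - y) * c"
proof (induction p)
  case 0
  then show ?case by (intro exI[of _ 0]) simp
next
  case (pCons a p)
  let ?P = "\<lambda>z. poly (map_poly of_int p) z :: complex"
  obtain c where c: "algebraic_int c" "?P x - ?P y = (x - y) * c" using pCons by blast
  have "poly (map_poly of_int (pCons a p)) x - poly (map_poly of_int (pCons a p)) y
      = (x - y) * ?P x + y * (?P x - ?P y)"
    by (simp add: of_int_hom.map_poly_pCons_hom algebra_simps)
  also have "\<dots> = (x - y) * (?P x + y * c)" unfolding c(2) by (simp add: algebra_simps)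
  finally show ?case
    by (intro exI[of _ "?P x + y * c"] conjI algebraic_int_plus algebraic_int_times
        algebraic_int_ipoly x y c(1))
qed

section \<open>Subfields of the complex numbers and their homomorphisms\<close>

lemma subfield_closed:
  assumes F: "complex_subfield F"
  shows subfield_1: "1 \<in> F" and subfield_0: "0 \<in> F"
    and subfield_diff: "\<And>x y. x \<in> F \<Longrightarrow> y \<in> F \<Longrightarrow> x - y \<in> F"
    and subfield_minus: "\<And>x. x \<in> F \<Longrightarrow> - x \<in> F"
    and subfield_add: "\<And>x y. x \<in> F \<Longrightarrow> y \<in> F \<Longrightarrow> x + y \<in> F"
    and subfield_mult: "\<And>x y. x \<in> F \<Longrightarrow> y \<in> F \<Longrightarrow> x * y \<in> F"
    and subfield_inverse: "\<And>x. x \<in> F \<Longrightarrow> inverse x \<in> F"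
    and subfield_divide: "\<And>x y. x \<in> F \<Longrightarrow> y \<in> F \<Longrightarrow> x / y \<in> F"
proof -
  note d = F[unfolded complex_subfield_def]
  show one: "1 \<in> F" using d by blast
  show diff: "x - y \<in> F" if "x \<in> F" "y \<in> F" for x y using d that by blast
  show mult: "x * y \<in> F" if "x \<in> F" "y \<in> F" for x y using d that by blast
  show inv: "inverse x \<in> F" if "x \<in> F" for x using d that by blast
  show zero: "0 \<in> F" using diff[OF one one] by simp
  show minus: "- x \<in> F" if "x \<in> F" for x using diff[OF zero that] by simp
  show "x + y \<in> F" if "x \<in> F" "y \<in> F" for x y using diff[OF that(1) minus[OF that(2)]] by simp
  show "x / y \<in> F" if "x \<in> F" "y \<in> F" for x y
    using mult[OF that(1) inv[OF that(2)]] by (simp add: divide_inverse)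
qed

lemma subfield_sum:
  assumes "complex_subfield F" "\<And>i. i \<in> I \<Longrightarrow> f i \<in> F"
  shows "(\<Sum>i\<in>I. f i) \<in> F"
  using assms(2)
  by (induction I rule: infinite_finite_induct) (auto intro: subfield_0 subfield_add assms(1))

lemma subfield_power: "complex_subfield F \<Longrightarrow> x \<in> F \<Longrightarrow> x ^ k \<in> F"
  by (induction k) (auto intro: subfield_1 subfield_mult)

lemma subfield_of_nat: "complex_subfield F \<Longrightarrow> of_nat k \<in> F"
  by (induction k) (auto intro: subfield_0 subfield_1 subfield_add)

lemma subfield_of_int: "complex_subfield F \<Longrightarrow> of_int k \<in> F"
  by (cases k rule: int_cases2) (auto intro: subfield_of_nat subfield_minus)

lemma subfield_of_rat: "complex_subfield F \<Longrightarrow> of_rat q \<in> F"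
  by (cases q) (auto simp: of_rat_rat intro: subfield_of_int subfield_divide)

lemma subfield_Rats: "complex_subfield F \<Longrightarrow> \<rat> \<subseteq> F"
  by (auto elim!: Rats_cases intro: subfield_of_rat)

lemma complex_subfield_Rats: "complex_subfield \<rat>"
  unfolding complex_subfield_def by auto

definition field_hom :: "complex set \<Rightarrow> (complex \<Rightarrow> complex) \<Rightarrow> bool" where
  "field_hom F \<sigma> \<longleftrightarrow> \<sigma> 1 = 1 \<and>
     (\<forall>x\<in>F. \<forall>y\<in>F. \<sigma> (x + y) = \<sigma> x + \<sigma> y \<and> \<sigma> (x * y) = \<sigma> x * \<sigma> y)"

lemma embeddings_eq: "embeddings F = {\<sigma> \<in> extensional F. field_hom F \<sigma>}"
  by (simp add: embeddings_def field_hom_def)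

locale subfield_hom =
  fixes F :: "complex set" and \<sigma> :: "complex \<Rightarrow> complex"
  assumes sub: "complex_subfield F" and hom: "field_hom F \<sigma>"
begin

lemma hom_1: "\<sigma> 1 = 1"
  using hom by (simp add: field_hom_def)

lemma hom_add: "x \<in> F \<Longrightarrow> y \<in> F \<Longrightarrow> \<sigma> (x + y) = \<sigma> x + \<sigma> y"
  using hom by (simp add: field_hom_def)

lemma hom_mult: "x \<in> F \<Longrightarrow> y \<in> F \<Longrightarrow> \<sigma> (x * y) = \<sigma> x * \<sigma> y"
  using hom by (simp add: field_hom_def)

lemma hom_0: "\<sigma> 0 = 0"
  using hom_add[of 0 0] subfield_0[OF sub] by simp

lemma hom_minus: "x \<in> F \<Longrightarrow> \<sigma> (- x) = - \<sigma> x"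
  using hom_add[of x "- x"] subfield_minus[OF sub] hom_0 by (simp add: minus_unique)

lemma hom_diff: "x \<in> F \<Longrightarrow> y \<in> F \<Longrightarrow> \<sigma> (x - y) = \<sigma> x - \<sigma> y"
  using hom_add[of x "- y"] subfield_minus[OF sub] hom_minus by simp

lemma hom_inverse: "x \<in> F \<Longrightarrow> \<sigma> (inverse x) = inverse (\<sigma> x)"
proof (cases "x = 0")
  case False
  assume x: "x \<in> F"
  have "\<sigma> x * \<sigma> (inverse x) = 1"
    using hom_mult[OF x subfield_inverse[OF sub x]] False hom_1 by simp
  then show ?thesis by (metis inverse_unique)
qed (simp add: hom_0)

lemma hom_eq_0_iff: "x \<in> F \<Longrightarrow> \<sigma> x = 0 \<longleftrightarrow> x = 0"
proof
  assume x: "x \<in> F" and 0: "\<sigma> x = 0"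
  show "x = 0"
  proof (rule ccontr)
    assume "x \<noteq> 0"
    then have "\<sigma> x * \<sigma> (inverse x) = 1"
      using hom_mult[OF x subfield_inverse[OF sub x]] hom_1 by simp
    with 0 show False by simp
  qed
qed (simp add: hom_0)

lemma hom_sum: "(\<And>i. i \<in> I \<Longrightarrow> f i \<in> F) \<Longrightarrow> \<sigma> (\<Sum>i\<in>I. f i) = (\<Sum>i\<in>I. \<sigma> (f i))"
  by (induction I rule: infinite_finite_induct)
     (auto simp: hom_0 hom_add subfield_sum[OF sub])

lemma hom_power: "x \<in> F \<Longrightarrow> \<sigma> (x ^ k) = \<sigma> x ^ k"
  by (induction k) (auto simp: hom_1 hom_mult subfield_power[OF sub])

lemma hom_of_nat: "\<sigma> (of_nat k) = of_nat k"
  by (induction k) (auto simp: hom_0 hom_1 hom_add subfield_of_nat[OF sub] subfield_1[OF sub])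

lemma hom_of_int: "\<sigma> (of_int k) = of_int k"
  by (cases k rule: int_cases2) (auto simp: hom_of_nat hom_minus subfield_of_nat[OF sub])

lemma hom_of_rat: "\<sigma> (of_rat q) = of_rat q"
proof (cases q)
  case (Fract a b)
  have "\<sigma> (of_int a * inverse (of_int b)) = of_int a * inverse (of_int b)"
    by (simp add: hom_mult hom_inverse hom_of_int subfield_of_int[OF sub] subfield_inverse[OF sub])
  with Fract show ?thesis by (simp add: of_rat_rat divide_inverse)
qed

lemma hom_Rats: "x \<in> \<rat> \<Longrightarrow> \<sigma> x = x"
  by (auto elim!: Rats_cases simp: hom_of_rat)

end

section \<open>Polynomials over a subfield\<close>

definition polys_over :: "complex set \<Rightarrow> complex poly set" where
  "polys_over F = {p. \<forall>i. coeff p i \<in> F}"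

lemma polys_over_closed:
  assumes F: "complex_subfield F"
  shows polys_over_0: "0 \<in> polys_over F"
    and polys_over_pCons: "\<And>a p. pCons a p \<in> polys_over F \<longleftrightarrow> a \<in> F \<and> p \<in> polys_over F"
    and polys_over_add: "\<And>p q. p \<in> polys_over F \<Longrightarrow> q \<in> polys_over F \<Longrightarrow> p + q \<in> polys_over F"
    and polys_over_diff: "\<And>p q. p \<in> polys_over F \<Longrightarrow> q \<in> polys_over F \<Longrightarrow> p - q \<in> polys_over F"
    and polys_over_minus: "\<And>p. p \<in> polys_over F \<Longrightarrow> - p \<in> polys_over F"
    and polys_over_mult: "\<And>p q. p \<in> polys_over F \<Longrightarrow> q \<in> polys_over F \<Longrightarrow> p * q \<in> polys_over F"
    and polys_over_smult: "\<And>a p. a \<in> F \<Longrightarrow> p \<in> polys_over F \<Longrightarrow> Polynomial.smult a p \<in> polys_over F"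
    and polys_over_monom: "\<And>a k. a \<in> F \<Longrightarrow> monom a k \<in> polys_over F"
  unfolding polys_over_def
  by (auto simp: coeff_pCons coeff_mult all_conj_distrib split: nat.splits
      intro!: subfield_sum[OF F] intro: subfield_0[OF F] subfield_add[OF F] subfield_diff[OF F]
        subfield_minus[OF F] subfield_mult[OF F])

lemma poly_in_subfield:
  assumes F: "complex_subfield F" and "p \<in> polys_over F" "x \<in> F"
  shows "poly p x \<in> F"
  using assms(2)
  by (induction p)
     (auto simp: polys_over_pCons[OF F] intro!: subfield_add[OF F] subfield_mult[OF F] subfield_0[OF F] assms(3))

lemma polys_over_division:
  assumes F: "complex_subfield F" and g: "g \<in> polys_over F" "g \<noteq> 0"
  shows "p \<in> polys_over F \<Longrightarrow>
    \<exists>q\<in>polys_over F. \<exists>r\<in>polys_over F. p = g * q + r \<and> (r = 0 \<or> degree r < degree g)"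
proof (induction "degree p" arbitrary: p rule: less_induct)
  case (less p)
  show ?case
  proof (cases "p = 0 \<or> degree p < degree g")
    case True
    then show ?thesis
      using less.prems polys_over_0[OF F] by (intro bexI[of _ 0] bexI[of _ p]) auto
  next
    case False
    define t where "t = monom (lead_coeff p / lead_coeff g) (degree p - degree g)"
    have t: "t \<in> polys_over F"
      unfolding t_def using less.prems g(1)
      by (intro polys_over_monom[OF F] subfield_divide[OF F]) (auto simp: polys_over_def)
    define p' where "p' = p - g * t"
    have p': "p' \<in> polys_over F"
      unfolding p'_def by (intro polys_over_diff[OF F] polys_over_mult[OF F] t g less.prems)
    have t0: "t \<noteq> 0" "degree t = degree p - degree g" "lead_coeff t = lead_coeff p / lead_coeff g"
      unfolding t_def using False g(2) by (auto simp: degree_monom_eq)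
    have deg: "degree (g * t) = degree p"
      using False t0 g(2) by (simp add: degree_mult_eq)
    have lc: "lead_coeff (g * t) = lead_coeff p"
      using t0 g(2) by (simp add: lead_coeff_mult)
    have "p' = 0 \<or> degree p' < degree p"
    proof (rule disjCI)
      assume nd: "\<not> degree p' < degree p"
      have "degree p' \<le> degree p" unfolding p'_def using deg by (intro degree_diff_le) auto
      with nd have "degree p' = degree p" by simp
      moreover have "coeff p' (degree p) = 0" unfolding p'_def using lc deg by simp
      ultimately show "p' = 0" by (metis leading_coeff_0_iff)
    qed
    then obtain q r where qr: "q \<in> polys_over F" "r \<in> polys_over F" "p' = g * q + r"
      "r = 0 \<or> degree r < degree g"
    proof
      assume "p' = 0"
      then show ?thesis using that[of 0 0] polys_over_0[OF F] by simp
    next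
      assume "degree p' < degree p"
      then show ?thesis using less.hyps[OF _ p'] that by blast
    qed
    have "p = g * (t + q) + r" using qr(3) by (simp add: p'_def algebra_simps)
    with qr polys_over_add[OF F t qr(1)] show ?thesis by blast
  qed
qed

definition algebraic_over :: "complex set \<Rightarrow> complex \<Rightarrow> bool" where
  "algebraic_over F x \<longleftrightarrow> (\<exists>p\<in>polys_over F. p \<noteq> 0 \<and> poly p x = 0)"

definition minimal_poly :: "complex set \<Rightarrow> complex \<Rightarrow> complex poly \<Rightarrow> bool" where
  "minimal_poly F x m \<longleftrightarrow> m \<in> polys_over F \<and> lead_coeff m = 1 \<and> poly m x = 0 \<and>
     (\<forall>p\<in>polys_over F. p \<noteq> 0 \<longrightarrow> poly p x = 0 \<longrightarrow> degree m \<le> degree p)"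

lemma minimal_poly_exists:
  assumes F: "complex_subfield F" and x: "algebraic_over F x"
  shows "\<exists>m. minimal_poly F x m"
proof -
  let ?P = "\<lambda>p. p \<in> polys_over F \<and> p \<noteq> 0 \<and> poly p x = 0"
  obtain p where p: "?P p" and min: "\<And>q. ?P q \<Longrightarrow> degree p \<le> degree q"
  proof -
    obtain p0 where "?P p0" using x by (auto simp: algebraic_over_def)
    from ex_has_least_nat[of ?P p0 degree, OF this] that show thesis by blast
  qed
  define c where "c = inverse (lead_coeff p)"
  have "c \<noteq> 0" using p by (simp add: c_def)
  have "minimal_poly F x (Polynomial.smult c p)"
    unfolding minimal_poly_def
  proof (intro conjI ballI impI)
    show "Polynomial.smult c p \<in> polys_over F"
      using p unfolding c_def
      by (intro polys_over_smult[OF F] subfield_inverse[OF F]) (auto simp: polys_over_def)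
    show "lead_coeff (Polynomial.smult c p) = 1" using p by (simp add: c_def)
  qed (use p min \<open>c \<noteq> 0\<close> in auto)
  then show ?thesis by blast
qed

lemma minimal_poly_dvd:
  assumes F: "complex_subfield F" and m: "minimal_poly F x m"
    and p: "p \<in> polys_over F" "poly p x = 0"
  shows "\<exists>q\<in>polys_over F. p = m * q"
proof -
  have m': "m \<in> polys_over F" "m \<noteq> 0" using m by (auto simp: minimal_poly_def)
  obtain q r where qr: "q \<in> polys_over F" "r \<in> polys_over F" "p = m * q + r" "r = 0 \<or> degree r < degree m"
    using polys_over_division[OF F m' p(1)] by blast
  have "poly r x = 0" using qr(3) p(2) m by (simp add: minimal_poly_def)
  then have "r = 0" using qr m by (fastforce simp: minimal_poly_def)
  with qr show ?thesis by auto
qed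

definition adjoin :: "complex set \<Rightarrow> complex \<Rightarrow> complex set" where
  "adjoin F x = (\<lambda>p. poly p x) ` polys_over F"

lemma adjoin_contains:
  assumes F: "complex_subfield F"
  shows "F \<subseteq> adjoin F x" "x \<in> adjoin F x"
proof -
  show "F \<subseteq> adjoin F x"
  proof
    fix a assume "a \<in> F"
    then have "[:a:] \<in> polys_over F" by (simp add: polys_over_pCons[OF F] polys_over_0[OF F])
    moreover have "a = poly [:a:] x" by simp
    ultimately show "a \<in> adjoin F x" unfolding adjoin_def by blast
  qed
  have "[:0, 1:] \<in> polys_over F"
    by (simp add: polys_over_pCons[OF F] polys_over_0[OF F] subfield_0[OF F] subfield_1[OF F])
  moreover have "x = poly [:0, 1:] x" by simp
  ultimately show "x \<in> adjoin F x" unfolding adjoin_def by blast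
qed

text \<open>
  Inverses are found by descending along remainders of the minimal polynomial: dividing it by \<open>p\<close>
  expresses a multiple of \<open>p(x)\<close> through a remainder of smaller degree.
\<close>

lemma subfield_adjoin:
  assumes F: "complex_subfield F" and x: "algebraic_over F x"
  shows "complex_subfield (adjoin F x)"
proof -
  obtain m where m: "minimal_poly F x m" using minimal_poly_exists[OF assms] by blast
  have inv: "p \<in> polys_over F \<Longrightarrow> poly p x \<noteq> 0 \<Longrightarrow> degree p < degree m \<Longrightarrow>
      \<exists>u\<in>polys_over F. poly u x * poly p x = 1" for p
  proof (induction "degree p" arbitrary: p rule: less_induct)
    case (less p)
    have p0: "p \<noteq> 0" using less.prems by auto
    show ?case
    proof (cases "degree p = 0")
      case True
      then obtain a where a: "p = [:a:]" by (metis degree_eq_zeroE)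
      then have "[:inverse a:] \<in> polys_over F"
        using less.prems by (simp add: polys_over_pCons[OF F] subfield_inverse[OF F])
      with a less.prems show ?thesis by (intro bexI[of _ "[:inverse a:]"]) auto
    next
      case False
      have m': "m \<in> polys_over F" using m by (simp add: minimal_poly_def)
      obtain q r where qr: "q \<in> polys_over F" "r \<in> polys_over F" "m = p * q + r" "r = 0 \<or> degree r < degree p"
        using polys_over_division[OF F less.prems(1) p0 m'] by blast
      have rx: "poly r x = - (poly p x * poly q x)"
        using m qr(3) by (simp add: minimal_poly_def add_eq_0_iff)
      have "r \<noteq> 0"
      proof
        assume "r = 0"
        then have "poly q x = 0" using rx less.prems by simp
        moreover have "q \<noteq> 0" using qr(3) \<open>r = 0\<close> m by (auto simp: minimal_poly_def)
        ultimately have "degree m \<le> degree q" using m qr(1) by (auto simp: minimal_poly_def)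
        moreover have "degree m = degree p + degree q"
          using qr(3) \<open>r = 0\<close> \<open>q \<noteq> 0\<close> p0 by (simp add: degree_mult_eq)
        ultimately show False using False by simp
      qed
      then have "degree r < degree p" using qr by simp
      moreover have "poly r x \<noteq> 0"
        using m qr(2) \<open>r \<noteq> 0\<close> \<open>degree r < degree p\<close> less.prems(3) by (fastforce simp: minimal_poly_def)
      ultimately obtain u where u: "u \<in> polys_over F" "poly u x * poly r x = 1"
        using less.hyps[OF _ qr(2)] less.prems(3) by fastforce
      have "poly (- (u * q)) x * poly p x = 1" using u(2) by (simp add: rx mult_ac)
      moreover have "- (u * q) \<in> polys_over F"
        by (intro polys_over_minus[OF F] polys_over_mult[OF F] u qr)
      ultimately show ?thesis by blast
    qed
  qed
  show ?thesis
    unfolding complex_subfield_def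
  proof (intro conjI ballI)
    show "1 \<in> adjoin F x" using adjoin_contains(1)[OF F] subfield_1[OF F] by blast
    fix y assume "y \<in> adjoin F x"
    then obtain p where p: "p \<in> polys_over F" "y = poly p x" by (auto simp: adjoin_def)
    show "inverse y \<in> adjoin F x"
    proof (cases "y = 0")
      case True
      then show ?thesis using adjoin_contains(1)[OF F] subfield_0[OF F] by auto
    next
      case False
      have m': "m \<in> polys_over F" "m \<noteq> 0" using m by (auto simp: minimal_poly_def)
      obtain q r where qr: "q \<in> polys_over F" "r \<in> polys_over F" "p = m * q + r" "r = 0 \<or> degree r < degree m"
        using polys_over_division[OF F m' p(1)] by blast
      have y: "y = poly r x" using m p(2) qr(3) by (simp add: minimal_poly_def)
      with False qr(4) have "degree r < degree m" by auto
      then obtain u where "u \<in> polys_over F" "poly u x * y = 1" using inv[OF qr(2)] y False by auto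
      then show ?thesis unfolding adjoin_def by (metis image_eqI inverse_unique mult.commute)
    qed
    fix z assume "z \<in> adjoin F x"
    then obtain q where q: "q \<in> polys_over F" "z = poly q x" by (auto simp: adjoin_def)
    show "y - z \<in> adjoin F x" "y * z \<in> adjoin F x"
      using polys_over_diff[OF F p(1) q(1)] polys_over_mult[OF F p(1) q(1)] p(2) q(2)
      unfolding adjoin_def by (auto simp flip: poly_diff poly_mult)
  qed
qed

section \<open>Extending homomorphisms and producing conjugates\<close>

context subfield_hom
begin

lemma coeff_map_poly_hom: "coeff (map_poly \<sigma> p) i = \<sigma> (coeff p i)"
  by (simp add: coeff_map_poly hom_0)

lemma map_poly_pCons_hom: "map_poly \<sigma> (pCons a p) = pCons (\<sigma> a) (map_poly \<sigma> p)"
  by (intro poly_eqI) (auto simp: coeff_map_poly_hom coeff_pCons split: nat.splits)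

lemma map_poly_add: "p \<in> polys_over F \<Longrightarrow> q \<in> polys_over F \<Longrightarrow>
    map_poly \<sigma> (p + q) = map_poly \<sigma> p + map_poly \<sigma> q"
  by (intro poly_eqI) (auto simp: coeff_map_poly_hom hom_add polys_over_def)

lemma map_poly_diff: "p \<in> polys_over F \<Longrightarrow> q \<in> polys_over F \<Longrightarrow>
    map_poly \<sigma> (p - q) = map_poly \<sigma> p - map_poly \<sigma> q"
  by (intro poly_eqI) (auto simp: coeff_map_poly_hom hom_diff polys_over_def)

lemma map_poly_mult: "p \<in> polys_over F \<Longrightarrow> q \<in> polys_over F \<Longrightarrow>
    map_poly \<sigma> (p * q) = map_poly \<sigma> p * map_poly \<sigma> q"
  by (intro poly_eqI)
     (auto simp: coeff_map_poly_hom coeff_mult hom_sum hom_mult polys_over_def subfield_mult[OF sub])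

lemma hom_poly: "p \<in> polys_over F \<Longrightarrow> x \<in> F \<Longrightarrow> \<sigma> (poly p x) = poly (map_poly \<sigma> p) (\<sigma> x)"
proof (induction p)
  case (pCons a p)
  then have "a \<in> F" "p \<in> polys_over F" by (auto simp: polys_over_pCons[OF sub])
  with pCons show ?case
    by (simp add: map_poly_pCons_hom hom_0 hom_add hom_mult subfield_mult[OF sub] poly_in_subfield[OF sub])
qed (simp add: hom_0)

lemma hom_ipoly: "x \<in> F \<Longrightarrow> \<sigma> (poly (map_poly of_int p) x) = poly (map_poly of_int p) (\<sigma> x)"
proof -
  assume x: "x \<in> F"
  have "map_poly of_int p \<in> polys_over F"
    by (auto simp: polys_over_def coeff_map_poly subfield_of_int[OF sub])
  moreover have "map_poly \<sigma> (map_poly of_int p) = map_poly of_int p"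
    by (intro poly_eqI) (simp add: coeff_map_poly hom_0 hom_of_int)
  ultimately show ?thesis using hom_poly x by simp
qed

lemma hom_algebraic_int: "x \<in> F \<Longrightarrow> algebraic_int x \<Longrightarrow> algebraic_int (\<sigma> x)"
  unfolding algebraic_int_altdef_ipoly using hom_ipoly hom_0 by metis

text \<open>
  The extension sends \<open>p(x)\<close> to the image of \<open>p\<close> evaluated at \<open>y\<close>. It does not depend on the polynomial chosen
  to represent an element, because two representatives differ by a multiple of the minimal polynomial,
  and \<open>y\<close> is a root of its image.
\<close>

lemma extend_to_adjoin:
  assumes m: "minimal_poly F x m" and y: "poly (map_poly \<sigma> m) y = 0"
  shows "\<exists>\<tau>. field_hom (adjoin F x) \<tau> \<and> (\<forall>z\<in>F. \<tau> z = \<sigma> z) \<and> \<tau> x = y"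
proof -
  define \<tau> where "\<tau> z = poly (map_poly \<sigma> (SOME p. p \<in> polys_over F \<and> poly p x = z)) y" for z
  have \<tau>: "\<tau> (poly p x) = poly (map_poly \<sigma> p) y" if p: "p \<in> polys_over F" for p
  proof -
    define q where "q = (SOME q. q \<in> polys_over F \<and> poly q x = poly p x)"
    have q: "q \<in> polys_over F" "poly q x = poly p x"
      using someI[of "\<lambda>q. q \<in> polys_over F \<and> poly q x = poly p x" p] p by (auto simp: q_def)
    obtain s where s: "s \<in> polys_over F" "q - p = m * s"
      using minimal_poly_dvd[OF sub m polys_over_diff[OF sub q(1) p]] q(2) by auto
    have "map_poly \<sigma> q - map_poly \<sigma> p = map_poly \<sigma> m * map_poly \<sigma> s"
      using m q p s map_poly_diff map_poly_mult by (metis minimal_poly_def)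
    then have "poly (map_poly \<sigma> q) y - poly (map_poly \<sigma> p) y = 0"
      using y by (metis mult_zero_left poly_diff poly_mult)
    then show ?thesis by (simp add: \<tau>_def q_def)
  qed
  have const: "[:a:] \<in> polys_over F" if "a \<in> F" for a
    using that by (simp add: polys_over_pCons[OF sub] polys_over_0[OF sub])
  have \<tau>F: "\<tau> z = \<sigma> z" if "z \<in> F" for z
    using \<tau>[OF const[OF that]] by (simp add: map_poly_pCons_hom hom_0)
  have X: "[:0, 1:] \<in> polys_over F"
    by (simp add: polys_over_pCons[OF sub] polys_over_0[OF sub] subfield_0[OF sub] subfield_1[OF sub])
  have "\<tau> x = y" using \<tau>[OF X] by (simp add: map_poly_pCons_hom hom_0 hom_1)
  moreover have "field_hom (adjoin F x) \<tau>"
    unfolding field_hom_def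
  proof (intro conjI ballI)
    show "\<tau> 1 = 1" using \<tau>F[OF subfield_1[OF sub]] hom_1 by simp
    fix u v assume "u \<in> adjoin F x" "v \<in> adjoin F x"
    then obtain p q where pq: "p \<in> polys_over F" "u = poly p x" "q \<in> polys_over F" "v = poly q x"
      by (auto simp: adjoin_def)
    show "\<tau> (u + v) = \<tau> u + \<tau> v"
      using \<tau>[OF polys_over_add[OF sub pq(1,3)]] \<tau>[OF pq(1)] \<tau>[OF pq(3)] pq(2,4) map_poly_add[OF pq(1,3)] by simp
    show "\<tau> (u * v) = \<tau> u * \<tau> v"
      using \<tau>[OF polys_over_mult[OF sub pq(1,3)]] \<tau>[OF pq(1)] \<tau>[OF pq(3)] pq(2,4) map_poly_mult[OF pq(1,3)] by simp
  qed
  ultimately show ?thesis using \<tau>F by blast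
qed

lemma degree_map_poly_hom: "p \<in> polys_over F \<Longrightarrow> degree (map_poly \<sigma> p) = degree p"
proof (cases "p = 0")
  case False
  assume "p \<in> polys_over F"
  with False have "coeff (map_poly \<sigma> p) (degree p) \<noteq> 0"
    by (simp add: coeff_map_poly_hom hom_eq_0_iff polys_over_def)
  then show ?thesis by (intro antisym degree_map_poly_le le_degree)
qed simp

lemma extend_finite:
  assumes "finite S" "\<And>x. x \<in> S \<Longrightarrow> algebraic_over \<rat> x"
  shows "\<exists>E \<tau>. complex_subfield E \<and> F \<subseteq> E \<and> S \<subseteq> E \<and> field_hom E \<tau> \<and> (\<forall>z\<in>F. \<tau> z = \<sigma> z)"
  using assms
proof (induction S rule: finite_induct)
  case empty
  then show ?case using sub hom by blast
next
  case (insert x S)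
  then obtain E \<tau> where E: "complex_subfield E" "F \<subseteq> E" "S \<subseteq> E" "field_hom E \<tau>" "\<forall>z\<in>F. \<tau> z = \<sigma> z"
    by blast
  interpret E: subfield_hom E \<tau> by unfold_locales (use E in auto)
  have alg: "algebraic_over E x"
    using insert.prems[of x] subfield_Rats[OF E(1)]
    by (auto simp: algebraic_over_def polys_over_def)
  obtain m where m: "minimal_poly E x m" using minimal_poly_exists[OF E(1) alg] by blast
  have "degree m \<noteq> 0"
  proof
    assume "degree m = 0"
    then obtain a where "m = [:a:]" by (metis degree_eq_zeroE)
    with m show False by (auto simp: minimal_poly_def)
  qed
  then have "degree (map_poly \<tau> m) \<noteq> 0"
    using E.degree_map_poly_hom m by (simp add: minimal_poly_def)
  then obtain y where "poly (map_poly \<tau> m) y = 0"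
    using fundamental_theorem_of_algebra_alt[of "map_poly \<tau> m"] by (metis degree_pCons_0)
  then obtain \<tau>' where "field_hom (adjoin E x) \<tau>'" "\<forall>z\<in>E. \<tau>' z = \<tau> z"
    using E.extend_to_adjoin[OF m] by blast
  then show ?case
    using E adjoin_contains[OF E(1), of x] subfield_adjoin[OF E(1) alg]
    by (intro exI[of _ "adjoin E x"] exI[of _ \<tau>']) auto
qed

end

text \<open>
  This takes the place of a Galois group: a conjugate of \<open>y\<close> is realized by a homomorphism that is defined
  on prescribed further algebraic numbers, so that the effect on all numbers in play can be followed.
\<close>

lemma conjugate_hom:
  assumes m: "minimal_poly \<rat> y m" and y': "poly m y' = 0"
    and S: "finite S" "\<And>x. x \<in> S \<Longrightarrow> algebraic_over \<rat> x"
  shows "\<exists>E \<tau>. complex_subfield E \<and> S \<subseteq> E \<and> y \<in> E \<and> field_hom E \<tau> \<and> \<tau> y = y'"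
proof -
  have y: "algebraic_over \<rat> y"
    using m unfolding minimal_poly_def algebraic_over_def by (metis leading_coeff_0_iff zero_neq_one)
  interpret Q: subfield_hom "\<rat>" "\<lambda>x. x"
    by unfold_locales (auto simp: complex_subfield_Rats field_hom_def)
  have "map_poly (\<lambda>x. x) m = m" by (intro poly_eqI) (simp add: coeff_map_poly)
  then obtain \<sigma> where \<sigma>: "field_hom (adjoin \<rat> y) \<sigma>" "\<sigma> y = y'"
    using Q.extend_to_adjoin[OF m, of y'] y' by auto
  interpret A: subfield_hom "adjoin \<rat> y" \<sigma>
    by unfold_locales (use \<sigma> subfield_adjoin[OF complex_subfield_Rats y] in auto)
  have "y \<in> adjoin \<rat> y" using adjoin_contains(2)[OF complex_subfield_Rats] .
  with A.extend_finite[OF S] \<sigma>(2) show ?thesis by (metis subsetD)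
qed

lemma algebraic_int_imp_algebraic_over_Rats:
  assumes "algebraic_int x"
  shows "algebraic_over \<rat> x"
proof -
  obtain p where "lead_coeff p = (1::complex)" "\<forall>i. coeff p i \<in> \<int>" "poly p x = 0"
    using assms by (auto elim: algebraic_int.cases)
  then show ?thesis
    using Ints_subset_Rats unfolding algebraic_over_def polys_over_def
    by (intro bexI[of _ p]) auto
qed

lemma complex_poly_splits:
  fixes m :: "complex poly"
  assumes "lead_coeff m = 1"
  shows "\<exists>zs. m = (\<Prod>z\<leftarrow>zs. [:- z, 1:]) \<and> (\<forall>z\<in>set zs. poly m z = 0) \<and> length zs = degree m"
proof -
  obtain zs where zs: "Polynomial.smult (lead_coeff m) (\<Prod>z\<leftarrow>zs. [:- z, 1:]) = m" "length zs = degree m"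
    using fundamental_theorem_algebra_factorized[of m] by blast
  have "poly (\<Prod>z\<leftarrow>zs. [:- z, 1:]) z = 0" if "z \<in> set zs" for z
    using that by (auto simp: poly_prod_list prod_list_zero_iff)
  with zs assms show ?thesis by auto
qed

text \<open>
  If \<open>y\<close> were the only root of its minimal polynomial \<open>(X - y)\<^sup>k\<close>, then the second highest coefficient
  \<open>- k y\<close>, and with it \<open>y\<close>, would be rational.
\<close>

lemma nonrational_conjugate:
  assumes y: "algebraic_over \<rat> y" "y \<notin> \<rat>"
    and S: "finite S" "\<And>x. x \<in> S \<Longrightarrow> algebraic_over \<rat> x"
  shows "\<exists>E \<tau>. complex_subfield E \<and> S \<subseteq> E \<and> y \<in> E \<and> field_hom E \<tau> \<and> \<tau> y \<noteq> y"
proof -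
  obtain m where m: "minimal_poly \<rat> y m" using minimal_poly_exists[OF complex_subfield_Rats y(1)] by blast
  have "\<exists>y'. poly m y' = 0 \<and> y' \<noteq> y"
  proof (rule ccontr)
    assume "\<nexists>y'. poly m y' = 0 \<and> y' \<noteq> y"
    moreover obtain zs where zs: "m = (\<Prod>z\<leftarrow>zs. [:- z, 1:])" "\<forall>z\<in>set zs. poly m z = 0" "length zs = degree m"
      using complex_poly_splits[of m] m by (auto simp: minimal_poly_def)
    ultimately have "\<forall>z\<in>set zs. z = y" by blast
    then have "zs = replicate (length zs) y" by (metis replicate_length_same)
    then have mp: "m = [:- y, 1:] ^ degree m"
      using zs by (metis map_replicate prod_list_replicate)
    define k where "k = degree m"
    have k0: "k \<noteq> 0"
    proof
      assume "k = 0"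
      then have "m = 1" using mp by (simp add: k_def)
      with m show False by (simp add: minimal_poly_def)
    qed
    have c: "coeff ([:- y, 1:] ^ Suc j) j = - (of_nat (Suc j) * y)" for j
    proof (induction j)
      case (Suc j)
      have lead: "coeff ([:- y, 1:] ^ Suc j) (Suc j) = 1"
        using lead_coeff_power[of "[:- y, 1:]" "Suc j"] by (simp add: degree_linear_power del: power_Suc)
      have "coeff ([:- y, 1:] ^ Suc (Suc j)) (Suc j)
          = - y * coeff ([:- y, 1:] ^ Suc j) (Suc j) + coeff ([:- y, 1:] ^ Suc j) j"
        by (subst power_Suc) (simp add: mult_pCons_left del: power_Suc)
      then show ?case unfolding lead Suc by (simp add: algebra_simps)
    qed simp
    have "coeff m (k - 1) = - (of_nat k * y)"
      using c[of "k - 1"] k0 by (subst mp) (simp add: k_def del: power_Suc)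
    moreover have "coeff m (k - 1) \<in> \<rat>" using m by (simp add: minimal_poly_def polys_over_def)
    ultimately have "of_nat k * y \<in> \<rat>" by (metis Rats_minus_iff)
    then have "of_nat k * y / of_nat k \<in> \<rat>" by (intro Rats_divide) auto
    with k0 y(2) show False by simp
  qed
  with conjugate_hom[OF m _ S] show ?thesis by blast
qed

text \<open>
  The conjugates of \<open>y\<close> multiply, up to sign, to the constant coefficient of the minimal polynomial.
  It is rational and integral, hence a nonzero integer, so the conjugates cannot all be smaller than 1.
\<close>

lemma large_conjugate:
  assumes y: "algebraic_int y" "y \<noteq> 0"
    and S: "finite S" "\<And>x. x \<in> S \<Longrightarrow> algebraic_over \<rat> x"
  shows "\<exists>E \<tau>. complex_subfield E \<and> S \<subseteq> E \<and> y \<in> E \<and> field_hom E \<tau> \<and> cmod (\<tau> y) \<ge> 1"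
proof -
  obtain p where p: "lead_coeff p = (1::complex)" "\<forall>i. coeff p i \<in> \<int>" "poly p y = 0"
    using y(1) by (auto elim: algebraic_int.cases)
  have pQ: "p \<in> polys_over \<rat>" using p(2) Ints_subset_Rats by (auto simp: polys_over_def)
  obtain m where m: "minimal_poly \<rat> y m"
    using minimal_poly_exists[OF complex_subfield_Rats algebraic_int_imp_algebraic_over_Rats[OF y(1)]] by blast
  obtain q where q: "p = m * q" using minimal_poly_dvd[OF complex_subfield_Rats m pQ p(3)] by blast
  have int: "algebraic_int z" if "poly m z = 0" for z
    using p(1,2) that q by (intro algebraic_int.intros[of p]) auto
  obtain zs where zs: "m = (\<Prod>z\<leftarrow>zs. [:- z, 1:])" "\<forall>z\<in>set zs. poly m z = 0" "length zs = degree m"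
    using complex_poly_splits[of m] m by (auto simp: minimal_poly_def)
  have "\<exists>y'. poly m y' = 0 \<and> cmod y' \<ge> 1"
  proof (rule ccontr)
    assume "\<nexists>y'. poly m y' = 0 \<and> cmod y' \<ge> 1"
    with zs(2) have small: "\<forall>z\<in>set zs. cmod z < 1" by force
    have c0: "coeff m 0 = (\<Prod>z\<leftarrow>zs. - z)"
      unfolding zs(1) poly_0_coeff_0[symmetric] by (simp add: poly_prod_list o_def)
    have ai: "\<forall>z\<in>set xs. algebraic_int z \<Longrightarrow> algebraic_int (\<Prod>z\<leftarrow>xs. - z)" for xs :: "complex list"
      by (induction xs) (auto intro: algebraic_int_times int_imp_algebraic_int)
    have "algebraic_int (coeff m 0)" unfolding c0 using ai int zs(2) by blast
    moreover have "coeff m 0 \<in> \<rat>" using m by (simp add: minimal_poly_def polys_over_def)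
    ultimately have cint: "coeff m 0 \<in> \<int>" by (rule rational_algebraic_int_is_int)
    have "degree m \<noteq> 0"
    proof
      assume "degree m = 0"
      then have "m = 1" using m by (metis minimal_poly_def degree_eq_zeroE lead_coeff_pCons(2) one_pCons)
      with m show False by (simp add: minimal_poly_def)
    qed
    then have "zs \<noteq> []" using zs(3) by auto
    have le: "cmod (\<Prod>z\<leftarrow>xs. - z) < 1" if "xs \<noteq> []" "\<forall>z\<in>set xs. cmod z < 1" for xs
      using that
    proof (induction xs)
      case (Cons z xs)
      show ?case
      proof (cases "xs = []")
        case False
        then have "cmod (\<Prod>z\<leftarrow>xs. - z) < 1" using Cons by auto
        then have "cmod z * cmod (\<Prod>z\<leftarrow>xs. - z) < 1 * 1"
          using Cons.prems by (intro mult_strict_mono') auto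
        then show ?thesis by (simp add: norm_mult)
      qed (use Cons in auto)
    qed simp
    have "coeff m 0 = 0"
      using cint le[OF \<open>zs \<noteq> []\<close> small] unfolding c0[symmetric] by (auto elim!: Ints_cases)
    then obtain r where r: "m = pCons 0 r" by (metis pCons_cases coeff_pCons_0)
    with y(2) m have "poly r y = 0" by (simp add: minimal_poly_def)
    moreover have "r \<noteq> 0" using m r by (auto simp: minimal_poly_def)
    moreover have "r \<in> polys_over \<rat>"
      using m r by (simp add: minimal_poly_def polys_over_pCons[OF complex_subfield_Rats])
    ultimately have "degree m \<le> degree r" using m by (simp add: minimal_poly_def)
    then show False using r \<open>r \<noteq> 0\<close> by simp
  qed
  with conjugate_hom[OF m _ S] show ?thesis by blast
qed

lemma complex_subfield_hull: "complex_subfield (complex_subfield hull S)"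
  by (rule hull_in) (auto simp: complex_subfield_def)

section \<open>Embeddings and traces of a number field\<close>

lemma rational_poly_denominator:
  assumes x: "algebraic_int x" and p: "p \<in> polys_over \<rat>"
  shows "\<exists>k :: int. k \<noteq> 0 \<and> algebraic_int (of_int k * poly p x)"
  using p
proof (induction p)
  case 0
  show ?case by (intro exI[of _ 1]) simp
next
  case (pCons a p)
  then have a: "a \<in> \<rat>" and p: "p \<in> polys_over \<rat>"
    by (auto simp: polys_over_pCons[OF complex_subfield_Rats])
  obtain k :: int where k: "k \<noteq> 0" "algebraic_int (of_int k * poly p x)" using pCons p by blast
  obtain q where q: "a = of_rat q" using a by (auto elim: Rats_cases)
  obtain u v :: int where uv: "v \<noteq> 0" "a = of_int u / of_int v"
  proof (cases q)
    case (Fract u v)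
    with q that[of v u] show thesis by (simp add: of_rat_rat)
  qed
  have va: "of_int v * a = of_int u" using uv by simp
  have "of_int (v * k) * poly (pCons a p) x = of_int k * (of_int v * a) + of_int v * (x * (of_int k * poly p x))"
    by (simp only: of_int_mult poly_pCons distrib_left mult_ac)
  then have "of_int (v * k) * poly (pCons a p) x = of_int (k * u) + of_int v * (x * (of_int k * poly p x))"
    by (simp add: va)
  moreover have "algebraic_int \<dots>"
    by (intro algebraic_int_plus algebraic_int_times x k algebraic_int_of_int)
  ultimately show ?case using uv k by (intro exI[of _ "v * k"]) auto
qed

lemma common_denominator:
  fixes q :: "nat \<Rightarrow> rat"
  shows "\<exists>k :: int. k \<noteq> 0 \<and> (\<forall>i<n. \<exists>u :: int. of_int k * q i = of_int u)"
proof (induction n)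
  case 0
  show ?case by (intro exI[of _ 1]) simp
next
  case (Suc n)
  then obtain k :: int where k: "k \<noteq> 0" "\<And>i. i < n \<Longrightarrow> \<exists>u :: int. of_int k * q i = of_int u" by blast
  obtain a b where ab: "q n = of_int a / of_int b" "b \<noteq> 0"
    by (cases "q n") (auto simp: Fract_of_int_quotient)
  have "\<exists>u :: int. of_int (b * k) * q i = of_int u" if "i < Suc n" for i
  proof (cases "i = n")
    case True
    with ab show ?thesis by (intro exI[of _ "k * a"]) simp
  next
    case False
    with that k(2)[of i] obtain u :: int where "of_int k * q i = of_int u" by auto
    then show ?thesis by (intro exI[of _ "b * u"]) (simp add: mult.assoc)
  qed
  with k ab show ?case by (intro exI[of _ "b * k"]) auto
qed

lemma det_in_subfield:
  fixes A :: "complex mat"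
  assumes F: "complex_subfield F" and A: "A \<in> carrier_mat n n"
    and el: "\<And>i j. i < n \<Longrightarrow> j < n \<Longrightarrow> A $$ (i, j) \<in> F"
  shows "det A \<in> F"
proof -
  have pr: "(\<Prod>i\<in>I. f i) \<in> F" if "\<And>i. i \<in> I \<Longrightarrow> f i \<in> F" for I :: "nat set" and f
    using that by (induction I rule: infinite_finite_induct) (auto intro: subfield_1[OF F] subfield_mult[OF F])
  have "det A = (\<Sum>p\<in>{p. p permutes {0..<n}}. signof p * (\<Prod>i = 0..<n. A $$ (i, p i)))"
    using A by (simp add: det_def')
  moreover have "\<dots> \<in> F"
  proof (intro subfield_sum[OF F] subfield_mult[OF F] pr el)
    fix p i assume "p \<in> {p. p permutes {0..<n}}" "i \<in> {0..<n}"
    then show "p i < n" "i < n" by (auto dest: permutes_in_image)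
  qed (auto simp: sign_def subfield_1[OF F] subfield_minus[OF F])
  ultimately show ?thesis by simp
qed

locale simple_number_field =
  fixes \<xi> :: complex and F :: "complex set"
  assumes \<xi>: "algebraic_int \<xi>" and F_eq: "F = adjoin_rat {\<xi>}"
begin

lemma F: "complex_subfield F"
  unfolding F_eq adjoin_rat_def by (rule complex_subfield_hull)

lemma \<xi>_in: "\<xi> \<in> F"
  unfolding F_eq adjoin_rat_def by (simp add: hull_inc)

lemma rational_poly_representation:
  assumes "x \<in> F"
  shows "\<exists>p\<in>polys_over \<rat>. x = poly p \<xi>"
proof -
  have "F \<subseteq> adjoin \<rat> \<xi>"
    unfolding F_eq adjoin_rat_def
    by (intro hull_minimal subfield_adjoin[OF complex_subfield_Rats algebraic_int_imp_algebraic_over_Rats[OF \<xi>]])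
       (simp add: adjoin_contains[OF complex_subfield_Rats])
  with assms show ?thesis by (auto simp: adjoin_def)
qed

lemma integral_multiple:
  assumes "x \<in> F"
  shows "\<exists>k :: int. k \<noteq> 0 \<and> of_int k * x \<in> ring_of_integers F"
proof -
  obtain p where p: "p \<in> polys_over \<rat>" "x = poly p \<xi>"
    using rational_poly_representation[OF assms] by blast
  obtain k :: int where "k \<noteq> 0" "algebraic_int (of_int k * x)"
    using rational_poly_denominator[OF \<xi> p(1)] p(2) by blast
  with assms show ?thesis
    by (auto simp: ring_of_integers_def intro: subfield_mult[OF F] subfield_of_int[OF F])
qed

lemma embedding_hom:
  assumes "\<sigma> \<in> embeddings F"
  shows "subfield_hom F \<sigma>"
  using assms F by unfold_locales (auto simp: embeddings_eq)

lemma hom_image: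
  assumes \<sigma>: "subfield_hom F \<sigma>" and x: "x \<in> F"
  shows "\<exists>p\<in>polys_over \<rat>. x = poly p \<xi> \<and> \<sigma> x = poly p (\<sigma> \<xi>)"
proof -
  interpret subfield_hom F \<sigma> by fact
  obtain p where p: "p \<in> polys_over \<rat>" "x = poly p \<xi>" using rational_poly_representation[OF x] by blast
  have "p \<in> polys_over F" using p(1) subfield_Rats[OF F] by (auto simp: polys_over_def)
  moreover have "map_poly \<sigma> p = p"
    using p(1) by (intro poly_eqI) (simp add: coeff_map_poly hom_0 hom_Rats polys_over_def)
  ultimately show ?thesis using hom_poly[of p \<xi>] \<xi>_in p by auto
qed

lemma embedding_eqI:
  assumes "\<sigma> \<in> embeddings F" "\<tau> \<in> embeddings F" "\<sigma> \<xi> = \<tau> \<xi>"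
  shows "\<sigma> = \<tau>"
proof (rule extensionalityI[of _ F])
  show "\<sigma> \<in> extensional F" "\<tau> \<in> extensional F" using assms by (auto simp: embeddings_eq)
  fix x assume x: "x \<in> F"
  interpret s: subfield_hom F \<sigma> by (rule embedding_hom) fact
  interpret t: subfield_hom F \<tau> by (rule embedding_hom) fact
  obtain p where p: "p \<in> polys_over \<rat>" "x = poly p \<xi>" using rational_poly_representation[OF x] by blast
  have pF: "p \<in> polys_over F" using p(1) subfield_Rats[OF F] by (auto simp: polys_over_def)
  have "map_poly \<sigma> p = p" "map_poly \<tau> p = p"
    using p(1) by (auto intro!: poly_eqI simp: coeff_map_poly s.hom_0 s.hom_Rats t.hom_0 t.hom_Rats polys_over_def)
  then show "\<sigma> x = \<tau> x"
    using s.hom_poly[OF pF \<xi>_in] t.hom_poly[OF pF \<xi>_in] p(2) assms(3) by simp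
qed

lemma embeddings_finite_card:
  assumes f: "f \<noteq> (0 :: int poly)" "poly (map_poly of_int f) \<xi> = 0"
  shows "finite (embeddings F)" "card (embeddings F) \<le> degree f"
proof -
  let ?P = "map_poly of_int f :: complex poly"
  have P: "?P \<noteq> 0" using f(1) by simp
  have inj: "inj_on (\<lambda>\<sigma>. \<sigma> \<xi>) (embeddings F)" by (rule inj_onI) (rule embedding_eqI)
  have sub: "(\<lambda>\<sigma>. \<sigma> \<xi>) ` embeddings F \<subseteq> {z. poly ?P z = 0}"
  proof
    fix z assume "z \<in> (\<lambda>\<sigma>. \<sigma> \<xi>) ` embeddings F"
    then obtain \<sigma> where \<sigma>: "\<sigma> \<in> embeddings F" "z = \<sigma> \<xi>" by blast
    interpret subfield_hom F \<sigma> by (rule embedding_hom) fact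
    show "z \<in> {z. poly ?P z = 0}" using hom_ipoly[OF \<xi>_in, of f] f(2) \<sigma>(2) hom_0 by simp
  qed
  have fin: "finite {z. poly ?P z = 0}" by (rule poly_roots_finite[OF P])
  show "finite (embeddings F)" using finite_subset[OF sub fin] inj finite_imageD by blast
  have "card (embeddings F) \<le> card {z. poly ?P z = 0}" by (rule card_inj_on_le[OF inj sub fin])
  also have "\<dots> \<le> degree ?P" by (rule card_poly_roots_bound[OF P])
  finally show "card (embeddings F) \<le> degree f" by simp
qed

lemma finite_embeddings: "finite (embeddings F)"
proof -
  obtain p where p: "poly (map_poly of_int p) \<xi> = 0" "lead_coeff p = (1::int)"
    using \<xi> unfolding algebraic_int_altdef_ipoly by blast
  then have "p \<noteq> 0" by auto
  then show ?thesis using embeddings_finite_card p by blast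
qed

lemma inclusion_embedding: "restrict (\<lambda>x. x) F \<in> embeddings F"
  using subfield_1[OF F] by (auto simp: embeddings_eq field_hom_def subfield_add[OF F] subfield_mult[OF F])

lemma card_embeddings_pos: "card (embeddings F) > 0"
  using inclusion_embedding finite_embeddings by (auto simp: card_gt_0_iff)

lemma embedding_conj_algebraic_int: "\<sigma> \<in> embeddings F \<Longrightarrow> algebraic_int (\<sigma> \<xi>)"
  using subfield_hom.hom_algebraic_int[OF embedding_hom] \<xi> \<xi>_in by blast

lemma embedding_range:
  assumes \<sigma>: "\<sigma> \<in> embeddings F" and E: "complex_subfield E" "\<sigma> \<xi> \<in> E" and x: "x \<in> F"
  shows "\<sigma> x \<in> E"
proof -
  obtain p where "p \<in> polys_over \<rat>" "\<sigma> x = poly p (\<sigma> \<xi>)"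
    using hom_image[OF embedding_hom[OF \<sigma>] x] by blast
  then show ?thesis
    using poly_in_subfield[OF E(1) _ E(2)] subfield_Rats[OF E(1)] by (auto simp: polys_over_def)
qed

lemma embedding_compose:
  assumes \<sigma>: "\<sigma> \<in> embeddings F" and E: "subfield_hom E \<tau>" "\<sigma> \<xi> \<in> E"
  shows "restrict (\<tau> \<circ> \<sigma>) F \<in> embeddings F"
proof -
  interpret s: subfield_hom F \<sigma> by (rule embedding_hom) fact
  interpret t: subfield_hom E \<tau> by fact
  have r: "\<sigma> x \<in> E" if "x \<in> F" for x using embedding_range[OF \<sigma> t.sub E(2) that] .
  show ?thesis
    using r subfield_1[OF F]
    by (auto simp: embeddings_eq field_hom_def s.hom_1 t.hom_1 s.hom_add s.hom_mult t.hom_add t.hom_mult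
        subfield_add[OF F] subfield_mult[OF F])
qed

lemma trace_combination:
  assumes c: "\<And>i. i < n \<Longrightarrow> c i \<in> \<rat>" and b: "\<And>i. i < n \<Longrightarrow> b i \<in> F"
  shows "field_trace F (\<Sum>i<n. c i * b i) = (\<Sum>i<n. c i * field_trace F (b i))"
proof -
  have "field_trace F (\<Sum>i<n. c i * b i) = (\<Sum>\<sigma>\<in>embeddings F. \<Sum>i<n. c i * \<sigma> (b i))"
    unfolding field_trace_def
  proof (rule sum.cong[OF refl])
    fix \<sigma> assume "\<sigma> \<in> embeddings F"
    then interpret subfield_hom F \<sigma> by (rule embedding_hom)
    have cF: "i < n \<Longrightarrow> c i \<in> F" for i using c subfield_Rats[OF F] by blast
    have "\<sigma> (\<Sum>i<n. c i * b i) = (\<Sum>i<n. \<sigma> (c i * b i))"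
      by (rule hom_sum) (auto intro: subfield_mult[OF F] cF b)
    also have "\<dots> = (\<Sum>i<n. c i * \<sigma> (b i))"
      by (rule sum.cong) (auto simp: hom_mult cF b hom_Rats c)
    finally show "\<sigma> (\<Sum>i<n. c i * b i) = (\<Sum>i<n. c i * \<sigma> (b i))" .
  qed
  also have "\<dots> = (\<Sum>i<n. c i * field_trace F (b i))"
    unfolding field_trace_def by (subst sum.swap) (simp add: sum_distrib_left)
  finally show ?thesis .
qed

lemma trace_scale: "c \<in> \<rat> \<Longrightarrow> x \<in> F \<Longrightarrow> field_trace F (c * x) = c * field_trace F x"
  using trace_combination[of "Suc 0" "\<lambda>_. c" "\<lambda>_. x"] by (simp add: lessThan_Suc del: sum_constant)

lemma trace_one: "field_trace F 1 = of_nat (card (embeddings F))"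
proof -
  have "field_trace F 1 = (\<Sum>\<sigma>\<in>embeddings F. 1)"
    unfolding field_trace_def by (rule sum.cong) (auto simp: embeddings_def)
  then show ?thesis by simp
qed

lemma trace_algebraic_int:
  assumes "x \<in> ring_of_integers F"
  shows "algebraic_int (field_trace F x)"
  unfolding field_trace_def
  using assms subfield_hom.hom_algebraic_int[OF embedding_hom]
  by (intro algebraic_int_sum) (auto simp: ring_of_integers_def)

text \<open>
  A homomorphism defined on all conjugates permutes the embeddings by composition and so fixes the trace. By
  \<open>nonrational_conjugate\<close> the trace is then rational, and an integral rational number is an integer.
\<close>

lemma trace_Ints:
  assumes x: "x \<in> ring_of_integers F"
  shows "field_trace F x \<in> \<int>"
proof -
  let ?y = "field_trace F x"
  have xF: "x \<in> F" using x by (simp add: ring_of_integers_def)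
  have "?y \<in> \<rat>"
  proof (rule ccontr)
    assume "?y \<notin> \<rat>"
    moreover have "finite ((\<lambda>\<sigma>. \<sigma> \<xi>) ` embeddings F)" using finite_embeddings by simp
    moreover have "algebraic_over \<rat> s" if "s \<in> (\<lambda>\<sigma>. \<sigma> \<xi>) ` embeddings F" for s
      using that embedding_conj_algebraic_int algebraic_int_imp_algebraic_over_Rats by auto
    ultimately obtain E \<tau> where E: "complex_subfield E" "(\<lambda>\<sigma>. \<sigma> \<xi>) ` embeddings F \<subseteq> E"
      "field_hom E \<tau>" "\<tau> ?y \<noteq> ?y"
      using nonrational_conjugate[OF algebraic_int_imp_algebraic_over_Rats[OF trace_algebraic_int[OF x]]]
      by metis
    interpret t: subfield_hom E \<tau> by unfold_locales (use E in auto)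
    have in_E: "\<sigma> u \<in> E" if "\<sigma> \<in> embeddings F" "u \<in> F" for \<sigma> u
      using embedding_range[OF that(1) E(1) _ that(2)] E(2) that(1) by blast
    let ?c = "\<lambda>\<sigma>. restrict (\<tau> \<circ> \<sigma>) F"
    have cm: "?c ` embeddings F \<subseteq> embeddings F"
      using embedding_compose[OF _ t.subfield_hom_axioms] E(2) by blast
    have "inj_on ?c (embeddings F)"
    proof (rule inj_onI)
      fix \<sigma> \<rho> assume a: "\<sigma> \<in> embeddings F" "\<rho> \<in> embeddings F" "?c \<sigma> = ?c \<rho>"
      from a(3) have "\<tau> (\<sigma> \<xi>) = \<tau> (\<rho> \<xi>)" using \<xi>_in by (metis comp_apply restrict_apply')
      then have "\<tau> (\<sigma> \<xi> - \<rho> \<xi>) = 0" using t.hom_diff in_E a \<xi>_in by simp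
      then have "\<sigma> \<xi> - \<rho> \<xi> = 0"
        using t.hom_eq_0_iff[of "\<sigma> \<xi> - \<rho> \<xi>"] subfield_diff[OF E(1)] in_E a \<xi>_in by simp
      then show "\<sigma> = \<rho>" using embedding_eqI a by simp
    qed
    then have bij: "bij_betw ?c (embeddings F) (embeddings F)"
      using cm finite_embeddings by (simp add: bij_betw_def endo_inj_surj)
    have "\<tau> ?y = (\<Sum>\<sigma>\<in>embeddings F. \<tau> (\<sigma> x))"
      unfolding field_trace_def by (rule t.hom_sum) (use in_E xF in auto)
    also have "\<dots> = (\<Sum>\<sigma>\<in>embeddings F. ?c \<sigma> x)" using xF by simp
    also have "\<dots> = ?y" unfolding field_trace_def by (rule sum.reindex_bij_betw[OF bij])
    finally show False using E(4) by simp
  qed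
  then show ?thesis using trace_algebraic_int[OF x] by (simp add: rational_algebraic_int_is_int)
qed

lemma trace_Rats:
  assumes "x \<in> F"
  shows "field_trace F x \<in> \<rat>"
proof -
  obtain k :: int where k: "k \<noteq> 0" "of_int k * x \<in> ring_of_integers F"
    using integral_multiple[OF assms] by blast
  have "of_int k * field_trace F x \<in> \<int>"
    using trace_Ints[OF k(2)] trace_scale[of "of_int k" x] assms by simp
  then have "of_int k * field_trace F x / of_int k \<in> \<rat>"
    using Ints_subset_Rats by (intro Rats_divide) auto
  with k(1) show ?thesis by simp
qed

lemma fixed_imp_rational:
  assumes x: "x \<in> F" and fixed: "\<And>\<sigma>. \<sigma> \<in> embeddings F \<Longrightarrow> \<sigma> x = x"
  shows "x \<in> \<rat>"
proof -
  have "field_trace F x = of_nat (card (embeddings F)) * x"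
    by (simp add: field_trace_def fixed)
  then have "of_nat (card (embeddings F)) * x / of_nat (card (embeddings F)) \<in> \<rat>"
    using trace_Rats[OF x] by (intro Rats_divide) auto
  then show ?thesis using card_embeddings_pos by simp
qed

lemma ring_of_integers_closed:
  assumes "x \<in> ring_of_integers F" "y \<in> ring_of_integers F"
  shows "x + y \<in> ring_of_integers F" "x - y \<in> ring_of_integers F" "x * y \<in> ring_of_integers F"
  using assms algebraic_int_plus algebraic_int_diff algebraic_int_times
    subfield_add[OF F] subfield_diff[OF F] subfield_mult[OF F]
  by (auto simp: ring_of_integers_def)

lemma of_int_in_ring_of_integers: "of_int k \<in> ring_of_integers F"
  by (simp add: ring_of_integers_def subfield_of_int[OF F])

end

section \<open>Integral bases and the discriminant\<close>

lemma (in Modules.module) span_family: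
  fixes b :: "nat \<Rightarrow> 'b"
  assumes inj: "inj_on b {..<n}"
  shows "span (b ` {..<n}) = range (\<lambda>k. \<Sum>i<n. scale (k i) (b i))"
proof -
  have "span (b ` {..<n}) = range (\<lambda>u. \<Sum>v\<in>b ` {..<n}. scale (u v) v)"
    by (rule span_finite) simp
  also have "\<dots> = range (\<lambda>k. \<Sum>i<n. scale (k i) (b i))"
  proof (intro equalityI subsetI; elim rangeE)
    fix x u assume "x = (\<Sum>v\<in>b ` {..<n}. scale (u v) v)"
    then have "x = (\<Sum>i<n. scale (u (b i)) (b i))" by (simp add: sum.reindex[OF inj])
    then show "x \<in> range (\<lambda>k. \<Sum>i<n. scale (k i) (b i))" by (intro range_eqI[of _ _ "\<lambda>i. u (b i)"])
  next
    fix x k assume "x = (\<Sum>i<n. scale (k i) (b i))"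
    then have "x = (\<Sum>v\<in>b ` {..<n}. scale (k (the_inv_into {..<n} b v)) v)"
      by (simp add: sum.reindex[OF inj] the_inv_into_f_f[OF inj])
    then show "x \<in> range (\<lambda>u. \<Sum>v\<in>b ` {..<n}. scale (u v) v)"
      by (intro range_eqI[of _ _ "\<lambda>v. k (the_inv_into {..<n} b v)"])
  qed
  finally show ?thesis .
qed

lemma (in Modules.module) independent_family:
  fixes b :: "nat \<Rightarrow> 'b"
  assumes inj: "inj_on b {..<n}"
  shows "independent (b ` {..<n}) \<longleftrightarrow> (\<forall>k. (\<Sum>i<n. scale (k i) (b i)) = 0 \<longrightarrow> (\<forall>i<n. k i = 0))"
proof
  assume ind: "independent (b ` {..<n})"
  show "\<forall>k. (\<Sum>i<n. scale (k i) (b i)) = 0 \<longrightarrow> (\<forall>i<n. k i = 0)"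
  proof (intro allI impI)
    fix k i assume k: "(\<Sum>i<n. scale (k i) (b i)) = 0" and i: "i < n"
    let ?u = "\<lambda>v. k (the_inv_into {..<n} b v)"
    have comb: "(\<Sum>v\<in>b ` {..<n}. scale (?u v) v) = 0"
      using k by (simp add: sum.reindex[OF inj] the_inv_into_f_f[OF inj])
    have nd: "\<not> (\<exists>u. (\<exists>v\<in>b ` {..<n}. u v \<noteq> 0) \<and> (\<Sum>v\<in>b ` {..<n}. scale (u v) v) = 0)"
      using ind unfolding dependent_finite[OF finite_imageI[OF finite_lessThan]] .
    show "k i = 0"
    proof (rule ccontr)
      assume "k i \<noteq> 0"
      then have "\<exists>v\<in>b ` {..<n}. ?u v \<noteq> 0"
        using i by (intro bexI[of _ "b i"]) (auto simp: the_inv_into_f_f[OF inj])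
      with comb have "(\<exists>v\<in>b ` {..<n}. ?u v \<noteq> 0) \<and> (\<Sum>v\<in>b ` {..<n}. scale (?u v) v) = 0" by (rule conjI[rotated])
      then have "\<exists>u. (\<exists>v\<in>b ` {..<n}. u v \<noteq> 0) \<and> (\<Sum>v\<in>b ` {..<n}. scale (u v) v) = 0"
        by (rule exI[of _ ?u])
      with nd show False by (rule notE)
    qed
  qed
next
  assume *: "\<forall>k. (\<Sum>i<n. scale (k i) (b i)) = 0 \<longrightarrow> (\<forall>i<n. k i = 0)"
  show "independent (b ` {..<n})"
  proof
    assume "dependent (b ` {..<n})"
    then obtain u i where u: "i < n" "u (b i) \<noteq> 0" "(\<Sum>v\<in>b ` {..<n}. scale (u v) v) = 0"
      by (auto simp: dependent_finite)
    then have "(\<Sum>i<n. scale (u (b i)) (b i)) = 0" by (simp add: sum.reindex[OF inj])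
    with *[rule_format, of "\<lambda>i. u (b i)", OF _ u(1)] u(2) show False by simp
  qed
qed

text \<open>
  Bases are indexed families, so that change of basis is given by square matrices. The first notion is
  an integral basis (see \<open>integral_basis_iff_family\<close>), the second a basis over the rationals.
\<close>

definition integral_family :: "complex set \<Rightarrow> nat \<Rightarrow> (nat \<Rightarrow> complex) \<Rightarrow> bool" where
  "integral_family F n b \<longleftrightarrow> (\<forall>i<n. b i \<in> ring_of_integers F) \<and>
     (\<forall>x\<in>ring_of_integers F. \<exists>k :: nat \<Rightarrow> int. x = (\<Sum>i<n. of_int (k i) * b i)) \<and>
     (\<forall>k :: nat \<Rightarrow> int. (\<Sum>i<n. of_int (k i) * b i) = 0 \<longrightarrow> (\<forall>i<n. k i = 0))"

definition rational_family :: "complex set \<Rightarrow> nat \<Rightarrow> (nat \<Rightarrow> complex) \<Rightarrow> bool" where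
  "rational_family F n b \<longleftrightarrow> (\<forall>i<n. b i \<in> F) \<and>
     (\<forall>x\<in>F. \<exists>q :: nat \<Rightarrow> rat. x = (\<Sum>i<n. of_rat (q i) * b i)) \<and>
     (\<forall>q :: nat \<Rightarrow> rat. (\<Sum>i<n. of_rat (q i) * b i) = 0 \<longrightarrow> (\<forall>i<n. q i = 0))"

lemma independent_combinations_inj:
  assumes "\<forall>k :: nat \<Rightarrow> int. (\<Sum>i<n. of_int (k i) * b i) = (0 :: complex) \<longrightarrow> (\<forall>i<n. k i = 0)"
  shows "inj_on b {..<n}"
proof (rule inj_onI, rule ccontr)
  fix i j assume ij: "i \<in> {..<n}" "j \<in> {..<n}" "b i = b j" "i \<noteq> j"
  let ?k = "\<lambda>l. of_bool (l = i) - of_bool (l = j) :: int"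
  have "(\<Sum>l<n. of_int (?k l) * b l) = (\<Sum>l<n. if l = i then b l else 0) - (\<Sum>l<n. if l = j then b l else 0)"
    unfolding sum_subtractf[symmetric] by (intro sum.cong) auto
  also have "\<dots> = 0" using ij by simp
  finally show False using assms[THEN spec, of ?k] ij by auto
qed

lemma integral_basis_iff_family:
  assumes F: "complex_subfield F"
  shows "integral_basis F bs \<longleftrightarrow> integral_family F (length bs) (\<lambda>i. bs ! i)"
proof -
  let ?n = "length bs" and ?b = "\<lambda>i. bs ! i" and ?O = "ring_of_integers F"
  have img: "set bs = ?b ` {..<?n}" by (auto simp: set_conv_nth)
  have dist: "distinct bs \<longleftrightarrow> inj_on ?b {..<?n}" by (auto simp: distinct_conv_nth inj_on_def)
  have comb: "(\<Sum>i<?n. of_int (k i) * ?b i) \<in> ?O" if "\<forall>i<?n. ?b i \<in> ?O" for k :: "nat \<Rightarrow> int"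
    using that unfolding ring_of_integers_def
    by (auto intro!: subfield_sum[OF F] algebraic_int_sum algebraic_int_times
        subfield_mult[OF F] subfield_of_int[OF F])
  show ?thesis
  proof
    assume ib: "integral_basis F bs"
    then have inj: "inj_on ?b {..<?n}" using dist by (simp add: integral_basis_def)
    have "?b i \<in> ?O" if "i < ?n" for i
      using ib int_mod.span_base[of "?b i" "set bs"] that by (simp add: integral_basis_def)
    moreover have "?O = range (\<lambda>k. \<Sum>i<?n. of_int (k i) * ?b i)"
      using ib int_mod.span_family[OF inj] img by (simp add: integral_basis_def)
    moreover have "\<forall>k :: nat \<Rightarrow> int. (\<Sum>i<?n. of_int (k i) * ?b i) = 0 \<longrightarrow> (\<forall>i<?n. k i = 0)"
      using ib int_mod.independent_family[OF inj] img by (simp add: integral_basis_def)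
    ultimately show "integral_family F ?n ?b" unfolding integral_family_def by blast
  next
    assume fam: "integral_family F ?n ?b"
    then have inj: "inj_on ?b {..<?n}"
      using independent_combinations_inj by (simp add: integral_family_def)
    have "?O = range (\<lambda>k. \<Sum>i<?n. of_int (k i) * ?b i)"
      using fam comb unfolding integral_family_def by blast
    then have "int_mod.span (set bs) = ?O" using int_mod.span_family[OF inj] img by simp
    moreover have "int_mod.independent (set bs)"
      using fam int_mod.independent_family[OF inj] img by (simp add: integral_family_def)
    ultimately show "integral_basis F bs" using dist inj by (simp add: integral_basis_def)
  qed
qed

lemma rational_family_dim:
  assumes fam: "rational_family F n b"
  shows "field_degree F = n"
proof -
  have "inj_on b {..<n}"
  proof (rule independent_combinations_inj, intro allI impI)
    fix k :: "nat \<Rightarrow> int" and i assume "(\<Sum>i<n. of_int (k i) * b i) = 0" "i < n"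
    then have "(\<Sum>i<n. of_rat (of_int (k i)) * b i) = 0" by simp
    then show "k i = 0"
      using fam \<open>i < n\<close> unfolding rational_family_def by (metis of_int_eq_0_iff)
  qed
  note inj = this
  have span: "rat_vs.span (b ` {..<n}) = range (\<lambda>q. \<Sum>i<n. of_rat (q i) * b i)"
    by (rule rat_vs.span_family[OF inj])
  have "rat_vs.independent (b ` {..<n})"
    using fam rat_vs.independent_family[OF inj] by (simp add: rational_family_def)
  moreover have "b ` {..<n} \<subseteq> F" using fam by (auto simp: rational_family_def)
  moreover have "F \<subseteq> rat_vs.span (b ` {..<n})" using fam unfolding span rational_family_def by blast
  ultimately show ?thesis
    unfolding field_degree_def using inj by (intro rat_vs.dim_unique) (auto simp: card_image)
qed

definition family_discriminant :: "complex set \<Rightarrow> nat \<Rightarrow> (nat \<Rightarrow> complex) \<Rightarrow> complex" where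
  "family_discriminant F n b = det (mat n n (\<lambda>(i, j). field_trace F (b i * b j)))"

lemma basis_discriminant_eq:
  "basis_discriminant F bs = family_discriminant F (length bs) (\<lambda>i. bs ! i)"
  by (simp add: basis_discriminant_def family_discriminant_def)

context simple_number_field
begin

lemma integral_imp_rational_family:
  assumes fam: "integral_family F n b"
  shows "rational_family F n b"
  unfolding rational_family_def
proof (intro conjI allI ballI impI)
  show "b i \<in> F" if "i < n" for i
    using fam that by (auto simp: integral_family_def ring_of_integers_def)
next
  fix x assume "x \<in> F"
  then obtain c :: int where c: "c \<noteq> 0" "of_int c * x \<in> ring_of_integers F"
    using integral_multiple by blast
  then obtain k :: "nat \<Rightarrow> int" where k: "of_int c * x = (\<Sum>i<n. of_int (k i) * b i)"
    using fam unfolding integral_family_def by blast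
  have "x = (of_int c * x) / of_int c" using c by simp
  also have "\<dots> = (\<Sum>i<n. of_rat (of_int (k i) / of_int c) * b i)"
    unfolding k sum_divide_distrib by (simp add: of_rat_divide)
  finally show "\<exists>q :: nat \<Rightarrow> rat. x = (\<Sum>i<n. of_rat (q i) * b i)"
    by (rule exI[of _ "\<lambda>i. of_int (k i) / of_int c"])
next
  fix q :: "nat \<Rightarrow> rat" and i assume q: "(\<Sum>i<n. of_rat (q i) * b i) = 0" and i: "i < n"
  obtain c :: int where c: "c \<noteq> 0" "\<forall>i<n. \<exists>u :: int. of_int c * q i = of_int u"
    using common_denominator by blast
  then obtain u :: "nat \<Rightarrow> int" where u: "\<And>i. i < n \<Longrightarrow> of_int c * q i = of_int (u i)" by metis
  have u': "of_int (u i) = of_int c * (of_rat (q i) :: complex)" if "i < n" for i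
    using arg_cong[OF u[OF that], of "of_rat :: rat \<Rightarrow> complex"] by (simp add: of_rat_mult)
  have "(\<Sum>i<n. of_int (u i) * b i) = of_int c * (\<Sum>i<n. of_rat (q i) * b i)"
    unfolding sum_distrib_left by (intro sum.cong refl) (simp add: u' mult.assoc)
  with q have "(\<Sum>i<n. of_int (u i) * b i) = 0" by simp
  then have "u i = 0" using fam i unfolding integral_family_def by blast
  with u[OF i] c(1) show "q i = 0" by simp
qed

lemma family_discriminant_change:
  assumes C: "\<And>i j. i < n \<Longrightarrow> j < n \<Longrightarrow> C i j \<in> \<rat>" and b: "\<And>i. i < n \<Longrightarrow> b i \<in> F"
    and c: "\<And>i. i < n \<Longrightarrow> c i = (\<Sum>j<n. C i j * b j)"
  shows "family_discriminant F n c = det (mat n n (\<lambda>(i, j). C i j)) ^ 2 * family_discriminant F n b"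
proof -
  let ?C = "mat n n (\<lambda>(i, j). C i j)"
  let ?G = "mat n n (\<lambda>(i, j). field_trace F (b i * b j))"
  have "mat n n (\<lambda>(i, j). field_trace F (c i * c j)) = ?C * (?G * ?C\<^sup>T)"
  proof (rule eq_matI)
    fix i j assume "i < dim_row (?C * (?G * ?C\<^sup>T))" "j < dim_col (?C * (?G * ?C\<^sup>T))"
    then have ij: "i < n" "j < n" by auto
    have cF: "c l \<in> F" if "l < n" for l
      unfolding c[OF that] using C that b subfield_Rats[OF F]
      by (intro subfield_sum[OF F] subfield_mult[OF F]) auto
    have "field_trace F (c i * c j) = field_trace F (\<Sum>k<n. C i k * (b k * c j))"
      by (simp add: c[OF ij(1)] sum_distrib_right mult.assoc)
    also have "\<dots> = (\<Sum>k<n. C i k * field_trace F (b k * c j))"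
      by (rule trace_combination) (use ij C b cF subfield_mult[OF F] in auto)
    also have "\<dots> = (\<Sum>k<n. C i k * (\<Sum>l<n. field_trace F (b k * b l) * C j l))"
    proof (intro sum.cong refl)
      fix k assume k: "k \<in> {..<n}"
      have "b k * c j = (\<Sum>l<n. C j l * (b k * b l))"
        by (simp add: c[OF ij(2)] sum_distrib_left mult.left_commute)
      then have "field_trace F (b k * c j) = (\<Sum>l<n. C j l * field_trace F (b k * b l))"
        using trace_combination[of n "C j" "\<lambda>l. b k * b l"] ij C b k subfield_mult[OF F] by simp
      then show "C i k * field_trace F (b k * c j) = C i k * (\<Sum>l<n. field_trace F (b k * b l) * C j l)"
        by (simp add: mult.commute)
    qed
    finally show "mat n n (\<lambda>(i, j). field_trace F (c i * c j)) $$ (i, j) = (?C * (?G * ?C\<^sup>T)) $$ (i, j)"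
      using ij by (simp add: scalar_prod_def atLeast0LessThan)
  qed auto
  then have "family_discriminant F n c = det (?C * (?G * ?C\<^sup>T))"
    by (simp add: family_discriminant_def)
  also have "\<dots> = det ?C * det (?G * ?C\<^sup>T)"
    by (rule det_mult[of _ n]) (auto intro!: mult_carrier_mat[of _ n n])
  also have "det (?G * ?C\<^sup>T) = det ?G * det ?C\<^sup>T"
    by (rule det_mult[of _ n]) auto
  also have "det ?C\<^sup>T = det ?C" by (rule det_transpose[of _ n]) simp
  finally show ?thesis by (simp add: family_discriminant_def power2_eq_square)
qed

lemma family_discriminant_Rats:
  assumes "\<And>i. i < n \<Longrightarrow> b i \<in> F"
  shows "family_discriminant F n b \<in> \<rat>"
  unfolding family_discriminant_def
  by (rule det_in_subfield[OF complex_subfield_Rats, of _ n])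
     (auto intro!: trace_Rats subfield_mult[OF F] assms)

lemma family_discriminant_Ints:
  assumes "\<And>i. i < n \<Longrightarrow> b i \<in> ring_of_integers F"
  shows "family_discriminant F n b \<in> \<int>"
proof (rule rational_algebraic_int_is_int)
  show "family_discriminant F n b \<in> \<rat>"
    using assms by (intro family_discriminant_Rats) (simp add: ring_of_integers_def)
  show "algebraic_int (family_discriminant F n b)"
    unfolding family_discriminant_def
    by (rule algebraic_int_det[of _ n])
       (auto intro!: trace_algebraic_int ring_of_integers_closed assms)
qed

text \<open>
  The trace form is nondegenerate: an element \<open>x\<close> of its kernel, if nonzero, would give trace 0 to
  \<open>inverse x * x = 1\<close>, whose trace is the number of embeddings.
\<close>

lemma family_discriminant_nonzero:
  assumes fam: "rational_family F n b"
  shows "family_discriminant F n b \<noteq> 0"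
proof
  assume zero: "family_discriminant F n b = 0"
  have bF: "b i \<in> F" if "i < n" for i using fam that by (simp add: rational_family_def)
  have "\<exists>q :: rat. field_trace F (b i * b j) = of_rat q" if "i < n" "j < n" for i j
    using trace_Rats[OF subfield_mult[OF F bF[OF that(1)] bF[OF that(2)]]] by (auto elim: Rats_cases)
  then obtain g :: "nat \<Rightarrow> nat \<Rightarrow> rat"
    where g: "\<And>i j. i < n \<Longrightarrow> j < n \<Longrightarrow> field_trace F (b i * b j) = of_rat (g i j)" by metis
  let ?G = "mat n n (\<lambda>(i, j). g i j)"
  have "mat n n (\<lambda>(i, j). field_trace F (b i * b j)) = map_mat of_rat ?G"
    by (rule eq_matI) (auto simp: g)
  then have "of_rat (det ?G) = (0 :: complex)"
    using zero by (simp add: family_discriminant_def of_rat_hom.hom_det)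
  then have "det ?G = 0" by simp
  then obtain v where v: "v \<in> carrier_vec n" "v \<noteq> 0\<^sub>v n" "?G *\<^sub>v v = 0\<^sub>v n"
    using det_0_iff_vec_prod_zero_field[of ?G n] by auto
  define x where "x = (\<Sum>j<n. of_rat (v $ j) * b j)"
  have xF: "x \<in> F" unfolding x_def by (intro subfield_sum[OF F] subfield_mult[OF F] subfield_of_rat[OF F] bF) simp
  have x0: "x \<noteq> 0"
  proof
    assume "x = 0"
    then have "\<forall>i<n. v $ i = 0" using fam unfolding x_def rational_family_def by blast
    with v(1,2) show False by (auto intro!: eq_vecI)
  qed
  have tr: "field_trace F (b i * x) = 0" if i: "i < n" for i
  proof -
    have "b i * x = (\<Sum>j<n. of_rat (v $ j) * (b i * b j))"
      by (simp add: x_def sum_distrib_left mult.left_commute)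
    then have "field_trace F (b i * x) = (\<Sum>j<n. of_rat (v $ j) * field_trace F (b i * b j))"
      using trace_combination[of n "\<lambda>j. of_rat (v $ j)" "\<lambda>j. b i * b j"] subfield_mult[OF F bF[OF i] bF]
      by simp
    also have "\<dots> = of_rat (\<Sum>j<n. g i j * v $ j)"
      using g[OF i] by (simp add: of_rat_sum of_rat_mult mult.commute)
    also have "(\<Sum>j<n. g i j * v $ j) = (?G *\<^sub>v v) $ i"
      using i v(1) by (simp add: scalar_prod_def atLeast0LessThan)
    finally show ?thesis using v(3) i by simp
  qed
  obtain q :: "nat \<Rightarrow> rat" where q: "inverse x = (\<Sum>i<n. of_rat (q i) * b i)"
    using fam subfield_inverse[OF F xF] unfolding rational_family_def by blast
  have "1 = (\<Sum>i<n. of_rat (q i) * (b i * x))"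
    using x0 arg_cong[OF q, of "\<lambda>y. y * x"] by (simp add: sum_distrib_right mult.assoc)
  then have "field_trace F 1 = (\<Sum>i<n. of_rat (q i) * field_trace F (b i * x))"
    using trace_combination[of n "\<lambda>i. of_rat (q i)" "\<lambda>i. b i * x"] subfield_mult[OF F bF xF] by simp
  also have "\<dots> = 0" by (simp add: tr)
  finally show False using card_embeddings_pos by (simp add: trace_one)
qed

lemma integral_rational_family_exists:
  assumes nf: "number_field F"
  shows "\<exists>n b. rational_family F n b \<and> (\<forall>i<n. b i \<in> ring_of_integers F)"
proof -
  obtain T where T: "finite T" "rat_vs.span T = F" using nf by (auto simp: number_field_def)
  obtain B where B: "B \<subseteq> ring_of_integers F" "rat_vs.independent B" "ring_of_integers F \<subseteq> rat_vs.span B"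
    using rat_vs.basis_exists by metis
  have "B \<subseteq> rat_vs.span T" using B(1) T(2) by (auto simp: ring_of_integers_def)
  then have "finite B" using rat_vs.independent_span_bound[OF T(1) B(2)] by blast
  then obtain bs where bs: "set bs = B" "distinct bs" using finite_distinct_list by blast
  let ?n = "length bs" and ?b = "\<lambda>i. bs ! i"
  have img: "B = ?b ` {..<?n}" using bs(1) by (auto simp: set_conv_nth)
  have inj: "inj_on ?b {..<?n}" using bs(2) by (auto simp: distinct_conv_nth inj_on_def)
  have bO: "\<forall>i<?n. ?b i \<in> ring_of_integers F" using B(1) bs(1) by auto
  have "F \<subseteq> rat_vs.span B"
  proof
    fix x assume "x \<in> F"
    then obtain c :: int where c: "c \<noteq> 0" "of_int c * x \<in> ring_of_integers F" using integral_multiple by blast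
    then have "of_rat (1 / of_int c) * (of_int c * x) \<in> rat_vs.span B"
      using B(3) by (intro rat_vs.span_scale) auto
    with c(1) show "x \<in> rat_vs.span B" by (simp add: of_rat_divide)
  qed
  then have "\<forall>x\<in>F. \<exists>q :: nat \<Rightarrow> rat. x = (\<Sum>i<?n. of_rat (q i) * ?b i)"
    using rat_vs.span_family[OF inj] img by auto
  moreover have "\<forall>q :: nat \<Rightarrow> rat. (\<Sum>i<?n. of_rat (q i) * ?b i) = 0 \<longrightarrow> (\<forall>i<?n. q i = 0)"
    using B(2) rat_vs.independent_family[OF inj] img by simp
  ultimately have "rational_family F ?n ?b"
    using bO unfolding rational_family_def by (simp add: ring_of_integers_def)
  with bO show ?thesis by blast
qed

text \<open>
  Among the rational bases that consist of integers, one whose discriminant has minimal absolute value is integral.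
  Otherwise some integer has a coordinate with fractional part \<open>r\<close> strictly between 0 and 1; after subtracting a
  multiple of the basis vector \<open>b i\<close> in question, it can replace \<open>b i\<close>, and the discriminant is
  multiplied by \<open>r\<^sup>2 < 1\<close>.
\<close>

lemma integral_family_exists:
  assumes nf: "number_field F"
  shows "\<exists>n b. integral_family F n b"
proof -
  obtain n b0 where "rational_family F n b0 \<and> (\<forall>i<n. b0 i \<in> ring_of_integers F)"
    using integral_rational_family_exists[OF nf] by blast
  from ex_has_least_nat[of "\<lambda>b. rational_family F n b \<and> (\<forall>i<n. b i \<in> ring_of_integers F)" b0
      "\<lambda>b. nat \<lfloor>cmod (family_discriminant F n b)\<rfloor>", OF this]
  obtain b where b: "rational_family F n b" "\<forall>i<n. b i \<in> ring_of_integers F"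
    and least: "\<And>c. rational_family F n c \<Longrightarrow> \<forall>i<n. c i \<in> ring_of_integers F \<Longrightarrow>
      nat \<lfloor>cmod (family_discriminant F n b)\<rfloor> \<le> nat \<lfloor>cmod (family_discriminant F n c)\<rfloor>"
    by blast
  have bF: "b i \<in> F" if "i < n" for i using b(1) that by (simp add: rational_family_def)
  have int: "q i \<in> \<int>"
    if x: "x \<in> ring_of_integers F" and q: "x = (\<Sum>i<n. of_rat (q i) * b i)" and i: "i < n"
    for x and q :: "nat \<Rightarrow> rat" and i
  proof (rule ccontr)
    assume "q i \<notin> \<int>"
    define r where "r = frac (q i)"
    have r: "0 < r" "r < 1" using \<open>q i \<notin> \<int>\<close> by (simp_all add: r_def frac_gt_0_iff frac_lt_1)
    define y where "y = x - of_int \<lfloor>q i\<rfloor> * b i"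
    define c where "c = b(i := y)"
    define q' where "q' = q(i := r)"
    have y: "y = (\<Sum>j<n. of_rat (q' j) * b j)"
    proof -
      have "(\<Sum>j<n. of_rat (q' j) * b j) = of_rat r * b i + (\<Sum>j\<in>{..<n} - {i}. of_rat (q j) * b j)"
        using i by (subst sum.remove[of _ i]) (auto simp: q'_def intro!: sum.cong)
      moreover have "x = of_rat (q i) * b i + (\<Sum>j\<in>{..<n} - {i}. of_rat (q j) * b j)"
        unfolding q using i by (subst sum.remove[of _ i]) auto
      moreover have "(of_rat (q i) :: complex) = of_rat r + of_int \<lfloor>q i\<rfloor>"
        unfolding r_def frac_def by (simp add: of_rat_diff)
      ultimately show ?thesis unfolding y_def by (simp add: algebra_simps)
    qed
    have yO: "y \<in> ring_of_integers F"
      unfolding y_def using x b(2) i by (intro ring_of_integers_closed of_int_in_ring_of_integers) auto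
    have cO: "\<forall>j<n. c j \<in> ring_of_integers F" using b(2) yO by (simp add: c_def)
    define C where "C = (\<lambda>k j. if k = i then of_rat (q' j) else of_bool (j = k) :: complex)"
    have c: "c k = (\<Sum>j<n. C k j * b j)" if k: "k < n" for k
    proof (cases "k = i")
      case False
      have "(\<Sum>j<n. C k j * b j) = (\<Sum>j<n. if j = k then b j else 0)"
        using False by (intro sum.cong) (auto simp: C_def)
      with False k show ?thesis by (simp add: c_def)
    qed (simp add: c_def C_def y)
    \<comment> \<open>The transposed matrix is the identity with one column replaced, so Cramer applied to the identity gives its determinant.\<close>
    have detC: "det (mat n n (\<lambda>(k, j). C k j)) = of_rat r"
    proof -
      let ?v = "vec n (\<lambda>j. of_rat (q' j)) :: complex vec"
      have v: "?v \<in> carrier_vec n" by simp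
      have "(mat n n (\<lambda>(k, j). C k j))\<^sup>T = replace_col (1\<^sub>m n) (1\<^sub>m n *\<^sub>v ?v) i"
        unfolding one_mult_mat_vec[OF v]
        by (rule eq_matI) (auto simp: replace_col_def C_def)
      then have "det (mat n n (\<lambda>(k, j). C k j))\<^sup>T = ?v $ i * det (1\<^sub>m n)"
        using cramer_lemma_mat[OF one_carrier_mat v i] by simp
      then show ?thesis using i by (simp add: det_transpose[of _ n] q'_def)
    qed
    have "C k j \<in> \<rat>" for k j by (simp add: C_def)
    then have dc: "family_discriminant F n c = of_rat r ^ 2 * family_discriminant F n b"
      using family_discriminant_change[of n C b c] bF c detC by simp
    have "rational_family F n c"
      unfolding rational_family_def
    proof (intro conjI allI ballI impI)
      show "c j \<in> F" if "j < n" for j using cO that by (simp add: ring_of_integers_def)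
    next
      fix z assume "z \<in> F"
      then obtain p :: "nat \<Rightarrow> rat" where p: "z = (\<Sum>j<n. of_rat (p j) * b j)"
        using b(1) unfolding rational_family_def by blast
      \<comment> \<open>Solving \<open>y = r b i + \<dots>\<close> for \<open>b i\<close> turns the coefficient \<open>p i\<close> of \<open>b i\<close> into the coefficient \<open>t\<close> of \<open>y\<close>.\<close>
      define t where "t = p i / r"
      have rest: "(\<Sum>j<n. of_rat (h j) * b j) = of_rat (h i) * b i + (\<Sum>j\<in>{..<n} - {i}. of_rat (h j) * b j)"
        for h :: "nat \<Rightarrow> rat" using i by (subst sum.remove[of _ i]) auto
      let ?p = "\<lambda>j. if j = i then t else p j - t * q j"
      have "(\<Sum>j<n. of_rat (?p j) * c j) = of_rat t * y + (\<Sum>j\<in>{..<n} - {i}. of_rat (p j - t * q j) * b j)"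
        using i by (subst sum.remove[of _ i]) (auto simp: c_def intro!: sum.cong)
      also have "\<dots> = of_rat t * (of_rat r * b i + (\<Sum>j\<in>{..<n} - {i}. of_rat (q j) * b j))
          + (\<Sum>j\<in>{..<n} - {i}. of_rat (p j - t * q j) * b j)"
        unfolding y rest[of q'] by (simp add: q'_def)
      also have "\<dots> = of_rat (t * r) * b i + (\<Sum>j\<in>{..<n} - {i}. of_rat (p j) * b j)"
      proof -
        have "(\<Sum>j\<in>{..<n} - {i}. of_rat (p j - t * q j) * b j)
            = (\<Sum>j\<in>{..<n} - {i}. of_rat (p j) * b j) - of_rat t * (\<Sum>j\<in>{..<n} - {i}. of_rat (q j) * b j)"
          by (simp only: of_rat_diff of_rat_mult left_diff_distrib sum_subtractf sum_distrib_left mult.assoc)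
        then show ?thesis by (simp add: of_rat_mult distrib_left mult.assoc)
      qed
      also have "\<dots> = z" unfolding p rest[of p] using r by (simp add: t_def)
      finally show "\<exists>p :: nat \<Rightarrow> rat. z = (\<Sum>j<n. of_rat (p j) * c j)" by metis
    next
      fix p :: "nat \<Rightarrow> rat" and j
      assume p: "(\<Sum>j<n. of_rat (p j) * c j) = 0" and j: "j < n"
      have rest: "(\<Sum>j<n. of_rat (h j) * b j) = of_rat (h i) * b i + (\<Sum>j\<in>{..<n} - {i}. of_rat (h j) * b j)"
        for h :: "nat \<Rightarrow> rat" using i by (subst sum.remove[of _ i]) auto
      let ?h = "\<lambda>j. if j = i then p i * r else p j + p i * q j"
      have "(\<Sum>j<n. of_rat (p j) * c j) = of_rat (p i) * y + (\<Sum>j\<in>{..<n} - {i}. of_rat (p j) * b j)"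
        using i by (subst sum.remove[of _ i]) (auto simp: c_def intro!: sum.cong)
      also have "\<dots> = of_rat (p i) * (of_rat r * b i + (\<Sum>j\<in>{..<n} - {i}. of_rat (q j) * b j))
          + (\<Sum>j\<in>{..<n} - {i}. of_rat (p j) * b j)"
        unfolding y rest[of q'] by (simp add: q'_def)
      also have "\<dots> = of_rat (p i * r) * b i + (\<Sum>j\<in>{..<n} - {i}. of_rat (p j + p i * q j) * b j)"
      proof -
        have "(\<Sum>j\<in>{..<n} - {i}. of_rat (p j + p i * q j) * b j)
            = (\<Sum>j\<in>{..<n} - {i}. of_rat (p j) * b j) + of_rat (p i) * (\<Sum>j\<in>{..<n} - {i}. of_rat (q j) * b j)"
          by (simp only: of_rat_add of_rat_mult distrib_right sum.distrib sum_distrib_left mult.assoc)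
        then show ?thesis by (simp only: of_rat_mult distrib_left mult.assoc add_ac)
      qed
      also have "\<dots> = (\<Sum>j<n. of_rat (?h j) * b j)" unfolding rest[of ?h] by simp
      finally have "(\<Sum>j<n. of_rat (?h j) * b j) = 0" using p by simp
      moreover have "(\<Sum>j<n. of_rat (?h j) * b j) = 0 \<longrightarrow> (\<forall>j<n. ?h j = 0)"
        by (rule spec[of "\<lambda>q :: nat \<Rightarrow> rat. (\<Sum>j<n. of_rat (q j) * b j) = 0 \<longrightarrow> (\<forall>j<n. q j = 0)" ?h])
           (use b(1) in \<open>simp add: rational_family_def\<close>)
      ultimately have h: "\<forall>j<n. ?h j = 0" by (rule mp[rotated])
      have "p i * r = 0" using h[rule_format, OF i] by simp
      then have "p i = 0" using r by simp
      then show "p j = 0" using h[rule_format, OF j] by (simp split: if_splits)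
    qed
    from least[OF this cO]
    have le: "nat \<lfloor>cmod (family_discriminant F n b)\<rfloor> \<le> nat \<lfloor>cmod (family_discriminant F n c)\<rfloor>" .
    obtain D D' :: int where D: "family_discriminant F n b = of_int D" "family_discriminant F n c = of_int D'"
      using family_discriminant_Ints b(2) cO by (metis Ints_cases)
    have "D \<noteq> 0" using family_discriminant_nonzero[OF b(1)] D(1) by auto
    have "nat \<bar>D\<bar> \<le> nat \<bar>D'\<bar>"
      using le unfolding D norm_of_int of_int_abs[symmetric] floor_of_int .
    then have "\<bar>D\<bar> \<le> \<bar>D'\<bar>" by simp
    moreover have "(of_int D' :: complex) = of_rat (r ^ 2 * of_int D)"
      using dc unfolding D by (simp add: of_rat_mult of_rat_power)
    then have "of_int D' = r ^ 2 * of_int D" by (metis of_rat_eq_iff of_rat_of_int_eq)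
    then have "\<bar>of_int D' :: rat\<bar> = r ^ 2 * \<bar>of_int D\<bar>" by (simp add: abs_mult)
    moreover have "r ^ 2 < 1" using r by (simp add: power_less_one_iff)
    then have "r ^ 2 * \<bar>of_int D\<bar> < \<bar>of_int D\<bar>" using \<open>D \<noteq> 0\<close> by simp
    ultimately have "\<bar>of_int D' :: rat\<bar> < \<bar>of_int D\<bar>" by simp
    then have "\<bar>D'\<bar> < \<bar>D\<bar>" by (metis of_int_abs of_int_less_iff)
    with \<open>\<bar>D\<bar> \<le> \<bar>D'\<bar>\<close> show False by simp
  qed
  have "integral_family F n b"
    unfolding integral_family_def
  proof (intro conjI allI ballI impI)
    fix x assume x: "x \<in> ring_of_integers F"
    then obtain q :: "nat \<Rightarrow> rat" where q: "x = (\<Sum>i<n. of_rat (q i) * b i)"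
      using b(1) unfolding rational_family_def ring_of_integers_def by blast
    have "\<exists>k :: int. q i = of_int k" if "i < n" for i
      using int[OF x q that] by (auto elim: Ints_cases)
    then obtain k :: "nat \<Rightarrow> int" where "\<And>i. i < n \<Longrightarrow> q i = of_int (k i)" by metis
    then have "x = (\<Sum>i<n. of_int (k i) * b i)" using q by simp
    then show "\<exists>k :: nat \<Rightarrow> int. x = (\<Sum>i<n. of_int (k i) * b i)" by blast
  next
    fix k :: "nat \<Rightarrow> int" and i assume "(\<Sum>i<n. of_int (k i) * b i) = 0" "i < n"
    then have "(\<Sum>i<n. of_rat (of_int (k i)) * b i) = 0" by simp
    with b(1)[unfolded rational_family_def, THEN conjunct2, THEN conjunct2, rule_format,
        of "\<lambda>i. of_int (k i)" i] \<open>i < n\<close>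
    have "of_int (k i) = (0 :: rat)" by blast
    then show "k i = 0" by simp
  qed (use b(2) in blast)
  then show ?thesis by blast
qed

text \<open>
  Two integral bases have the same length, the dimension of the field, and are integer combinations of each other.
  So each discriminant is a square multiple of the other, which forces equality.
\<close>

lemma discriminant_eq_family:
  assumes fam: "integral_family F n b"
  shows "of_int (discriminant F) = family_discriminant F n b"
proof -
  define bs where "bs = map b [0..<n]"
  have bO: "\<And>i. i < n \<Longrightarrow> b i \<in> ring_of_integers F" using fam by (simp add: integral_family_def)
  obtain D where D: "family_discriminant F n b = of_int D"
    using family_discriminant_Ints[of n b, OF bO] by (auto elim: Ints_cases)
  have cong: "family_discriminant F n (\<lambda>i. bs ! i) = family_discriminant F n b"
    unfolding family_discriminant_def by (intro arg_cong[of _ _ det] eq_matI) (auto simp: bs_def)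
  have "(\<Sum>i<n. of_int (k i) * bs ! i) = (\<Sum>i<n. of_int (k i) * b i)" for k :: "nat \<Rightarrow> int"
    by (intro sum.cong) (auto simp: bs_def)
  moreover have "bs ! i = b i" if "i < n" for i using that by (simp add: bs_def)
  ultimately have "integral_family F n (\<lambda>i. bs ! i)"
    using fam unfolding integral_family_def by simp
  then have bs: "integral_basis F bs" "basis_discriminant F bs = of_int D"
    using cong D by (auto simp: integral_basis_iff_family[OF F] basis_discriminant_eq bs_def)
  have change: "\<exists>k :: int. E = k ^ 2 * D"
    if b: "integral_family F n b" "family_discriminant F n b = of_int D"
      and c: "integral_family F n c" "family_discriminant F n c = of_int E" for b c D E
  proof -
    have "\<exists>k :: nat \<Rightarrow> int. c i = (\<Sum>j<n. of_int (k j) * b j)" if "i < n" for i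
      using b(1) c(1) that unfolding integral_family_def by blast
    then obtain C :: "nat \<Rightarrow> nat \<Rightarrow> int" where C: "\<And>i. i < n \<Longrightarrow> c i = (\<Sum>j<n. of_int (C i j) * b j)" by metis
    have "family_discriminant F n c = det (mat n n (\<lambda>(i, j). of_int (C i j))) ^ 2 * family_discriminant F n b"
      by (rule family_discriminant_change)
         (use b(1) C in \<open>auto simp: integral_family_def ring_of_integers_def\<close>)
    also have "mat n n (\<lambda>(i, j). of_int (C i j) :: complex) = map_mat of_int (mat n n (\<lambda>(i, j). C i j))"
      by (rule eq_matI) auto
    also have "det \<dots> = of_int (det (mat n n (\<lambda>(i, j). C i j)))" by (rule of_int_hom.hom_det)
    finally have "(of_int E :: complex) = of_int (det (mat n n (\<lambda>(i, j). C i j)) ^ 2 * D)"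
      by (simp add: b(2) c(2))
    then show ?thesis using of_int_eq_iff by blast
  qed
  have uniq: "E = D" if E: "integral_basis F cs" "of_int E = basis_discriminant F cs" for E cs
  proof -
    have cs: "integral_family F (length cs) (\<lambda>i. cs ! i)" using E(1) by (simp add: integral_basis_iff_family[OF F])
    have "length cs = n"
      using rational_family_dim[OF integral_imp_rational_family[OF cs]]
        rational_family_dim[OF integral_imp_rational_family[OF fam]] by simp
    with cs E(2) have c: "integral_family F n (\<lambda>i. cs ! i)" "family_discriminant F n (\<lambda>i. cs ! i) = of_int E"
      by (simp_all add: basis_discriminant_eq)
    obtain k l :: int where kl: "E = k ^ 2 * D" "D = l ^ 2 * E"
      using change[OF fam D c] change[OF c fam D] by blast
    show ?thesis
    proof (cases "D = 0")
      case False
      have "D * 1 = D * (l ^ 2 * k ^ 2)" using kl by (metis mult.assoc mult.commute mult.right_neutral)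
      with False have "l ^ 2 * k ^ 2 = 1" by simp
      then have "k ^ 2 = 1" using zmult_eq_1_iff[of "l ^ 2" "k ^ 2"] zero_le_power2[of k] by linarith
      with kl(1) show ?thesis by simp
    next
      case True
      with kl(1) show ?thesis by simp
    qed
  qed
  have "discriminant F = D"
    unfolding discriminant_def
  proof (rule the_equality)
    show "\<exists>cs. integral_basis F cs \<and> of_int D = basis_discriminant F cs" using bs by auto
    fix E assume "\<exists>cs. integral_basis F cs \<and> of_int E = basis_discriminant F cs"
    then obtain cs where "integral_basis F cs" "of_int E = basis_discriminant F cs" by (elim exE conjE)
    then show "E = D" by (rule uniq)
  qed
  then show ?thesis using D by simp
qed

text \<open>
  The traces are the result of applying the Gram matrix of the trace form to the coordinates of \<open>z\<close>.
  By Cramer's rule the determinant of that matrix, which is the discriminant, clears the denominators.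
\<close>

lemma discriminant_times_integral:
  assumes fam: "integral_family F n b" and z: "z \<in> F"
    and tr: "\<And>i. i < n \<Longrightarrow> field_trace F (b i * z) \<in> \<int>"
  shows "algebraic_int (of_int (discriminant F) * z)"
proof -
  have bF: "b i \<in> F" and bO: "b i \<in> ring_of_integers F" if "i < n" for i
    using fam that by (auto simp: integral_family_def ring_of_integers_def)
  obtain q :: "nat \<Rightarrow> rat" where q: "z = (\<Sum>i<n. of_rat (q i) * b i)"
    using integral_imp_rational_family[OF fam] z unfolding rational_family_def by blast
  let ?G = "mat n n (\<lambda>(i, j). field_trace F (b i * b j))"
  let ?v = "vec n (\<lambda>j. of_rat (q j)) :: complex vec"
  have Gv: "(?G *\<^sub>v ?v) $ i = field_trace F (b i * z)" if i: "i < n" for i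
  proof -
    have "b i * z = (\<Sum>j<n. of_rat (q j) * (b i * b j))"
      by (simp add: q sum_distrib_left mult.left_commute)
    then have "field_trace F (b i * z) = (\<Sum>j<n. of_rat (q j) * field_trace F (b i * b j))"
      using trace_combination[of n "\<lambda>j. of_rat (q j)" "\<lambda>j. b i * b j"] subfield_mult[OF F bF[OF i] bF] by simp
    also have "\<dots> = (?G *\<^sub>v ?v) $ i"
      using i by (simp add: scalar_prod_def atLeast0LessThan mult.commute)
    finally show ?thesis by simp
  qed
  have coef: "algebraic_int (of_int (discriminant F) * of_rat (q k) :: complex)" if k: "k < n" for k
  proof -
    have "det (replace_col ?G (?G *\<^sub>v ?v) k) = ?v $ k * det ?G"
      by (rule cramer_lemma_mat[OF _ _ k]) auto
    also have "\<dots> = of_int (discriminant F) * of_rat (q k)"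
      using k discriminant_eq_family[OF fam] by (simp add: family_discriminant_def)
    finally have eq: "det (replace_col ?G (?G *\<^sub>v ?v) k) = of_int (discriminant F) * of_rat (q k)" .
    have "algebraic_int (det (replace_col ?G (?G *\<^sub>v ?v) k))"
    proof (rule algebraic_int_det[of _ n])
      show "replace_col ?G (?G *\<^sub>v ?v) k \<in> carrier_mat n n" by (simp add: replace_col_def)
      fix i j assume ij: "i < n" "j < n"
      have "algebraic_int (field_trace F (b i * b j))"
        by (intro trace_algebraic_int ring_of_integers_closed bO ij)
      moreover have "algebraic_int ((?G *\<^sub>v ?v) $ i)"
        unfolding Gv[OF ij(1)] using tr[OF ij(1)] by (rule int_imp_algebraic_int)
      ultimately show "algebraic_int (replace_col ?G (?G *\<^sub>v ?v) k $$ (i, j))"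
        unfolding replace_col_def using ij by (simp del: index_mult_mat_vec)
    qed
    then show ?thesis by (simp only: eq)
  qed
  have "of_int (discriminant F) * z = (\<Sum>i<n. (of_int (discriminant F) * of_rat (q i)) * b i)"
    by (simp add: q sum_distrib_left mult.assoc)
  moreover have "algebraic_int \<dots>"
  proof (rule algebraic_int_sum)
    fix i assume "i \<in> {..<n}"
    then show "algebraic_int (of_int (discriminant F) * of_rat (q i) * b i)"
      using coef[of i] bO[of i] by (intro algebraic_int_times[OF coef]) (auto simp: ring_of_integers_def)
  qed
  ultimately show ?thesis by simp
qed

text \<open>
  The discriminant is the square of the determinant of the conjugates of the basis. Subtracting the row of
  \<open>\<tau>\<close> from that of \<open>\<sigma>\<close> makes a whole row divisible by \<open>x\<close>. Zero rows
  make the matrix square; they do not change its Gram matrix.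
\<close>

lemma embedding_difference_divides_discriminant:
  assumes fam: "integral_family F n b" and card: "card (embeddings F) \<le> n"
    and \<sigma>: "\<sigma> \<in> embeddings F" and \<tau>: "\<tau> \<in> embeddings F" and ne: "\<sigma> \<noteq> \<tau>"
    and x: "\<And>\<theta>. \<theta> \<in> ring_of_integers F \<Longrightarrow> \<exists>c. algebraic_int c \<and> \<sigma> \<theta> - \<tau> \<theta> = x * c"
  shows "\<exists>c. algebraic_int c \<and> of_int (discriminant F) = x * c"
proof -
  have bF: "b i \<in> F" and bO: "b i \<in> ring_of_integers F" if "i < n" for i
    using fam that by (auto simp: integral_family_def ring_of_integers_def)
  define m where "m = card (embeddings F)"
  obtain e where e: "bij_betw e {..<m} (embeddings F)"
    using ex_bij_betw_nat_finite[OF finite_embeddings] by (auto simp: m_def atLeast0LessThan)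
  have m: "m \<le> n" using card by (simp add: m_def)
  define s where "s = (\<lambda>i j. if i < m then e i (b j) else 0)"
  let ?S = "mat n n (\<lambda>(i, j). s i j)"
  have e_emb: "e i \<in> embeddings F" if "i < m" for i using e that by (auto simp: bij_betw_def)
  have s_int: "algebraic_int (s i j)" if "j < n" for i j
    using subfield_hom.hom_algebraic_int[OF embedding_hom[OF e_emb]] bO[OF that]
    by (auto simp: s_def ring_of_integers_def)
  have "mat n n (\<lambda>(i, j). field_trace F (b i * b j)) = ?S\<^sup>T * ?S"
  proof (rule eq_matI)
    fix i j assume "i < dim_row (?S\<^sup>T * ?S)" "j < dim_col (?S\<^sup>T * ?S)"
    then have ij: "i < n" "j < n" by auto
    have "(?S\<^sup>T * ?S) $$ (i, j) = (\<Sum>k<n. s k i * s k j)"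
      using ij by (simp add: scalar_prod_def atLeast0LessThan)
    also have "\<dots> = (\<Sum>k<m. e k (b i) * e k (b j))"
      using m by (intro sum.mono_neutral_cong_right) (auto simp: s_def)
    also have "\<dots> = (\<Sum>k<m. e k (b i * b j))"
      using subfield_hom.hom_mult[OF embedding_hom[OF e_emb]] bF ij by (intro sum.cong) auto
    also have "\<dots> = field_trace F (b i * b j)"
      unfolding field_trace_def by (rule sum.reindex_bij_betw[OF e])
    finally show "mat n n (\<lambda>(i, j). field_trace F (b i * b j)) $$ (i, j) = (?S\<^sup>T * ?S) $$ (i, j)"
      using ij by simp
  qed auto
  then have "family_discriminant F n b = det ?S\<^sup>T * det ?S"
    unfolding family_discriminant_def using det_mult[of "?S\<^sup>T" n ?S] by simp
  then have disc: "of_int (discriminant F) = det ?S * det ?S"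
    using discriminant_eq_family[OF fam] by (simp add: det_transpose[of _ n])
  obtain k l where k: "k < m" "e k = \<sigma>" and l: "l < m" "e l = \<tau>"
    using e \<sigma> \<tau> unfolding bij_betw_def by (metis imageE lessThan_iff)
  have kl: "k \<noteq> l" using k l ne by auto
  obtain c where c: "\<And>j. j < n \<Longrightarrow> algebraic_int (c j)" "\<And>j. j < n \<Longrightarrow> \<sigma> (b j) - \<tau> (b j) = x * c j"
    using x[OF bO] by metis
  let ?T = "mat n n (\<lambda>(i, j). if i = k then c j else s i j)"
  have "addrow (-1) k l ?S = multrow k x ?T"
    using k l m kl c(2) by (intro eq_matI) (auto simp: s_def algebra_simps)
  then have "det ?S = x * det ?T"
    using det_addrow[of l n k ?S "-1"] det_multrow[of k n ?T x] k l m kl by auto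
  moreover have "algebraic_int (det ?T)"
    using c(1) s_int by (intro algebraic_int_det[of _ n]) auto
  moreover have "algebraic_int (det ?S)"
    using s_int by (intro algebraic_int_det[of _ n]) auto
  ultimately show ?thesis
    unfolding disc by (intro exI[of _ "det ?T * det ?S"]) (auto intro: algebraic_int_times)
qed

end

section \<open>Imaginary quadratic fields\<close>

lemma i_sqrt_square: "d > 0 \<Longrightarrow> i_sqrt d * i_sqrt d = - of_int d"
proof -
  assume d: "d > 0"
  have "i_sqrt d * i_sqrt d = (\<i> * \<i>) * complex_of_real (sqrt (of_int d) * sqrt (of_int d))"
    unfolding i_sqrt_def of_real_mult by (simp only: mult_ac)
  then show ?thesis using d by simp
qed

lemma cnj_of_rat: "cnj (of_rat q) = of_rat q"
  by (cases q) (simp add: of_rat_rat)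

lemma of_rat_algebraic_int:
  assumes "algebraic_int (of_rat q :: complex)"
  shows "\<exists>m :: int. q = of_int m"
proof -
  have "(of_rat q :: complex) \<in> \<int>"
    by (rule rational_algebraic_int_is_int[OF assms]) simp
  then obtain m where "(of_rat q :: complex) = of_int m" by (elim Ints_cases)
  then have "(of_rat q :: complex) = of_rat (of_int m)" by simp
  then show ?thesis by (simp only: of_rat_eq_iff) blast
qed

lemma squarefree_rational_square:
  fixes Q :: rat and d :: int
  assumes d: "squarefree d" and "of_int d * Q\<^sup>2 = of_int m"
  shows "Q \<in> \<int>"
proof (cases Q)
  case (Fract a b)
  then have Q: "Q = of_int a / of_int b" by (simp add: Fract_of_int_quotient)
  have "of_int (d * a\<^sup>2) = (of_int (m * b\<^sup>2) :: rat)"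
    using assms(2) Fract(2) unfolding Q by (simp add: power_divide field_simps)
  then have "d * a\<^sup>2 = m * b\<^sup>2" by (simp only: of_int_eq_iff)
  then have "b\<^sup>2 dvd d * a\<^sup>2" by simp
  moreover have "coprime (b\<^sup>2) (a\<^sup>2)" using Fract(3) by (simp add: coprime_commute)
  ultimately have "b\<^sup>2 dvd d" by (simp add: coprime_dvd_mult_left_iff)
  then have "is_unit b" using d unfolding squarefree_def by blast
  then have "b = 1" using Fract(2) by simp
  then show ?thesis using Q by simp
qed

text \<open>
  Write the number as \<open>(P + Q \<surd>(-d)) / 2\<close> with rational \<open>P\<close> and \<open>Q\<close>. Its trace \<open>P\<close> and its norm
  \<open>(P\<^sup>2 + d Q\<^sup>2) / 4\<close> are integers. As \<open>d\<close> is squarefree, \<open>Q\<close> is an integer too, and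
  \<open>P\<^sup>2 + d Q\<^sup>2\<close> being divisible by 4 decides the parities of \<open>P\<close> and \<open>Q\<close>.
\<close>

lemma quadratic_integer_coordinates:
  fixes t u :: rat
  assumes d: "d > 0" "squarefree d"
    and int: "algebraic_int (of_rat t + of_rat u * quadratic_omega d)"
  shows "t \<in> \<int>" "u \<in> \<int>"
proof -
  let ?z = "of_rat t + of_rat u * quadratic_omega d"
  define half where "half \<longleftrightarrow> (- d) mod 4 = 1"
  \<comment> \<open>Both shapes of the quadratic integer are brought to the form \<open>(P + Q r) / 2\<close>.\<close>
  define P where "P = (if half then 2 * t + u else 2 * t)"
  define Q where "Q = (if half then u else 2 * u)"
  define r where "r = i_sqrt d"
  have cnj_r: "cnj r = - r" by (simp add: r_def i_sqrt_def)
  have rr: "r * r = - of_int d" unfolding r_def by (rule i_sqrt_square[OF d(1)])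
  have z: "?z = (of_rat P + of_rat Q * r) / 2"
    unfolding quadratic_omega_def P_def Q_def r_def half_def
    by (auto simp: of_rat_add of_rat_mult field_simps)
  have zz': "?z + cnj ?z = of_rat P" unfolding z by (simp add: cnj_of_rat cnj_r field_simps)
  have "algebraic_int (?z + cnj ?z)" by (rule algebraic_int_plus[OF int]) (use int in blast)
  then have "algebraic_int (of_rat P :: complex)" by (simp only: zz')
  from of_rat_algebraic_int[OF this] obtain p where p: "P = of_int p" by blast
  have "4 * (?z * cnj ?z) = of_rat (P\<^sup>2 + of_int d * Q\<^sup>2)"
  proof -
    have "4 * (?z * cnj ?z) = (of_rat P + of_rat Q * r) * (of_rat P - of_rat Q * r)"
      unfolding z by (simp add: cnj_of_rat cnj_r)
    also have "\<dots> = of_rat P * of_rat P - of_rat Q * of_rat Q * (r * r)"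
      by (simp add: algebra_simps)
    finally show ?thesis by (simp add: rr of_rat_add of_rat_mult power2_eq_square)
  qed
  then have zz: "?z * cnj ?z = of_rat ((P\<^sup>2 + of_int d * Q\<^sup>2) / 4)"
    by (simp add: of_rat_divide field_simps)
  have "algebraic_int (?z * cnj ?z)" by (rule algebraic_int_times[OF int]) (use int in blast)
  then have "algebraic_int (of_rat ((P\<^sup>2 + of_int d * Q\<^sup>2) / 4) :: complex)" by (simp only: zz)
  from of_rat_algebraic_int[OF this] obtain m where m: "(P\<^sup>2 + of_int d * Q\<^sup>2) / 4 = of_int m" by blast
  then have "of_int d * Q\<^sup>2 = of_int (4 * m - p\<^sup>2)" unfolding p by (simp add: field_simps)
  then have "Q \<in> \<int>" by (rule squarefree_rational_square[OF d(2)])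
  then obtain q where q: "Q = of_int q" by (elim Ints_cases)
  have "of_int (p\<^sup>2 + d * q\<^sup>2) = (of_int (4 * m) :: rat)" using m unfolding p q by (simp add: field_simps)
  then have eq: "p\<^sup>2 + d * q\<^sup>2 = 4 * m" by (simp only: of_int_eq_iff)
  have d4: "\<not> 4 dvd d"
  proof
    assume "4 dvd d"
    then have "(2 :: int)\<^sup>2 dvd d" by simp
    then have "is_unit (2 :: int)" by (rule squarefreeD[OF d(2)])
    then show False by simp
  qed
  have sq4: "\<exists>y. x\<^sup>2 = 4 * y + of_bool (odd x)" for x :: int
  proof (cases "even x")
    case True
    then obtain c where "x = 2 * c" by (elim evenE)
    then show ?thesis using True by (intro exI[of _ "c\<^sup>2"]) (simp add: power2_eq_square)
  next
    case False
    then obtain c where "x = 2 * c + 1" by (elim oddE)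
    then show ?thesis using False
      by (intro exI[of _ "c\<^sup>2 + c"]) (simp add: power2_eq_square algebra_simps)
  qed
  obtain A B where A: "p\<^sup>2 = 4 * A + of_bool (odd p)" and B: "q\<^sup>2 = 4 * B + of_bool (odd q)"
    using sq4 by blast
  have par: "4 * A + of_bool (odd p) + (4 * (d * B) + d * of_bool (odd q)) = 4 * m"
    using eq unfolding A B by (simp add: algebra_simps)
  have "t \<in> \<int> \<and> u \<in> \<int>"
  proof (cases half)
    case True
    then have "d mod 4 = 3" unfolding half_def by presburger
    with par have "even (p - q)"
      by (cases "odd p"; cases "odd q"; simp; presburger)
    then obtain c where "p - q = 2 * c" by (elim evenE)
    then have "of_int p - of_int q = (2 * of_int c :: rat)" by (metis of_int_diff of_int_mult of_int_numeral)
    then have "t = of_int c" using p q True unfolding P_def Q_def by simp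
    moreover have "u = of_int q" using q True unfolding Q_def by simp
    ultimately show ?thesis by simp
  next
    case False
    then have "d mod 4 \<noteq> 3" unfolding half_def by presburger
    moreover have "d mod 4 \<noteq> 0" using d4 by presburger
    ultimately have "even p \<and> even q"
      using par by (cases "odd p"; cases "odd q"; simp; presburger)
    then obtain a c where ac: "p = 2 * a" "q = 2 * c" by (elim conjE evenE)
    then have "t = of_int a" "u = of_int c" using p q False unfolding P_def Q_def by simp_all
    then show ?thesis by simp
  qed
  then show "t \<in> \<int>" "u \<in> \<int>" by auto
qed

lemma algebraic_int_i_sqrt: "algebraic_int (i_sqrt d)"
  unfolding i_sqrt_def by (intro algebraic_int_times algebraic_int_of_real algebraic_int_sqrt) auto

lemma quadratic_omega_relation:
  assumes d: "d > 0"
  shows "\<exists>T N :: int. quadratic_omega d * quadratic_omega d = of_int T * quadratic_omega d - of_int N"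
proof (cases "(- d) mod 4 = 1")
  case True
  then have "4 dvd d + 1" by presburger
  then obtain e where "d + 1 = 4 * e" by (elim dvdE)
  then have e: "d = 4 * e - 1" by simp
  let ?r = "i_sqrt d"
  have w: "quadratic_omega d = (1 + ?r) / 2" using True by (simp add: quadratic_omega_def)
  have de: "of_int d = (4 * of_int e - 1 :: complex)" using e by simp
  have "quadratic_omega d * quadratic_omega d = (1 + 2 * ?r + ?r * ?r) / 4"
    by (simp add: w field_simps)
  also have "\<dots> = of_int 1 * quadratic_omega d - of_int e"
    unfolding i_sqrt_square[OF d] de w by (simp add: field_simps)
  finally show ?thesis by blast
next
  case False
  then have "quadratic_omega d * quadratic_omega d = of_int 0 * quadratic_omega d - of_int d"
    using i_sqrt_square[OF d] by (simp add: quadratic_omega_def)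
  then show ?thesis by blast
qed

lemma algebraic_int_quadratic_omega:
  assumes d: "d > 0"
  shows "algebraic_int (quadratic_omega d)"
proof -
  obtain T N :: int where "quadratic_omega d * quadratic_omega d = of_int T * quadratic_omega d - of_int N"
    using quadratic_omega_relation[OF d] by blast
  then have "poly (map_poly of_int [:N, - T, 1:]) (quadratic_omega d) = 0"
    by (simp add: of_int_hom.map_poly_pCons_hom algebra_simps)
  moreover have "lead_coeff [:N, - T, 1:] = 1" by simp
  ultimately show ?thesis unfolding algebraic_int_altdef_ipoly by blast
qed

lemma Im_quadratic_omega_gt_1:
  assumes "d > 0" "d \<noteq> 1" "d \<noteq> 3"
  shows "Im (quadratic_omega d) > 1"
proof (cases "(- d) mod 4 = 1")
  case True
  then have "d \<ge> 5" using assms by presburger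
  then have "2 < sqrt (of_int d)" by (intro real_less_rsqrt) simp
  with True show ?thesis by (simp add: quadratic_omega_def i_sqrt_def)
next
  case False
  have "1 < sqrt (of_int d)" using assms by simp
  with False show ?thesis by (simp add: quadratic_omega_def i_sqrt_def)
qed

lemma det_two_by_two:
  fixes A :: "'a :: comm_ring_1 mat"
  assumes A: "A \<in> carrier_mat 2 2"
  shows "det A = A $$ (0, 0) * A $$ (1, 1) - A $$ (0, 1) * A $$ (1, 0)"
proof -
  have single: "det (mat_delete A i 0) = A $$ (1 - i, 1)" if "i < 2" for i
  proof -
    have "mat_delete A i 0 \<in> carrier_mat 1 1" using A by (simp add: mat_delete_def)
    then have "det (mat_delete A i 0) = mat_delete A i 0 $$ (0, 0)" by (rule det_single)
    also have "\<dots> = A $$ (1 - i, 1)" using A that by (auto simp: mat_delete_def less_2_cases_iff)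
    finally show ?thesis .
  qed
  have "det A = (\<Sum>i<2. A $$ (i, 0) * cofactor A i 0)"
    using laplace_expansion_column[OF A, of 0] by simp
  then show ?thesis
    by (simp add: numeral_2_eq_2 lessThan_Suc cofactor_def single[unfolded numeral_2_eq_2] mult.commute)
qed

lemma discriminant_imaginary_quadratic:
  assumes d: "d > 0" "squarefree d" and M: "M = adjoin_rat {i_sqrt d}"
  shows "of_int (discriminant M) = (quadratic_omega d - cnj (quadratic_omega d))\<^sup>2"
proof -
  let ?r = "i_sqrt d" and ?w = "quadratic_omega d"
  interpret M: simple_number_field ?r M
    by unfold_locales (simp_all add: algebraic_int_i_sqrt M)
  have rr: "?r * ?r = - of_int d" by (rule i_sqrt_square[OF d(1)])
  have cnj_r: "cnj ?r = - ?r" by (simp add: i_sqrt_def)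
  have r0: "?r \<noteq> - ?r" using d(1) by (simp add: i_sqrt_def)
  have wM: "?w \<in> M"
    unfolding quadratic_omega_def using M.\<xi>_in subfield_of_int[OF M.F, of 2]
    by (auto intro!: subfield_divide[OF M.F] subfield_add[OF M.F] subfield_1[OF M.F])
  have rw: "\<exists>a b :: rat. ?r = of_rat a + of_rat b * ?w \<and> b \<noteq> 0"
  proof (cases "(- d) mod 4 = 1")
    case True
    then have "?r = of_rat (- 1) + of_rat 2 * ?w" by (simp add: quadratic_omega_def field_simps)
    then show ?thesis by (intro exI[of _ "- 1"] exI[of _ 2]) simp
  next
    case False
    then have "?r = of_rat 0 + of_rat 1 * ?w" by (simp add: quadratic_omega_def)
    then show ?thesis by (intro exI[of _ 0] exI[of _ 1]) simp
  qed
  have poly_rep: "\<exists>a b :: rat. poly p ?r = of_rat a + of_rat b * ?r" if "p \<in> polys_over \<rat>" for p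
    using that
  proof (induction p)
    case 0
    show ?case by (intro exI[of _ 0]) simp
  next
    case (pCons c p)
    then have c: "c \<in> \<rat>" and p: "p \<in> polys_over \<rat>"
      by (auto simp: polys_over_pCons[OF complex_subfield_Rats])
    obtain a b :: rat where ab: "poly p ?r = of_rat a + of_rat b * ?r" using pCons p by blast
    obtain c' where c': "c = of_rat c'" using c by (elim Rats_cases)
    have "poly (pCons c p) ?r = of_rat c' + of_rat a * ?r + of_rat b * (?r * ?r)"
      by (simp add: ab c' algebra_simps)
    also have "\<dots> = of_rat (c' - b * of_int d) + of_rat a * ?r"
      by (simp add: rr of_rat_diff of_rat_mult)
    finally show ?case by blast
  qed
  have rep: "\<exists>t u :: rat. x = of_rat t + of_rat u * ?w" if x: "x \<in> M" for x
  proof -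
    obtain a b :: rat where ab: "x = of_rat a + of_rat b * ?r"
      using M.rational_poly_representation[OF x] poly_rep by blast
    obtain a' b' :: rat where "?r = of_rat a' + of_rat b' * ?w" using rw by blast
    with ab have "x = of_rat (a + b * a') + of_rat (b * b') * ?w"
      by (simp add: of_rat_add of_rat_mult algebra_simps)
    then show ?thesis by blast
  qed
  let ?b = "\<lambda>i :: nat. if i = 0 then 1 else ?w"
  have two: "(\<Sum>i<2. g i) = g 0 + g 1" for g :: "nat \<Rightarrow> complex"
    by (simp add: numeral_2_eq_2 lessThan_Suc)
  have fam: "integral_family M 2 ?b"
    unfolding integral_family_def
  proof (intro conjI allI ballI impI)
    show "?b i \<in> ring_of_integers M" for i
      using wM subfield_1[OF M.F] algebraic_int_quadratic_omega[OF d(1)]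
      by (auto simp: ring_of_integers_def int_imp_algebraic_int)
    fix x assume x: "x \<in> ring_of_integers M"
    then have "x \<in> M" by (simp add: ring_of_integers_def)
    from rep[OF this] obtain t u :: rat where tu: "x = of_rat t + of_rat u * ?w" by blast
    have "algebraic_int (of_rat t + of_rat u * ?w)" using x tu by (simp add: ring_of_integers_def)
    from quadratic_integer_coordinates[OF d this] obtain t' u' :: int where "t = of_int t'" "u = of_int u'"
      by (metis Ints_cases)
    with tu show "\<exists>k :: nat \<Rightarrow> int. x = (\<Sum>i<2. of_int (k i) * ?b i)"
      by (intro exI[of _ "\<lambda>i. if i = 0 then t' else u'"]) (simp add: two)
  next
    fix k :: "nat \<Rightarrow> int" and i :: nat assume "(\<Sum>i<2. of_int (k i) * ?b i) = 0" and i: "i < 2"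
    then have eq: "of_int (k 0) + of_int (k 1) * ?w = 0" by (simp add: two)
    have "Im ?w \<noteq> 0" using d(1) by (simp add: quadratic_omega_def i_sqrt_def)
    with arg_cong[OF eq, of Im] have "k 1 = 0" by simp
    with eq i show "k i = 0" by (auto simp: less_2_cases_iff)
  qed
  have emb: "embeddings M = {restrict (\<lambda>x. x) M, restrict cnj M}"
  proof (intro equalityI subsetI)
    fix \<sigma> assume \<sigma>: "\<sigma> \<in> embeddings M"
    then interpret s: subfield_hom M \<sigma> by (rule M.embedding_hom)
    have "\<sigma> ?r * \<sigma> ?r = \<sigma> (?r * ?r)" using s.hom_mult[OF M.\<xi>_in M.\<xi>_in] by simp
    also have "\<dots> = ?r * ?r" using s.hom_of_int[of "- d"] by (simp add: rr)
    finally have "\<sigma> ?r = ?r \<or> \<sigma> ?r = - ?r" by (simp add: square_eq_iff)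
    moreover have "restrict cnj M \<in> embeddings M"
      using subfield_1[OF M.F]
      by (auto simp: embeddings_eq field_hom_def subfield_add[OF M.F] subfield_mult[OF M.F])
    ultimately show "\<sigma> \<in> {restrict (\<lambda>x. x) M, restrict cnj M}"
      using M.embedding_eqI[OF \<sigma> M.inclusion_embedding] M.embedding_eqI[OF \<sigma>, of "restrict cnj M"] M.\<xi>_in cnj_r
      by auto
  next
    fix \<sigma> assume "\<sigma> \<in> {restrict (\<lambda>x. x) M, restrict cnj M}"
    then show "\<sigma> \<in> embeddings M"
      using M.inclusion_embedding subfield_1[OF M.F]
      by (auto simp: embeddings_eq field_hom_def subfield_add[OF M.F] subfield_mult[OF M.F])
  qed
  have ne: "restrict (\<lambda>x. x) M \<noteq> restrict cnj M"
    using r0 cnj_r M.\<xi>_in by (metis restrict_apply')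
  have tr: "field_trace M x = x + cnj x" if "x \<in> M" for x
    unfolding field_trace_def emb using ne that by simp
  have "family_discriminant M 2 ?b = field_trace M 1 * field_trace M (?w * ?w) - field_trace M ?w * field_trace M ?w"
    unfolding family_discriminant_def by (subst det_two_by_two) auto
  also have "\<dots> = (1 + 1) * (?w * ?w + cnj ?w * cnj ?w) - (?w + cnj ?w) * (?w + cnj ?w)"
    using tr[OF subfield_1[OF M.F]] tr[OF wM] tr[OF subfield_mult[OF M.F wM wM]] by simp
  also have "\<dots> = (?w - cnj ?w)\<^sup>2" by (simp add: power2_eq_square algebra_simps)
  finally show ?thesis using M.discriminant_eq_family[OF fam] by simp
qed

section \<open>Adjoining the quadratic integer to a totally real field\<close>

lemma quadratic_roots_sum:
  fixes w v T N :: complex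
  assumes "w * w = T * w - N" "v * v = T * v - N" "w \<noteq> v"
  shows "w + v = T"
proof -
  have "(w - v) * (w + v - T) = (w * w - T * w) - (v * v - T * v)" by (simp add: algebra_simps)
  also have "\<dots> = 0" unfolding assms(1,2) by simp
  finally show ?thesis using assms(3) by simp
qed

lemma quadratic_multiply:
  fixes w T N k x y u v :: complex
  assumes "w * w = T * w - N"
  shows "k + (x + y * w) * (u + v * w) = (k + x * u - N * (y * v)) + (x * v + y * u + T * (y * v)) * w"
proof -
  have "k + (x + y * w) * (u + v * w) = k + x * u + (x * v + y * u) * w + y * v * (w * w)"
    by (simp add: algebra_simps)
  also have "\<dots> = (k + x * u - N * (y * v)) + (x * v + y * u + T * (y * v)) * w"
    unfolding assms by (simp add: algebra_simps)
  finally show ?thesis .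
qed

lemma bezout_multiply:
  fixes p D q s y :: complex
  assumes "p * D + q * s = 1"
  shows "y = p * (D * y) + q * (s * y)"
proof -
  have "p * (D * y) + q * (s * y) = (p * D + q * s) * y" by (simp add: algebra_simps)
  with assms show ?thesis by simp
qed

lemma bezout_of_difference:
  fixes p q g f x y :: complex
  assumes "p * (x * g) + q * (f * (y - x))\<^sup>2 = 1"
  shows "x * (p * g + q * f\<^sup>2 * (x - (y + y))) + y * (q * f\<^sup>2 * y) = 1"
  unfolding assms[symmetric] by (simp add: power2_eq_square algebra_simps)

lemma coprime_product_divides:
  fixes x y k l z e1 e2 :: complex
  assumes "x * k + y * l = 1" "z = x * e1" "z = y * e2"
  shows "z = x * y * (e2 * k + e1 * l)"
proof -
  have "x * y * (e2 * k + e1 * l) = (x * k) * (y * e2) + (y * l) * (x * e1)"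
    by (simp add: algebra_simps)
  also have "\<dots> = (x * k + y * l) * z"
    unfolding assms(2)[symmetric] assms(3)[symmetric] by (simp only: distrib_right)
  finally show ?thesis unfolding assms(1) by simp
qed

text \<open>
  The arithmetic of the quadratic field enters only through \<open>w_coordinates\<close>, which says that \<open>1, w\<close> is an integral
  basis, and through \<open>bezout\<close>, which expresses coprimality of the discriminants.
\<close>

locale imaginary_quadratic_extension = L: simple_number_field \<xi> L
  for \<xi> :: complex and L :: "complex set" +
  fixes w :: complex and n :: nat and b :: "nat \<Rightarrow> complex" and T N u0 v0 :: int
  assumes real_embeddings: "\<And>\<sigma> x. \<sigma> \<in> embeddings L \<Longrightarrow> x \<in> L \<Longrightarrow> \<sigma> x \<in> \<real>"
    and w_relation: "w * w = of_int T * w - of_int N"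
    and Im_w: "Im w > 1"
    and w_coordinates: "\<And>t u :: rat. algebraic_int (of_rat t + of_rat u * w) \<Longrightarrow> t \<in> \<int> \<and> u \<in> \<int>"
    and fam: "integral_family L n b" and card_embeddings: "card (embeddings L) \<le> n"
    and bezout: "of_int u0 * of_int (discriminant L) + of_int v0 * (w - cnj w)\<^sup>2 = (1 :: complex)"
begin

lemma w_int: "algebraic_int w"
proof -
  have "poly (map_poly of_int [:N, - T, 1:]) w = 0"
    using w_relation by (simp add: of_int_hom.map_poly_pCons_hom algebra_simps)
  moreover have "lead_coeff [:N, - T, 1:] = 1" by simp
  ultimately show ?thesis unfolding algebraic_int_altdef_ipoly by blast
qed

lemma w_ne_cnj: "w \<noteq> cnj w"
  using Im_w by (auto simp: complex_eq_iff)

lemma w_plus_cnj: "w + cnj w = of_int T"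
proof (rule quadratic_roots_sum[OF w_relation _ w_ne_cnj])
  show "cnj w * cnj w = of_int T * cnj w - of_int N"
    using arg_cong[OF w_relation, of cnj] by simp
qed

lemma hom_w:
  assumes "subfield_hom E \<tau>" "w \<in> E"
  shows "\<tau> w = w \<or> \<tau> w = cnj w"
proof -
  interpret subfield_hom E \<tau> by fact
  have "\<tau> w * \<tau> w = \<tau> (of_int T * w - of_int N)"
    using hom_mult[OF assms(2,2)] by (simp add: w_relation)
  also have "\<dots> = of_int T * \<tau> w - of_int N"
    using assms(2) by (simp add: hom_diff hom_mult hom_of_int subfield_of_int[OF sub] subfield_mult[OF sub])
  finally have t: "\<tau> w * \<tau> w = of_int T * \<tau> w - of_int N" .
  show ?thesis
  proof (cases "\<tau> w = w")
    case False
    then have "\<tau> w + w = of_int T" by (rule quadratic_roots_sum[OF t w_relation])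
    then have "w + \<tau> w = w + cnj w" unfolding w_plus_cnj by (simp only: add.commute)
    then show ?thesis by simp
  qed simp
qed

lemma inclusion: "restrict (\<lambda>x. x) L \<in> embeddings L"
  by (rule L.inclusion_embedding)

lemma L_real: "x \<in> L \<Longrightarrow> x \<in> \<real>"
  using real_embeddings[OF inclusion] by force

lemma cnj_embedding: "\<sigma> \<in> embeddings L \<Longrightarrow> x \<in> L \<Longrightarrow> cnj (\<sigma> x) = \<sigma> x"
  using real_embeddings Reals_cnj_iff by blast

lemma w_independent:
  assumes "x \<in> \<real>" "y \<in> \<real>" "x' \<in> \<real>" "y' \<in> \<real>" "x + y * w = x' + y' * w"
  shows "x = x'" "y = y'"
proof -
  obtain p q p' q' where r: "x = of_real p" "y = of_real q" "x' = of_real p'" "y' = of_real q'"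
    using assms by (auto elim!: Reals_cases)
  have "q * Im w = q' * Im w" using arg_cong[OF assms(5), of Im] r by simp
  then show "y = y'" using Im_w r by simp
  with assms(5) show "x = x'" by simp
qed

lemma ipoly_cnj: "poly (map_poly of_int p) (cnj z) = cnj (poly (map_poly of_int p) z)"
proof -
  interpret subfield_hom UNIV cnj
    by unfold_locales (auto simp: complex_subfield_def field_hom_def)
  show ?thesis using hom_ipoly[of z p] by simp
qed

text \<open>
  For the inverse of \<open>z \<noteq> 0\<close>, note that \<open>z * cnj z\<close> is real and so lies in \<open>L\<close>.
\<close>

lemma subfield_coordinates: "complex_subfield {x + y * w | x y. x \<in> L \<and> y \<in> L}"
  (is "complex_subfield ?S")
proof -
  have in_S: "x + y * w \<in> ?S" if "x \<in> L" "y \<in> L" for x y using that by blast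
  note cl = subfield_mult[OF L.F] subfield_add[OF L.F] subfield_diff[OF L.F] subfield_of_int[OF L.F]
    subfield_minus[OF L.F] subfield_0[OF L.F]
  have mult: "z * z' \<in> ?S" if "z \<in> ?S" "z' \<in> ?S" for z z'
  proof -
    obtain x y x' y' where z: "z = x + y * w" "z' = x' + y' * w" "x \<in> L" "y \<in> L" "x' \<in> L" "y' \<in> L"
      using \<open>z \<in> ?S\<close> \<open>z' \<in> ?S\<close> by auto
    have "z * z' = (0 + x * x' - of_int N * (y * y')) + (x * y' + y * x' + of_int T * (y * y')) * w"
      unfolding z using quadratic_multiply[OF w_relation, of 0 x y x' y'] by simp
    also have "\<dots> \<in> ?S" using z by (intro in_S cl)
    finally show ?thesis .
  qed
  have scalar: "x \<in> ?S" if "x \<in> L" for x using in_S[OF that cl(6)] by simp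
  show ?thesis
    unfolding complex_subfield_def
  proof (intro conjI ballI)
    show "1 \<in> ?S" by (rule scalar[OF subfield_1[OF L.F]])
    fix z assume z: "z \<in> ?S"
    then obtain x y where xy: "z = x + y * w" "x \<in> L" "y \<in> L" by blast
    show "inverse z \<in> ?S"
    proof (cases "z = 0")
      case True
      then show ?thesis using scalar[OF cl(6)] by simp
    next
      case False
      have cw: "cnj w = of_int T - w" using w_plus_cnj by (simp add: eq_diff_eq add.commute)
      have real: "cnj x = x" "cnj y = y" using xy(2,3) L_real Reals_cnj_iff by auto
      have "cnj z = cnj x + cnj y * cnj w" by (simp add: xy)
      then have cz: "cnj z = (x + of_int T * y) + (- y) * w"
        unfolding real cw by (simp add: algebra_simps)
      have cS: "cnj z \<in> ?S" unfolding cz by (intro in_S cl xy)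
      obtain u v where uv: "z * cnj z = u + v * w" "u \<in> L" "v \<in> L" using mult[OF z cS] by blast
      have "u + v * w = of_real ((cmod z)\<^sup>2) + 0 * w"
        using complex_norm_square[of z] by (simp add: uv(1)[symmetric])
      then have "u = of_real ((cmod z)\<^sup>2)"
        using w_independent[of u v "of_real ((cmod z)\<^sup>2)" 0] L_real uv by auto
      then have u: "z * cnj z = u" using complex_norm_square[of z] by simp
      have "inverse z = cnj z * inverse u" using False unfolding u[symmetric] by simp
      also have "\<dots> \<in> ?S" by (intro mult cS scalar subfield_inverse[OF L.F] uv)
      finally show ?thesis .
    qed
    fix z' assume z': "z' \<in> ?S"
    show "z * z' \<in> ?S" by (rule mult[OF z z'])
    obtain x' y' where "z' = x' + y' * w" "x' \<in> L" "y' \<in> L" using z' by blast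
    then have "z - z' = (x - x') + (y - y') * w" "x - x' \<in> L" "y - y' \<in> L"
      using xy by (auto simp: algebra_simps intro: cl)
    then show "z - z' \<in> ?S" using in_S by simp
  qed
qed

text \<open>
  The coordinates of \<open>p(x + y w)\<close> are given by the same integer polynomials in \<open>x\<close> and \<open>y\<close> under every embedding.
  This replaces the extension of embeddings from \<open>L\<close> to the composite field.
\<close>

lemma ipoly_coordinates:
  assumes a: "x \<in> L" "y \<in> L"
  shows "\<exists>u\<in>L. \<exists>v\<in>L. \<forall>\<sigma>\<in>embeddings L. poly (map_poly of_int p) (\<sigma> x + \<sigma> y * w) = \<sigma> u + \<sigma> v * w"
proof (induction p)
  case 0
  have "poly (map_poly of_int 0) (\<sigma> x + \<sigma> y * w) = \<sigma> 0 + \<sigma> 0 * w" if "\<sigma> \<in> embeddings L" for \<sigma>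
    using subfield_hom.hom_0[OF L.embedding_hom[OF that]] by simp
  then show ?case using subfield_0[OF L.F] by blast
next
  case (pCons c p)
  then obtain u v where uv: "u \<in> L" "v \<in> L"
    and ev: "\<And>\<sigma>. \<sigma> \<in> embeddings L \<Longrightarrow> poly (map_poly of_int p) (\<sigma> x + \<sigma> y * w) = \<sigma> u + \<sigma> v * w"
    by blast
  let ?u = "of_int c + x * u - of_int N * (y * v)" and ?v = "x * v + y * u + of_int T * (y * v)"
  note cl = subfield_mult[OF L.F] subfield_add[OF L.F] subfield_diff[OF L.F] subfield_of_int[OF L.F]
  have "poly (map_poly of_int (pCons c p)) (\<sigma> x + \<sigma> y * w) = \<sigma> ?u + \<sigma> ?v * w" if \<sigma>: "\<sigma> \<in> embeddings L" for \<sigma>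
  proof -
    interpret s: subfield_hom L \<sigma> by (rule L.embedding_hom) fact
    have "poly (map_poly of_int (pCons c p)) (\<sigma> x + \<sigma> y * w)
        = of_int c + (\<sigma> x + \<sigma> y * w) * (\<sigma> u + \<sigma> v * w)"
      by (simp add: of_int_hom.map_poly_pCons_hom ev[OF \<sigma>])
    also have "\<dots> = (of_int c + \<sigma> x * \<sigma> u - of_int N * (\<sigma> y * \<sigma> v))
        + (\<sigma> x * \<sigma> v + \<sigma> y * \<sigma> u + of_int T * (\<sigma> y * \<sigma> v)) * w"
      by (rule quadratic_multiply[OF w_relation])
    also have "\<dots> = \<sigma> ?u + \<sigma> ?v * w"
      using a uv by (simp add: s.hom_add s.hom_diff s.hom_mult s.hom_of_int cl)
    finally show ?thesis .
  qed
  moreover have "?u \<in> L" "?v \<in> L" using a uv by (auto intro!: cl)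
  ultimately show ?case by blast
qed

text \<open>
  As \<open>\<theta>\<close> and its conjugates are real, a polynomial relation for \<open>\<theta>\<close> is preserved by replacing \<open>x, y, \<theta>\<close> by
  their conjugates, and then also by complex conjugation of the argument.
\<close>

lemma ipoly_transport:
  assumes xy: "x \<in> L" "y \<in> L" and th: "\<theta> \<in> L"
    and p: "poly (map_poly of_int p) (x + y * w) = \<theta>" and \<sigma>: "\<sigma> \<in> embeddings L"
  shows "poly (map_poly of_int p) (\<sigma> x + \<sigma> y * w) = \<sigma> \<theta>"
    and "poly (map_poly of_int p) (cnj (\<sigma> x + \<sigma> y * w)) = \<sigma> \<theta>"
proof -
  obtain u v where uv: "u \<in> L" "v \<in> L"
    and ev: "\<And>\<sigma>. \<sigma> \<in> embeddings L \<Longrightarrow> poly (map_poly of_int p) (\<sigma> x + \<sigma> y * w) = \<sigma> u + \<sigma> v * w"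
    using ipoly_coordinates[OF xy, of p] by blast
  have "u + v * w = \<theta> + 0 * w" using ev[OF inclusion] p xy uv by simp
  then have "u = \<theta>" "v = 0" using w_independent[of u v \<theta> 0] L_real uv th by auto
  then show *: "poly (map_poly of_int p) (\<sigma> x + \<sigma> y * w) = \<sigma> \<theta>"
    using ev[OF \<sigma>] subfield_hom.hom_0[OF L.embedding_hom[OF \<sigma>]] by simp
  show "poly (map_poly of_int p) (cnj (\<sigma> x + \<sigma> y * w)) = \<sigma> \<theta>"
    unfolding ipoly_cnj * by (rule cnj_embedding[OF \<sigma> th])
qed

lemma algebraic_int_conjugate:
  assumes xy: "x \<in> L" "y \<in> L" and int: "algebraic_int (x + y * w)" and \<sigma>: "\<sigma> \<in> embeddings L"
  shows "algebraic_int (\<sigma> x + \<sigma> y * w)"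
proof -
  obtain p where p: "poly (map_poly of_int p) (x + y * w) = 0" "lead_coeff p = (1 :: int)"
    using int unfolding algebraic_int_altdef_ipoly by blast
  have "poly (map_poly of_int p) (\<sigma> x + \<sigma> y * w) = 0"
    using ipoly_transport(1)[OF xy subfield_0[OF L.F] p(1) \<sigma>]
      subfield_hom.hom_0[OF L.embedding_hom[OF \<sigma>]] by simp
  with p(2) show ?thesis unfolding algebraic_int_altdef_ipoly by blast
qed

text \<open>
  The discriminant of \<open>L\<close> clears the denominator of \<open>y\<close>, because the traces of \<open>b i * (x + y w)\<close> over \<open>L\<close> are
  integral and so have integral coordinates. The discriminant of the quadratic field also clears it,
  as \<open>x + y w\<close> minus its complex conjugate is \<open>y (w - cnj w)\<close>. The two discriminants are coprime.
\<close>

lemma integral_coordinates: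
  assumes xy: "x \<in> L" "y \<in> L" and int: "algebraic_int (x + y * w)"
  shows "x \<in> ring_of_integers L" "y \<in> ring_of_integers L"
proof -
  have cnj_L: "cnj z = z" if "z \<in> L" for z using L_real[OF that] Reals_cnj_iff by blast
  have tr: "field_trace L (b i * y) \<in> \<int>" if i: "i < n" for i
  proof -
    have bi: "b i \<in> L" "algebraic_int (b i)"
      using fam i by (auto simp: integral_family_def ring_of_integers_def)
    note cl = subfield_mult[OF L.F bi(1)]
    have "(\<Sum>\<sigma>\<in>embeddings L. \<sigma> (b i) * (\<sigma> x + \<sigma> y * w))
        = field_trace L (b i * x) + field_trace L (b i * y) * w"
    proof -
      have "\<sigma> (b i) * (\<sigma> x + \<sigma> y * w) = \<sigma> (b i * x) + \<sigma> (b i * y) * w" if "\<sigma> \<in> embeddings L" for \<sigma>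
        using subfield_hom.hom_mult[OF L.embedding_hom[OF that]] bi xy by (simp add: algebra_simps)
      then show ?thesis
        by (simp add: field_trace_def sum.distrib sum_distrib_right)
    qed
    moreover have "algebraic_int (\<Sum>\<sigma>\<in>embeddings L. \<sigma> (b i) * (\<sigma> x + \<sigma> y * w))"
      using subfield_hom.hom_algebraic_int[OF L.embedding_hom] bi algebraic_int_conjugate[OF xy int]
      by (intro algebraic_int_sum algebraic_int_times) auto
    ultimately have ai: "algebraic_int (field_trace L (b i * x) + field_trace L (b i * y) * w)" by simp
    obtain t u where tu: "field_trace L (b i * x) = of_rat t" "field_trace L (b i * y) = of_rat u"
      using L.trace_Rats[OF cl[OF xy(1)]] L.trace_Rats[OF cl[OF xy(2)]] by (auto elim!: Rats_cases)
    have "u \<in> \<int>" using w_coordinates ai unfolding tu by blast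
    then show ?thesis unfolding tu by (auto elim!: Ints_cases)
  qed
  have D: "algebraic_int (of_int (discriminant L) * y)"
    by (rule L.discriminant_times_integral[OF fam xy(2) tr])
  have "(w - cnj w)\<^sup>2 * y = (w - cnj w) * ((x + y * w) - cnj (x + y * w))"
    by (simp add: cnj_L xy power2_eq_square algebra_simps)
  moreover have "algebraic_int \<dots>"
    by (intro algebraic_int_times algebraic_int_diff w_int int algebraic_int_cnj)
  ultimately have DM: "algebraic_int ((w - cnj w)\<^sup>2 * y)" by simp
  have "y = of_int u0 * (of_int (discriminant L) * y) + of_int v0 * ((w - cnj w)\<^sup>2 * y)"
    by (rule bezout_multiply[OF bezout])
  moreover have "algebraic_int \<dots>"
    by (intro algebraic_int_plus algebraic_int_times algebraic_int_of_int D DM)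
  ultimately have y: "algebraic_int y" by simp
  have "algebraic_int ((x + y * w) - y * w)"
    by (intro algebraic_int_diff int algebraic_int_times y w_int)
  then have "algebraic_int x" by simp
  with y xy show "x \<in> ring_of_integers L" "y \<in> ring_of_integers L" by (auto simp: ring_of_integers_def)
qed

end

section \<open>Generators of the composite field\<close>

locale composite_generator = imaginary_quadratic_extension +
  fixes a c \<alpha> :: complex
  assumes ac: "a \<in> L" "c \<in> L" and \<alpha>: "\<alpha> = a + c * w" and \<alpha>_int: "algebraic_int \<alpha>"
    and generates: "\<And>\<gamma>. \<gamma> \<in> ring_of_integers L \<or> \<gamma> = w \<Longrightarrow> \<exists>p :: int poly. \<gamma> = poly (map_poly of_int p) \<alpha>"
begin

lemma ac_int: "a \<in> ring_of_integers L" "c \<in> ring_of_integers L"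
  using integral_coordinates[OF ac] \<alpha>_int \<alpha> by auto

text \<open>
  Writing \<open>w\<close> as an integer polynomial in \<open>\<alpha>\<close> shows that \<open>\<alpha> - cnj \<alpha> = c (w - cnj w)\<close> divides \<open>w - cnj w\<close>.
\<close>

lemma c_unit: "\<exists>e. algebraic_int e \<and> c * e = 1"
proof -
  obtain p where p: "w = poly (map_poly of_int p) \<alpha>" using generates by blast
  have "algebraic_int (cnj \<alpha>)" using \<alpha>_int by blast
  then obtain e where e: "algebraic_int e"
    "poly (map_poly of_int p) \<alpha> - poly (map_poly of_int p) (cnj \<alpha>) = (\<alpha> - cnj \<alpha>) * e"
    using ipoly_diff_divisible[OF \<alpha>_int] by blast
  have "cnj a = a" "cnj c = c" using L_real ac Reals_cnj_iff by auto
  then have "\<alpha> - cnj \<alpha> = c * (w - cnj w)" by (simp add: \<alpha> algebra_simps)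
  with e(2) have "(w - cnj w) * (c * e) = (w - cnj w) * 1"
    unfolding ipoly_cnj p[symmetric] by (simp add: mult_ac)
  then have "c * e = 1" using w_ne_cnj by (metis mult_left_cancel right_minus_eq)
  with e(1) show ?thesis by blast
qed

text \<open>The image of \<open>\<alpha>\<close> under the extension of \<open>\<sigma>\<close> to the composite field that fixes \<open>w\<close>.\<close>

definition conjugate :: "(complex \<Rightarrow> complex) \<Rightarrow> complex" where
  "conjugate \<sigma> = \<sigma> a + \<sigma> c * w"

lemma conjugate_int: "\<sigma> \<in> embeddings L \<Longrightarrow> algebraic_int (conjugate \<sigma>)"
  unfolding conjugate_def using algebraic_int_conjugate[OF ac] \<alpha>_int \<alpha> by blast

lemma differences_divisible:
  assumes \<sigma>: "\<sigma> \<in> embeddings L" and \<tau>: "\<tau> \<in> embeddings L" and th: "\<theta> \<in> ring_of_integers L"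
  shows "\<exists>e. algebraic_int e \<and> \<sigma> \<theta> - \<tau> \<theta> = (conjugate \<sigma> - conjugate \<tau>) * e"
    and "\<exists>e. algebraic_int e \<and> \<sigma> \<theta> - \<tau> \<theta> = (conjugate \<sigma> - cnj (conjugate \<tau>)) * e"
proof -
  obtain p where p: "\<theta> = poly (map_poly of_int p) \<alpha>" using generates th by blast
  have thL: "\<theta> \<in> L" using th by (simp add: ring_of_integers_def)
  note tr = ipoly_transport[OF ac thL p[symmetric, unfolded \<alpha>], folded conjugate_def]
  show "\<exists>e. algebraic_int e \<and> \<sigma> \<theta> - \<tau> \<theta> = (conjugate \<sigma> - conjugate \<tau>) * e"
    using ipoly_diff_divisible[OF conjugate_int[OF \<sigma>] conjugate_int[OF \<tau>], of p] tr(1)[OF \<sigma>] tr(1)[OF \<tau>] by simp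
  have "algebraic_int (cnj (conjugate \<tau>))" using conjugate_int[OF \<tau>] by blast
  then show "\<exists>e. algebraic_int e \<and> \<sigma> \<theta> - \<tau> \<theta> = (conjugate \<sigma> - cnj (conjugate \<tau>)) * e"
    using ipoly_diff_divisible[OF conjugate_int[OF \<sigma>], of "cnj (conjugate \<tau>)" p] tr(1)[OF \<sigma>] tr(2)[OF \<tau>] by simp
qed

text \<open>
  The first factor divides the discriminant of \<open>L\<close>. The second minus the first is the unit \<open>\<tau> c\<close> times
  \<open>w - cnj w\<close>, whose square is coprime to that discriminant. So the factors are coprime, and as each divides
  \<open>\<sigma> \<theta> - \<tau> \<theta>\<close>, so does their product.
\<close>

lemma product_divides_difference:
  assumes \<sigma>: "\<sigma> \<in> embeddings L" and \<tau>: "\<tau> \<in> embeddings L" and ne: "\<sigma> \<noteq> \<tau>"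
    and th: "\<theta> \<in> ring_of_integers L"
  shows "\<exists>e. algebraic_int e \<and> \<sigma> \<theta> - \<tau> \<theta> = (conjugate \<sigma> - conjugate \<tau>) * (conjugate \<sigma> - cnj (conjugate \<tau>)) * e"
proof -
  let ?x = "conjugate \<sigma> - conjugate \<tau>" and ?y = "conjugate \<sigma> - cnj (conjugate \<tau>)"
  have ai: "algebraic_int ?x" "algebraic_int ?y"
    using conjugate_int[OF \<sigma>] conjugate_int[OF \<tau>] by (auto intro!: algebraic_int_diff)
  obtain g where g: "algebraic_int g" "of_int (discriminant L) = ?x * g"
    using L.embedding_difference_divides_discriminant[OF fam card_embeddings \<sigma> \<tau> ne
        differences_divisible(1)[OF \<sigma> \<tau>]] by blast
  obtain e where e: "algebraic_int e" "c * e = 1" using c_unit by blast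
  interpret t: subfield_hom L \<tau> by (rule L.embedding_hom) fact
  have e_inv: "e = inverse c" using e(2) by (metis inverse_unique)
  then have eL: "e \<in> L" using subfield_inverse[OF L.F ac(2)] by simp
  define f where "f = \<tau> e"
  have f: "algebraic_int f" unfolding f_def by (rule t.hom_algebraic_int[OF eL e(1)])
  have cf: "\<tau> c * f = 1" unfolding f_def using t.hom_mult[OF ac(2) eL] e(2) t.hom_1 by simp
  have yx: "?y - ?x = \<tau> c * (w - cnj w)"
    using cnj_embedding[OF \<tau>] ac by (simp add: conjugate_def algebra_simps)
  have "f * (?y - ?x) = (\<tau> c * f) * (w - cnj w)" unfolding yx by (simp only: mult_ac)
  then have w2: "w - cnj w = f * (?y - ?x)" using cf by simp
  \<comment> \<open>These witness comaximality: expand \<open>(?y - ?x)\<^sup>2\<close> in the Bezout identity and collect the multiples of \<open>?y\<^sup>2\<close> in \<open>?y * l\<close>.\<close>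
  define k l where "k = of_int u0 * g + of_int v0 * f\<^sup>2 * (?x - (?y + ?y))" and "l = of_int v0 * f\<^sup>2 * ?y"
  have kl: "?x * k + ?y * l = 1"
    unfolding k_def l_def
    by (rule bezout_of_difference) (use bezout in \<open>simp only: w2 g(2)\<close>)
  have kl_int: "algebraic_int k" "algebraic_int l"
    unfolding k_def l_def
    by (intro algebraic_int_plus algebraic_int_diff algebraic_int_times algebraic_int_power
        algebraic_int_of_int g f ai)+
  obtain e1 e2 where e12: "algebraic_int e1" "\<sigma> \<theta> - \<tau> \<theta> = ?x * e1"
    "algebraic_int e2" "\<sigma> \<theta> - \<tau> \<theta> = ?y * e2"
    using differences_divisible[OF \<sigma> \<tau> th] by blast
  have "\<sigma> \<theta> - \<tau> \<theta> = ?x * ?y * (e2 * k + e1 * l)"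
    by (rule coprime_product_divides[OF kl e12(2,4)])
  moreover have "algebraic_int (e2 * k + e1 * l)"
    by (intro algebraic_int_plus algebraic_int_times e12 kl_int)
  ultimately show ?thesis by blast
qed

text \<open>
  Let \<open>e\<close> be the quotient of \<open>\<sigma> \<theta> - \<tau> \<theta>\<close> by the product. A homomorphism \<open>\<rho>\<close> that makes \<open>e\<close> large carries
  \<open>\<sigma>\<close> and \<open>\<tau>\<close> to embeddings \<open>\<sigma>'\<close> and \<open>\<tau>'\<close>, and it fixes \<open>w\<close> or conjugates it. In both cases the absolute value of the
  image of the product is that of the product for \<open>\<sigma>'\<close> and \<open>\<tau>'\<close>, which the hypothesis bounds from below.
\<close>

lemma fixed_if_product_dominates:
  assumes th: "\<theta> \<in> ring_of_integers L"
    and dom: "\<And>\<sigma> \<tau>. \<sigma> \<in> embeddings L \<Longrightarrow> \<tau> \<in> embeddings L \<Longrightarrow> \<sigma> \<theta> \<noteq> \<tau> \<theta> \<Longrightarrow>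
      cmod (\<sigma> \<theta> - \<tau> \<theta>) < cmod ((conjugate \<sigma> - conjugate \<tau>) * (conjugate \<sigma> - cnj (conjugate \<tau>)))"
    and \<sigma>: "\<sigma> \<in> embeddings L" and \<tau>: "\<tau> \<in> embeddings L"
  shows "\<sigma> \<theta> = \<tau> \<theta>"
proof (rule ccontr)
  assume ne: "\<sigma> \<theta> \<noteq> \<tau> \<theta>"
  then have "\<sigma> \<noteq> \<tau>" by auto
  then obtain e where e: "algebraic_int e"
    "\<sigma> \<theta> - \<tau> \<theta> = (conjugate \<sigma> - conjugate \<tau>) * (conjugate \<sigma> - cnj (conjugate \<tau>)) * e"
    using product_divides_difference[OF \<sigma> \<tau> _ th] by blast
  have e0: "e \<noteq> 0" using e(2) ne by auto
  have thL: "\<theta> \<in> L" using th by (simp add: ring_of_integers_def)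
  let ?S = "{\<sigma> \<xi>, \<tau> \<xi>, w}"
  have "algebraic_over \<rat> z" if "z \<in> ?S" for z
    using that L.embedding_conj_algebraic_int[OF \<sigma>] L.embedding_conj_algebraic_int[OF \<tau>] w_int
    by (auto intro: algebraic_int_imp_algebraic_over_Rats)
  then obtain E \<rho> where E: "complex_subfield E" "?S \<subseteq> E" "e \<in> E" "field_hom E \<rho>" "cmod (\<rho> e) \<ge> 1"
    using large_conjugate[OF e(1) e0, of ?S] by auto
  interpret r: subfield_hom E \<rho> by unfold_locales (use E in auto)
  have wE: "w \<in> E" using E(2) by simp
  define \<sigma>' \<tau>' where "\<sigma>' = restrict (\<rho> \<circ> \<sigma>) L" and "\<tau>' = restrict (\<rho> \<circ> \<tau>) L"
  have \<sigma>': "\<sigma>' \<in> embeddings L" and \<tau>': "\<tau>' \<in> embeddings L"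
    unfolding \<sigma>'_def \<tau>'_def using E(2)
    by (auto intro!: L.embedding_compose \<sigma> \<tau> r.subfield_hom_axioms)
  have in_E: "\<sigma> z \<in> E" "\<tau> z \<in> E" if "z \<in> L" for z
    using L.embedding_range[OF \<sigma> E(1) _ that] L.embedding_range[OF \<tau> E(1) _ that] E(2) by auto
  have val: "\<rho> (\<sigma> z) = \<sigma>' z" "\<rho> (\<tau> z) = \<tau>' z" if "z \<in> L" for z
    using that by (simp_all add: \<sigma>'_def \<tau>'_def)
  note cl = subfield_mult[OF E(1)] subfield_add[OF E(1)] subfield_diff[OF E(1)]
  have cwE: "cnj w \<in> E"
  proof -
    have "cnj w = of_int T - w" using w_plus_cnj by (simp add: eq_diff_eq add.commute)
    then show ?thesis using cl(3)[OF subfield_of_int[OF E(1)] wE] by simp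
  qed
  have cnj_conjugate: "cnj (conjugate \<tau>) = \<tau> a + \<tau> c * cnj w" if "\<tau> \<in> embeddings L" for \<tau>
    using cnj_embedding[OF that] ac by (simp add: conjugate_def)
  let ?x = "conjugate \<sigma> - conjugate \<tau>" and ?y = "conjugate \<sigma> - cnj (conjugate \<tau>)"
  have xyE: "?x \<in> E" "?y \<in> E"
    unfolding cnj_conjugate[OF \<tau>] unfolding conjugate_def by (intro cl in_E ac wE cwE)+
  have \<rho>_form: "\<rho> ?x = (\<sigma>' a - \<tau>' a) + (\<sigma>' c - \<tau>' c) * \<rho> w"
    "\<rho> ?y = (\<sigma>' a - \<tau>' a) + \<sigma>' c * \<rho> w - \<tau>' c * \<rho> (cnj w)"
    unfolding cnj_conjugate[OF \<tau>] unfolding conjugate_def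
    using in_E ac wE cwE by (simp_all add: r.hom_add r.hom_diff r.hom_mult cl val algebra_simps)
  have norm: "cmod (\<rho> ?x * \<rho> ?y) = cmod ((conjugate \<sigma>' - conjugate \<tau>') * (conjugate \<sigma>' - cnj (conjugate \<tau>')))"
  proof -
    have s: "\<rho> w + \<rho> (cnj w) = w + cnj w"
      using arg_cong[OF w_plus_cnj, of \<rho>] r.hom_add[OF wE cwE] r.hom_of_int[of T] w_plus_cnj by simp
    consider "\<rho> w = w" "\<rho> (cnj w) = cnj w" | "\<rho> w = cnj w" "\<rho> (cnj w) = w"
      using hom_w[OF r.subfield_hom_axioms wE] s by force
    then show ?thesis
    proof cases
      case 1
      then show ?thesis unfolding \<rho>_form cnj_conjugate[OF \<tau>'] unfolding conjugate_def by (simp add: algebra_simps)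
    next
      case 2
      have "\<rho> ?x * \<rho> ?y = cnj ((conjugate \<sigma>' - conjugate \<tau>') * (conjugate \<sigma>' - cnj (conjugate \<tau>')))"
        unfolding \<rho>_form 2 using cnj_embedding[OF \<sigma>'] cnj_embedding[OF \<tau>'] ac
        by (simp add: conjugate_def algebra_simps)
      then show ?thesis by (simp only: complex_mod_cnj)
    qed
  qed
  have diff: "\<sigma>' \<theta> - \<tau>' \<theta> = \<rho> ?x * \<rho> ?y * \<rho> e"
  proof -
    have "\<sigma>' \<theta> - \<tau>' \<theta> = \<rho> (\<sigma> \<theta> - \<tau> \<theta>)" using in_E[OF thL] by (simp add: r.hom_diff val[OF thL])
    also have "\<dots> = \<rho> ?x * \<rho> ?y * \<rho> e"
      unfolding e(2) using xyE E(3) by (simp add: r.hom_mult cl)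
    finally show ?thesis .
  qed
  have "\<rho> (\<sigma> \<theta> - \<tau> \<theta>) \<noteq> 0" using r.hom_eq_0_iff[OF cl(3)] in_E[OF thL] ne by simp
  then have "\<sigma>' \<theta> \<noteq> \<tau>' \<theta>" using in_E[OF thL] by (simp add: r.hom_diff val[OF thL])
  from dom[OF \<sigma>' \<tau>' this]
  have lt: "cmod (\<sigma>' \<theta> - \<tau>' \<theta>) < cmod (\<rho> ?x * \<rho> ?y)" unfolding norm .
  have "cmod (\<rho> ?x * \<rho> ?y) * 1 \<le> cmod (\<rho> ?x * \<rho> ?y) * cmod (\<rho> e)"
    using E(5) by (intro mult_left_mono) auto
  also have "\<dots> = cmod (\<sigma>' \<theta> - \<tau>' \<theta>)" unfolding diff by (simp add: norm_mult)
  finally show False using lt by simp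
qed

text \<open>
  The two factors have the same real part \<open>A\<close>; their imaginary parts carry the estimates below.
\<close>

lemma factor_coordinates:
  assumes \<sigma>: "\<sigma> \<in> embeddings L" and \<tau>: "\<tau> \<in> embeddings L"
  obtains A p q where "\<sigma> c = of_real p" "\<tau> c = of_real q"
    "conjugate \<sigma> - conjugate \<tau> = Complex A (Im w * (p - q))"
    "conjugate \<sigma> - cnj (conjugate \<tau>) = Complex A (Im w * (p + q))"
    "of_real A = (\<sigma> a - \<tau> a) + (\<sigma> c - \<tau> c) * of_real (Re w)"
proof -
  obtain p q r s where rs: "\<sigma> c = of_real p" "\<tau> c = of_real q" "\<sigma> a = of_real r" "\<tau> a = of_real s"
    using real_embeddings[OF \<sigma>] real_embeddings[OF \<tau>] ac by (meson Reals_cases)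
  show thesis
    by (rule that[of p q "r - s + (p - q) * Re w"]) (simp_all add: rs conjugate_def complex_eq_iff algebra_simps)
qed

text \<open>
  The imaginary parts of the two factors multiply to \<open>(Im w)\<^sup>2 * (\<sigma> (c\<^sup>2) - \<tau> (c\<^sup>2))\<close>, and \<open>Im w > 1\<close>.
\<close>

lemma c_square_fixed:
  assumes \<sigma>: "\<sigma> \<in> embeddings L"
  shows "\<sigma> (c\<^sup>2) = c\<^sup>2"
proof -
  have c2: "c\<^sup>2 \<in> ring_of_integers L"
    unfolding power2_eq_square by (intro L.ring_of_integers_closed ac_int)
  have "\<sigma> (c\<^sup>2) = restrict (\<lambda>x. x) L (c\<^sup>2)"
  proof (rule fixed_if_product_dominates[OF c2 _ \<sigma> inclusion])
    fix \<sigma> \<tau> assume \<sigma>: "\<sigma> \<in> embeddings L" and \<tau>: "\<tau> \<in> embeddings L" and ne: "\<sigma> (c\<^sup>2) \<noteq> \<tau> (c\<^sup>2)"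
    obtain A p q where pq: "\<sigma> c = of_real p" "\<tau> c = of_real q"
      and x: "conjugate \<sigma> - conjugate \<tau> = Complex A (Im w * (p - q))"
      and y: "conjugate \<sigma> - cnj (conjugate \<tau>) = Complex A (Im w * (p + q))"
      using factor_coordinates[OF \<sigma> \<tau>] by metis
    have sq: "\<sigma> (c\<^sup>2) = of_real (p\<^sup>2)" "\<tau> (c\<^sup>2) = of_real (q\<^sup>2)"
      using subfield_hom.hom_power[OF L.embedding_hom[OF \<sigma>] ac(2)]
        subfield_hom.hom_power[OF L.embedding_hom[OF \<tau>] ac(2)] pq by simp_all
    have pos: "\<bar>(p - q) * (p + q)\<bar> > 0"
    proof -
      have "p\<^sup>2 \<noteq> q\<^sup>2"
      proof
        assume "p\<^sup>2 = q\<^sup>2"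
        with ne show False unfolding sq by (simp only: simp_thms)
      qed
      then show ?thesis by (simp add: power2_eq_iff eq_neg_iff_add_eq_0)
    qed
    have "cmod (\<sigma> (c\<^sup>2) - \<tau> (c\<^sup>2)) = \<bar>(p - q) * (p + q)\<bar>"
      unfolding sq of_real_diff[symmetric] norm_of_real by (simp add: power2_eq_square algebra_simps)
    also have "\<dots> < (Im w)\<^sup>2 * \<bar>(p - q) * (p + q)\<bar>"
      using pos Im_w one_less_power[of "Im w" 2] by simp
    also have "\<dots> = \<bar>Im w * (p - q)\<bar> * \<bar>Im w * (p + q)\<bar>"
      by (simp add: abs_mult power2_eq_square)
    also have "\<dots> \<le> cmod (Complex A (Im w * (p - q))) * cmod (Complex A (Im w * (p + q)))"
      using abs_Im_le_cmod[of "Complex A (Im w * (p - q))"] abs_Im_le_cmod[of "Complex A (Im w * (p + q))"]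
      by (intro mult_mono) auto
    finally show "cmod (\<sigma> (c\<^sup>2) - \<tau> (c\<^sup>2)) < cmod ((conjugate \<sigma> - conjugate \<tau>) * (conjugate \<sigma> - cnj (conjugate \<tau>)))"
      unfolding x y norm_mult .
  qed
  then show ?thesis using c2 by (simp add: ring_of_integers_def)
qed

lemma c_eq: "c = 1 \<or> c = - 1"
proof -
  have cL: "c\<^sup>2 \<in> L" using ac subfield_power[OF L.F] by blast
  have "c\<^sup>2 \<in> \<rat>" by (rule L.fixed_imp_rational[OF cL]) (rule c_square_fixed)
  moreover have "algebraic_int (c\<^sup>2)" using ac_int algebraic_int_power by (simp add: ring_of_integers_def)
  ultimately have "c\<^sup>2 \<in> \<int>" by (intro rational_algebraic_int_is_int)
  then obtain k :: int where k: "c\<^sup>2 = of_int k" by (elim Ints_cases)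
  obtain e where e: "algebraic_int e" "c * e = 1" using c_unit by blast
  have e2: "e\<^sup>2 = inverse (c\<^sup>2)" using e(2) by (metis inverse_unique power_inverse)
  have "e\<^sup>2 \<in> \<rat>" unfolding e2 using \<open>c\<^sup>2 \<in> \<rat>\<close> by (rule Rats_inverse)
  then have "e\<^sup>2 \<in> \<int>" using e(1) algebraic_int_power by (intro rational_algebraic_int_is_int) auto
  then obtain l :: int where l: "e\<^sup>2 = of_int l" by (elim Ints_cases)
  have "of_int (k * l) = (c * e)\<^sup>2" by (simp add: k l power_mult_distrib)
  then have "k * l = 1" using e(2) by (metis of_int_eq_1_iff one_power2)
  then have "k = 1 \<or> k = - 1" by (simp add: zmult_eq_1_iff) auto
  moreover have "k \<noteq> - 1"
  proof
    assume "k = - 1"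
    obtain r where "c = of_real r" using L_real[OF ac(2)] by (elim Reals_cases)
    with k \<open>k = - 1\<close> have "complex_of_real (r\<^sup>2) = of_real (- 1)" by simp
    then have "r\<^sup>2 = - 1" by (simp only: of_real_eq_iff)
    then show False by (metis zero_le_power2 neg_0_le_iff_le not_one_le_zero)
  qed
  ultimately show ?thesis using k by (simp add: power2_eq_1_iff)
qed

lemma embedding_c: "\<sigma> \<in> embeddings L \<Longrightarrow> \<sigma> c = c"
  using c_eq subfield_hom.hom_of_int[OF L.embedding_hom, of \<sigma> 1]
    subfield_hom.hom_of_int[OF L.embedding_hom, of \<sigma> "- 1"] by auto

text \<open>
  As \<open>c = \<plusminus>1\<close>, the first factor is \<open>\<sigma> a - \<tau> a\<close> itself, and the imaginary part of the second is \<open>\<plusminus>2 * Im w\<close>.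
\<close>

lemma a_fixed:
  assumes \<sigma>: "\<sigma> \<in> embeddings L"
  shows "\<sigma> a = a"
proof -
  have "\<sigma> a = restrict (\<lambda>x. x) L a"
  proof (rule fixed_if_product_dominates[OF ac_int(1) _ \<sigma> inclusion])
    fix \<sigma> \<tau> assume \<sigma>: "\<sigma> \<in> embeddings L" and \<tau>: "\<tau> \<in> embeddings L" and ne: "\<sigma> a \<noteq> \<tau> a"
    obtain A p q where pq: "\<sigma> c = of_real p" "\<tau> c = of_real q"
      and x: "conjugate \<sigma> - conjugate \<tau> = Complex A (Im w * (p - q))"
      and y: "conjugate \<sigma> - cnj (conjugate \<tau>) = Complex A (Im w * (p + q))"
      and A: "of_real A = (\<sigma> a - \<tau> a) + (\<sigma> c - \<tau> c) * of_real (Re w)"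
      using factor_coordinates[OF \<sigma> \<tau>] by metis
    have pc: "of_real p = c" "of_real q = c" using pq embedding_c[OF \<sigma>] embedding_c[OF \<tau>] by simp_all
    then have pq1: "p = q" by (metis of_real_eq_iff)
    have p1: "\<bar>p\<bar> = 1"
      using arg_cong[OF pc(1), of cmod] c_eq by auto
    have xa: "conjugate \<sigma> - conjugate \<tau> = \<sigma> a - \<tau> a"
      unfolding conjugate_def embedding_c[OF \<sigma>] embedding_c[OF \<tau>] by simp
    have "1 < \<bar>Im w * (p + q)\<bar>" using Im_w p1 unfolding pq1 by (simp add: abs_mult)
    also have "\<dots> \<le> cmod (conjugate \<sigma> - cnj (conjugate \<tau>))"
      unfolding y using abs_Im_le_cmod[of "Complex A (Im w * (p + q))"] by simp
    finally have "cmod (\<sigma> a - \<tau> a) * 1 < cmod (\<sigma> a - \<tau> a) * cmod (conjugate \<sigma> - cnj (conjugate \<tau>))"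
      using ne by (intro mult_strict_left_mono) auto
    then show "cmod (\<sigma> a - \<tau> a) < cmod ((conjugate \<sigma> - conjugate \<tau>) * (conjugate \<sigma> - cnj (conjugate \<tau>)))"
      unfolding norm_mult xa by simp
  qed
  then show ?thesis using ac by simp
qed

lemma a_Ints: "a \<in> \<int>"
proof (rule rational_algebraic_int_is_int)
  show "a \<in> \<rat>" by (rule L.fixed_imp_rational[OF ac(1)]) (rule a_fixed)
  show "algebraic_int a" using ac_int(1) by (simp add: ring_of_integers_def)
qed

text \<open>
  With \<open>a\<close> and \<open>c\<close> integers, every integer polynomial in \<open>\<alpha>\<close> is an integer combination of 1 and \<open>w\<close>;
  a real number of this form is an integer.
\<close>

lemma ring_of_integers_eq_Ints: "ring_of_integers L = \<int>"
proof (intro equalityI subsetI)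
  fix \<theta> assume th: "\<theta> \<in> ring_of_integers L"
  then obtain p where p: "\<theta> = poly (map_poly of_int p) \<alpha>" using generates by blast
  obtain a' c' :: int where ac': "a = of_int a'" "c = of_int c'"
    using a_Ints c_eq by (metis Ints_cases of_int_1 of_int_minus)
  have "\<exists>u v :: int. poly (map_poly of_int p) \<alpha> = of_int u + of_int v * w"
  proof (induction p)
    case 0
    show ?case by (intro exI[of _ 0]) simp
  next
    case (pCons k p)
    then obtain u v :: int where uv: "poly (map_poly of_int p) \<alpha> = of_int u + of_int v * w" by blast
    have "poly (map_poly of_int (pCons k p)) \<alpha> = of_int k + (of_int a' + of_int c' * w) * (of_int u + of_int v * w)"
      using uv by (simp add: of_int_hom.map_poly_pCons_hom \<alpha> ac')
    also have "\<dots> = of_int (k + a' * u - N * (c' * v)) + of_int (a' * v + c' * u + T * (c' * v)) * w"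
      unfolding of_int_add of_int_diff of_int_mult by (rule quadratic_multiply[OF w_relation])
    finally show ?case by blast
  qed
  then obtain u v :: int where "\<theta> + 0 * w = of_int u + of_int v * w" using p by auto
  then have "\<theta> = of_int u"
    using w_independent[of \<theta> 0 "of_int u" "of_int v"] th L_real by (auto simp: ring_of_integers_def)
  then show "\<theta> \<in> \<int>" by simp
qed (auto elim!: Ints_cases intro: L.of_int_in_ring_of_integers)

end

theorem theorem3:
  fixes f :: "int poly" and \<xi> \<alpha> :: complex and n :: nat and d :: int
    and L M K :: "complex set"
  assumes f_monic: "lead_coeff f = 1"
    and f_irreducible: "irreducible f"
    and f_degree: "degree f = n"
    and f_real_roots: "\<And>z :: complex. poly (map_poly of_int f) z = 0 \<Longrightarrow> z \<in> \<real>"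
    and xi_root: "poly (map_poly of_int f) \<xi> = 0"
    and L_def: "L = adjoin_rat {\<xi>}"
    and L_totally_real: "totally_real L"
    and L_degree: "field_degree L = n"
    and d_pos: "d > 0"
    and d_squarefree: "squarefree d"
    and M_def: "M = adjoin_rat {i_sqrt d}"
    and coprime_disc: "coprime (discriminant L) (discriminant M)"
    and K_def: "K = composite L M"
    and d_exceptions: "- d \<noteq> - 1" "- d \<noteq> - 3"
    and alpha_generator: "generates_power_integral_basis \<alpha> K"
  shows "\<exists>(x :: int) \<beta>. generates_power_integral_basis \<beta> L \<and>
           (\<alpha> = of_int x + \<beta> + quadratic_omega d \<or> \<alpha> = of_int x + \<beta> - quadratic_omega d)"
proof -
  let ?w = "quadratic_omega d"
  have \<xi>: "algebraic_int \<xi>"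
    unfolding algebraic_int_altdef_ipoly using f_monic xi_root by blast
  interpret L: simple_number_field \<xi> L by unfold_locales (fact \<xi> L_def)+
  interpret M: simple_number_field "i_sqrt d" M
    by unfold_locales (fact algebraic_int_i_sqrt M_def)+
  have "f \<noteq> 0" using f_monic by auto
  then have card: "card (embeddings L) \<le> n"
    using L.embeddings_finite_card(2)[OF _ xi_root] f_degree by simp
  have "number_field L" using L_totally_real by (simp add: totally_real_def)
  then obtain m b where "integral_family L m b" using L.integral_family_exists by blast
  moreover from this have "m = n"
    using rational_family_dim[OF L.integral_imp_rational_family] L_degree by simp
  ultimately have fam: "integral_family L n b" by simp
  obtain T N :: int where rel: "?w * ?w = of_int T * ?w - of_int N"
    using quadratic_omega_relation[OF d_pos] by blast
  obtain u v :: int where "u * discriminant L + v * discriminant M = 1"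
    using coprime_disc bezout_int[of "discriminant L" "discriminant M"] by auto
  then have "(of_int (u * discriminant L + v * discriminant M) :: complex) = of_int 1" by (simp only:)
  then have bez: "of_int u * of_int (discriminant L) + of_int v * (?w - cnj ?w)\<^sup>2 = (1 :: complex)"
    using discriminant_imaginary_quadratic[OF d_pos d_squarefree M_def] by simp
  interpret E: imaginary_quadratic_extension \<xi> L ?w n b T N u v
  proof unfold_locales
    show "\<sigma> x \<in> \<real>" if "\<sigma> \<in> embeddings L" "x \<in> L" for \<sigma> x
      using L_totally_real that by (auto simp: totally_real_def)
    show "1 < Im ?w" using Im_quadratic_omega_gt_1[OF d_pos] d_exceptions by simp
  qed (fact rel fam card bez | use quadratic_integer_coordinates[OF d_pos d_squarefree] in blast)+
  let ?S = "{x + y * ?w | x y. x \<in> L \<and> y \<in> L}"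
  have LK: "L \<subseteq> K" and MK: "M \<subseteq> K"
    unfolding K_def composite_def by (meson hull_subset le_sup_iff)+
  have wM: "?w \<in> M"
    unfolding quadratic_omega_def using M.\<xi>_in subfield_of_int[OF M.F, of 2]
    by (auto intro!: subfield_divide[OF M.F] subfield_add[OF M.F] subfield_1[OF M.F])
  have LS: "L \<subseteq> ?S"
  proof
    fix x assume "x \<in> L"
    then show "x \<in> ?S" using subfield_0[OF L.F] by (intro CollectI exI[of _ x] exI[of _ 0]) simp
  qed
  have "i_sqrt d \<in> ?S"
  proof (cases "(- d) mod 4 = 1")
    case True
    then have "i_sqrt d = of_int (- 1) + of_int 2 * ?w" by (simp add: quadratic_omega_def field_simps)
    then show ?thesis using subfield_of_int[OF L.F] by blast
  next
    case False
    then have "i_sqrt d = of_int 0 + of_int 1 * ?w" by (simp add: quadratic_omega_def)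
    then show ?thesis using subfield_of_int[OF L.F] by blast
  qed
  then have "M \<subseteq> ?S" unfolding M_def adjoin_rat_def by (intro hull_minimal E.subfield_coordinates) simp
  with LS have KS: "K \<subseteq> ?S"
    unfolding K_def composite_def by (intro hull_minimal E.subfield_coordinates) simp
  have \<alpha>K: "\<alpha> \<in> K" "algebraic_int \<alpha>" and gen: "ring_of_integers K = adjoin_int \<alpha>"
    using alpha_generator by (auto simp: generates_power_integral_basis_def ring_of_integers_def)
  obtain a c where ac: "a \<in> L" "c \<in> L" "\<alpha> = a + c * ?w" using \<alpha>K(1) KS by blast
  interpret G: composite_generator \<xi> L ?w n b T N u v a c \<alpha>
  proof unfold_locales
    fix \<gamma> assume "\<gamma> \<in> ring_of_integers L \<or> \<gamma> = ?w"
    then have "\<gamma> \<in> ring_of_integers K"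
      using LK MK wM E.w_int by (auto simp: ring_of_integers_def)
    then show "\<exists>p :: int poly. \<gamma> = poly (map_poly of_int p) \<alpha>"
      unfolding gen adjoin_int_def by blast
  qed (fact ac \<alpha>K)+
  obtain k :: int where k: "a = of_int k" using G.a_Ints by (elim Ints_cases)
  \<comment> \<open>Now \<open>\<alpha> = a \<plusminus> \<omega>\<close> with \<open>a\<close> an integer, so \<open>\<beta> = a\<close> and \<open>x = 0\<close> will do.\<close>
  have "adjoin_int a = \<int>"
  proof (intro equalityI subsetI)
    fix z assume "z \<in> adjoin_int a"
    then obtain p :: "int poly" where "z = poly (map_poly of_int p) (of_int k)"
      unfolding adjoin_int_def k by blast
    then show "z \<in> \<int>" by simp
  next
    fix z :: complex assume "z \<in> \<int>"
    then obtain l :: int where "z = of_int l" by (elim Ints_cases)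
    then have "z = poly (map_poly of_int [:l:]) a" by (simp add: of_int_hom.map_poly_pCons_hom)
    then show "z \<in> adjoin_int a" unfolding adjoin_int_def by blast
  qed
  then have "generates_power_integral_basis a L"
    using G.ac_int(1) G.ring_of_integers_eq_Ints by (simp add: generates_power_integral_basis_def)
  moreover have "\<alpha> = of_int 0 + a + ?w \<or> \<alpha> = of_int 0 + a - ?w"
    using G.c_eq ac(3) by auto
  ultimately show ?thesis by blast
qed

end
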